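(* Let $F$ be a field of odd characteristic $p$, let $r$ be an odd prime power not divisible by $p$, let $l\ge1$, and let $\mathfrak A_{p^l-1}$ be the dual polar scheme on $[{}^2A_{2(p^l-1)}(r)]$. If $F\mathfrak A_{p^l-1}$ is a local algebra, then $$F\mathfrak A_{p^l-1}\cong F[X_1,\dots,X_l]/(X_1^p,\dots,X_l^p)$$ as $F$-algebras.
   Context: Let $q=r^2$ and $d=p^l-1$. $[{}^2A_{2d}(r)]$ is $\mathbb F_q^{2d+1}$ with a non-degenerate Hermitian form. The dual polar scheme $\mathfrak A_d$ has point set = maximal totally isotropic subspaces (dimension $d$), relations $R_i=\{(x,y):\dim(x\cap y)=d-i\}$, $i=0,\dots,d$, with $0/1$ adjacency matrices $A_i$; $F\mathfrak A_d=\bigoplus_{i=0}^dFA_i$ is its adjacency algebra over $F$. A local algebra has a unique maximal ideal. *)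

theory Defs
  imports
    "HOL-Analysis.Cartesian_Space"
    "HOL-Number_Theory.Prime_Powers"
    "HOL-Library.Poly_Mapping"
    "HOL-Algebra.Module"
    "HOL-Algebra.QuotRing"
begin

section \<open>Algebras over a field\<close>

text \<open>
  An algebra over the field formed by a type \<open>'f\<close> is represented by a record of the
  type of HOL-Algebra's modules, every element of \<open>'f\<close> being a scalar.
\<close>

definition local_algebra :: "('f, 'a, 'm) module_scheme \<Rightarrow> bool" where
  "local_algebra A \<longleftrightarrow> (\<exists>!I. maximalideal I A)"

definition alg_isomorphic ::
  "('f, 'a, 'm) module_scheme \<Rightarrow> ('f, 'b, 'n) module_scheme \<Rightarrow> bool" where
  "alg_isomorphic A B \<longleftrightarrow>
     (\<exists>h \<in> ring_iso A B. \<forall>c. \<forall>x \<in> carrier A. h (c \<odot>\<^bsub>A\<^esub> x) = c \<odot>\<^bsub>B\<^esub> h x)"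

text \<open>The scalar action on cosets is written in the same style as \<^const>\<open>rcoset_mult\<close>.\<close>

definition quot_alg :: "('f, 'a, 'm) module_scheme \<Rightarrow> 'a set \<Rightarrow> ('f, 'a set) module" where
  "quot_alg A I =
     \<lparr>carrier = carrier (A Quot I), mult = mult (A Quot I), one = one (A Quot I),
      zero = zero (A Quot I), add = add (A Quot I),
      smult = (\<lambda>c C. \<Union>x\<in>C. I +>\<^bsub>A\<^esub> (c \<odot>\<^bsub>A\<^esub> x))\<rparr>"

section \<open>Polynomials in finitely many variables\<close>

text \<open>
  A polynomial maps monomials, i.e. finitely supported exponent functions, to coefficients;
  \<open>mpoly_alg l\<close> consists of the polynomials in the variables with index in \<open>{1..l}\<close>.
\<close>

definition mpoly_alg :: "nat \<Rightarrow> ('f::field, (nat \<Rightarrow>\<^sub>0 nat) \<Rightarrow>\<^sub>0 'f) module" where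
  "mpoly_alg l =
     \<lparr>carrier = {P. \<forall>m \<in> Poly_Mapping.keys P. Poly_Mapping.keys m \<subseteq> {1..l}},
      mult = (*), one = 1, zero = 0, add = (+),
      smult = (\<lambda>c P. Poly_Mapping.single 0 c * P)\<rparr>"

definition mvar :: "nat \<Rightarrow> (nat \<Rightarrow>\<^sub>0 nat) \<Rightarrow>\<^sub>0 'f::field" where
  "mvar i = Poly_Mapping.single (Poly_Mapping.single i 1) 1"

definition truncated_poly_alg ::
  "nat \<Rightarrow> nat \<Rightarrow> ('f::field, ((nat \<Rightarrow>\<^sub>0 nat) \<Rightarrow>\<^sub>0 'f) set) module" where
  "truncated_poly_alg l p =
     quot_alg (mpoly_alg l) (genideal (mpoly_alg l) ((\<lambda>i. mvar i ^ p) ` {1..l}))"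

section \<open>Adjacency algebras\<close>

definition adjacency_matrix :: "('x \<times> 'x) set \<Rightarrow> 'x \<Rightarrow> 'x \<Rightarrow> 'f::field" where
  "adjacency_matrix R x y = (if (x, y) \<in> R then 1 else 0)"

text \<open>
  Matrices with rows and columns indexed by the finite set \<open>X\<close> are functions that vanish
  outside \<open>X \<times> X\<close>; the relations \<open>R 0, \<dots>, R d\<close> are subsets of \<open>X \<times> X\<close>.
\<close>

definition adjacency_algebra ::
  "'x set \<Rightarrow> (nat \<Rightarrow> ('x \<times> 'x) set) \<Rightarrow> nat \<Rightarrow> ('f::field, 'x \<Rightarrow> 'x \<Rightarrow> 'f) module" where
  "adjacency_algebra X R d =
     \<lparr>carrier = {(\<lambda>x y. \<Sum>i\<le>d. c i * adjacency_matrix (R i) x y) | c :: nat \<Rightarrow> 'f. True},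
      mult = (\<lambda>M N x z. \<Sum>y\<in>X. M x y * N y z),
      one = (\<lambda>x y. if x \<in> X \<and> x = y then 1 else 0),
      zero = (\<lambda>x y. 0),
      add = (\<lambda>M N x y. M x y + N x y),
      smult = (\<lambda>a M x y. a * M x y)\<rparr>"

section \<open>Dual polar schemes of Hermitian spaces\<close>

text \<open>
  On a field with \<open>r\<^sup>2\<close> elements, \<open>a \<mapsto> a ^ r\<close> is the involutory automorphism.
\<close>

definition hermitian_form :: "nat \<Rightarrow> ('k::field ^ 'n \<Rightarrow> 'k ^ 'n \<Rightarrow> 'k) \<Rightarrow> bool" where
  "hermitian_form r H \<longleftrightarrow>
     (\<forall>u v w. H (u + v) w = H u w + H v w) \<and>
     (\<forall>a u w. H (a *s u) w = a * H u w) \<and>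
     (\<forall>u v. H v u = H u v ^ r)"

definition nondegenerate :: "('k::field ^ 'n \<Rightarrow> 'k ^ 'n \<Rightarrow> 'k) \<Rightarrow> bool" where
  "nondegenerate H \<longleftrightarrow> (\<forall>u. (\<forall>v. H u v = 0) \<longrightarrow> u = 0)"

definition totally_isotropic ::
  "('k::field ^ 'n \<Rightarrow> 'k ^ 'n \<Rightarrow> 'k) \<Rightarrow> ('k ^ 'n) set \<Rightarrow> bool" where
  "totally_isotropic H U \<longleftrightarrow> vec.subspace U \<and> (\<forall>u\<in>U. \<forall>v\<in>U. H u v = 0)"

definition dual_polar_points ::
  "('k::field ^ 'n \<Rightarrow> 'k ^ 'n \<Rightarrow> 'k) \<Rightarrow> ('k ^ 'n) set set" where
  "dual_polar_points H =
     {U. totally_isotropic H U \<and> (\<forall>W. totally_isotropic H W \<and> U \<subseteq> W \<longrightarrow> W = U)}"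

definition dual_polar_rel ::
  "('k::field ^ 'n \<Rightarrow> 'k ^ 'n \<Rightarrow> 'k) \<Rightarrow> nat \<Rightarrow> nat \<Rightarrow> (('k ^ 'n) set \<times> ('k ^ 'n) set) set" where
  "dual_polar_rel H d i =
     {(x, y). x \<in> dual_polar_points H \<and> y \<in> dual_polar_points H \<and> vec.dim (x \<inter> y) = d - i}"

definition dual_polar_algebra ::
  "('k::field ^ 'n \<Rightarrow> 'k ^ 'n \<Rightarrow> 'k) \<Rightarrow> nat \<Rightarrow>
   ('f::field, ('k ^ 'n) set \<Rightarrow> ('k ^ 'n) set \<Rightarrow> 'f) module" where
  "dual_polar_algebra H d = adjacency_algebra (dual_polar_points H) (dual_polar_rel H d) d"

end

theory Submission
  imports Defs
    "HOL-Number_Theory.Residues"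
    "HOL-Computational_Algebra.Polynomial"
    "HOL-Algebra.Ring_Divisibility"
begin

text \<open>
  Write \<open>d = p ^ l - 1\<close> and \<open>q = r\<^sup>2\<close>.  Let \<open>A\<^sub>1\<close> be the adjacency matrix of the relation \<open>R\<^sub>1\<close>.
  Its valency and its eigenvalue on differences of characteristic functions of isotropic vectors
  differ by \<open>r ^ (2 d + 1) + 1\<close>; in a local algebra they coincide, and Fermat's theorem then gives
  \<open>r = - 1\<close> modulo \<open>p\<close>.

  For such \<open>r\<close> we have \<open>q = 1\<close> modulo \<open>p\<close>, so Gaussian binomials become ordinary ones, and the
  number of maximal isotropic subspaces above a given non-maximal one is divisible by \<open>p\<close>.  Let
  \<open>E\<^sub>n(x, y)\<close> be the number modulo \<open>p\<close> of \<open>(d - n)\<close>-dimensional subspaces of the intersection of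
  \<open>x\<close> and \<open>y\<close>.  In the product of \<open>E\<^sub>i\<close> and \<open>E\<^sub>j\<close> only pairs \<open>(U, W)\<close> for which \<open>U + W\<close> is itself
  maximal survive, and counting these gives \<open>(i + j choose i) E\<^sub>i\<^sub>+\<^sub>j\<close>.  Hence the adjacency
  algebra is a divided power algebra truncated at \<open>p ^ l\<close>, which is freely generated by
  the \<open>E\<close> with index \<open>1, p, \<dots>, p ^ (l - 1)\<close> up to the vanishing of their \<open>p\<close>-th powers.
\<close>

section \<open>Counting subspaces over a finite field\<close>

text \<open>A local algebra offers no decomposition into eigenspaces, so all structure constants
  come from integer counts reduced modulo \<open>p\<close>. Locality is used twice: having a maximal
  ideal includes being a ring, and two non-units cannot add up to one. The latter applies to
  \<open>A - \<theta>\<close> and \<open>\<kappa> - A\<close>, where \<open>A\<close> is the matrix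
  of the first relation, \<open>\<kappa>\<close> its valency and \<open>\<theta>\<close> the other
  eigenvalue: both are singular and their sum is the scalar \<open>\<kappa> - \<theta>\<close>,
  which must therefore vanish. Since \<open>p - 1\<close> divides \<open>d\<close>, Fermat's theorem
  makes \<open>r ^ d\<close> equal to one there. The matrices are indexed by codimension because
  codimensions add: if \<open>U\<close> and \<open>W\<close> have codimensions \<open>i\<close> and
  \<open>j\<close> and their sum is maximal isotropic, then their intersection has codimension
  \<open>i + j\<close>. No codimension exceeds \<open>d\<close>, which is the truncation. That
  \<open>d + 1\<close> is a power of \<open>p\<close> makes the truncated divided power algebra a
  tensor product of \<open>l\<close> pieces: every index below \<open>p ^ l\<close> is written with
  \<open>l\<close> digits below \<open>p\<close>, one digit for each variable.\<close>

lemma card_eq_sum_fibres: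
  assumes "finite A" "finite B" "\<And>a. a \<in> A \<Longrightarrow> f a \<in> B"
  shows "card A = (\<Sum>b\<in>B. card {a \<in> A. f a = b})"
proof -
  have "(\<Sum>b\<in>B. \<Sum>a\<in>{a \<in> A. f a = b}. (1::nat)) = (\<Sum>a\<in>A. 1)"
    using assms by (intro sum.group) auto
  then show ?thesis by simp
qed

lemma card_const_fibres:
  assumes "finite A" "finite B" "\<And>a. a \<in> A \<Longrightarrow> f a \<in> B"
    and "\<And>b. b \<in> B \<Longrightarrow> card {a \<in> A. f a = b} = c"
  shows "card A = c * card B"
  using card_eq_sum_fibres[OF assms(1-3)] assms(4) by simp

lemma card_fibres_cong:
  assumes "finite A" "finite B" "\<And>a. a \<in> A \<Longrightarrow> f a \<in> B"
    and "\<And>b. b \<in> B \<Longrightarrow> [card {a \<in> A. f a = b} = c] (mod m)"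
  shows "[card A = c * card B] (mod m)"
proof -
  have "[(\<Sum>b\<in>B. card {a \<in> A. f a = b}) = (\<Sum>b\<in>B. c)] (mod m)"
    using assms(4) by (rule cong_sum)
  then show ?thesis
    using card_eq_sum_fibres[OF assms(1-3)] by (simp add: mult.commute)
qed

text \<open>There is no slack: at most \<open>n\<close> fibres of size at most \<open>c\<close> have
  to exhaust at least \<open>c * n\<close> elements. Upper bounds that come from counting roots of
  polynomials thereby become exact fibre sizes for the trace and the norm.\<close>

lemma card_fibres_extremal:
  assumes "finite A" "finite B" "\<And>a. a \<in> A \<Longrightarrow> f a \<in> B"
    and "\<And>b. b \<in> B \<Longrightarrow> card {a \<in> A. f a = b} \<le> c"
    and "c * n \<le> card A" "card B \<le> n" "b \<in> B"
  shows "card {a \<in> A. f a = b} = c"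
proof (rule ccontr)
  assume "card {a \<in> A. f a = b} \<noteq> c"
  then have "card {a \<in> A. f a = b} < c"
    using assms(4,7) by (meson le_neq_implies_less)
  then have "(\<Sum>b\<in>B. card {a \<in> A. f a = b}) < (\<Sum>b\<in>B. c)"
    using assms(2,4,7) by (intro sum_strict_mono_ex1) auto
  then have "card A < c * card B"
    using card_eq_sum_fibres[OF assms(1-3)] by (simp add: mult.commute)
  also have "\<dots> \<le> c * n" using assms(6) by simp
  finally show False using assms(5) by simp
qed

section \<open>Dimension and cardinality of spans\<close>

lemma span_of_subspace: "vec.subspace U \<Longrightarrow> vec.span U = U"
  by simp

lemma dim_span_Un_Int:
  assumes "vec.subspace U" "vec.subspace W"
  shows "vec.dim (vec.span (U \<union> W)) + vec.dim (U \<inter> W) = vec.dim U + vec.dim W"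
proof -
  have "vec.span (U \<union> W) = {x + y |x y. x \<in> U \<and> y \<in> W}"
    using vec.span_Un[of U W] by (simp only: assms span_of_subspace)
  then show ?thesis using vec.dim_sums_Int[OF assms] by simp
qed

lemma dim_span_insert:
  "a \<notin> vec.span S \<Longrightarrow> vec.dim (vec.span (insert a S)) = Suc (vec.dim S)"
  by (simp add: vec.dim_insert)

lemma mem_span_insert:
  assumes "vec.subspace U"
  shows "x \<in> vec.span (insert a U) \<longleftrightarrow> (\<exists>k. x - k *s a \<in> U)"
  using vec.span_breakdown_eq[of x a U] by (simp only: assms span_of_subspace)

lemma card_span_insert:
  fixes a :: "'k::{field,finite} ^ 'n"
  assumes "vec.subspace U" "a \<notin> U"
  shows "card (vec.span (insert a U)) = CARD('k) * card U"
proof -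
  have "bij_betw (\<lambda>(k,u). k *s a + u) (UNIV \<times> U) (vec.span (insert a U))"
    unfolding bij_betw_def
  proof
    show "inj_on (\<lambda>(k,u). k *s a + u) (UNIV \<times> U)"
    proof (rule inj_onI, clarsimp)
      fix k u k' u'
      assume u: "u \<in> U" "u' \<in> U" and eq: "k *s a + u = k' *s a + u'"
      have "(k - k') *s a = u' - u"
        using eq by (simp add: vector_sub_rdistrib algebra_simps)
      then have in_U: "(k - k') *s a \<in> U"
        using vec.subspace_diff[OF assms(1) u(2,1)] by simp
      have "k = k'"
      proof (rule ccontr)
        assume "k \<noteq> k'"
        then have "a = inverse (k - k') *s ((k - k') *s a)" by simp
        then show False using vec.subspace_scale[OF assms(1) in_U] assms(2) by metis
      qed
      then show "k = k' \<and> u = u'" using eq by simp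
    qed
    show "(\<lambda>(k,u). k *s a + u) ` (UNIV \<times> U) = vec.span (insert a U)"
    proof (intro equalityI subsetI)
      fix x assume "x \<in> (\<lambda>(k,u). k *s a + u) ` (UNIV \<times> U)"
      then obtain k u where "u \<in> U" "x = k *s a + u" by auto
      then have "x - k *s a \<in> U" by simp
      then show "x \<in> vec.span (insert a U)"
        using mem_span_insert[OF assms(1)] by blast
    next
      fix x assume "x \<in> vec.span (insert a U)"
      then obtain k where "x - k *s a \<in> U" using mem_span_insert[OF assms(1)] by blast
      then show "x \<in> (\<lambda>(k,u). k *s a + u) ` (UNIV \<times> U)"
        by (intro image_eqI[of _ _ "(k, x - k *s a)"]) auto
    qed
  qed
  then show ?thesis by (metis bij_betw_same_card card_cartesian_product)
qed

lemma card_subspace: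
  fixes U :: "('k::{field,finite} ^ 'n) set"
  assumes "vec.subspace U"
  shows "card U = CARD('k) ^ vec.dim U"
proof -
  obtain B where B: "B \<subseteq> U" "vec.independent B" "U \<subseteq> vec.span B" "card B = vec.dim U"
    by (rule vec.basis_exists)
  have "finite B" using B(2) vec.finiteI_independent by blast
  then have "card (vec.span B) = CARD('k) ^ card B" using B(2)
  proof (induction B)
    case empty
    then show ?case by simp
  next
    case (insert a B)
    then have "a \<notin> vec.span B" "vec.independent B"
      by (simp_all add: vec.independent_insert)
    moreover have "vec.span (insert a B) = vec.span (insert a (vec.span B))"
      unfolding vec.span_insert vec.span_span ..
    ultimately show ?case
      using card_span_insert[of "vec.span B" a] insert by simp
  qed
  moreover have "vec.span B = U" using B assms vec.span_subspace by blast
  ultimately show ?thesis using B by simp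
qed

text \<open>Extend a basis \<open>C\<close> of \<open>B\<close> to a basis \<open>D\<close> of
  \<open>E\<close> and drop one vector of \<open>D - C\<close>. Counts in \<open>E\<close> are
  reduced by induction to counts in a hyperplane that still contains \<open>B\<close>.\<close>

lemma hyperplane_between:
  fixes B E :: "('k::field ^ 'n) set"
  assumes "vec.subspace B" "vec.subspace E" "B \<subseteq> E" "B \<noteq> E"
  obtains E' where "vec.subspace E'" "B \<subseteq> E'" "E' \<subseteq> E" "vec.dim E = Suc (vec.dim E')"
proof -
  obtain C where C: "C \<subseteq> B" "vec.independent C" "B \<subseteq> vec.span C" "card C = vec.dim B"
    by (rule vec.basis_exists)
  have "C \<subseteq> E" using C(1) assms(3) by blast
  then obtain D where D: "C \<subseteq> D" "D \<subseteq> E" "vec.independent D" "E \<subseteq> vec.span D"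
    using C(2) by (rule vec.maximal_independent_subset_extend)
  have "finite D" using D(3) vec.finiteI_independent by blast
  have ED: "vec.span D = E" using D assms(2) vec.span_subspace by blast
  have "C \<noteq> D" using ED C assms vec.span_subspace by blast
  then obtain a where a: "a \<in> D" "a \<notin> C" using D(1) by blast
  have ind: "vec.independent (D - {a})" using D(3) vec.independent_mono by blast
  show ?thesis
  proof
    show "vec.subspace (vec.span (D - {a}))" by simp
    show "B \<subseteq> vec.span (D - {a})"
      using C(3) D(1) a vec.span_mono[of C "D - {a}"] by blast
    show "vec.span (D - {a}) \<subseteq> E" using ED vec.span_mono[of "D - {a}" D] by blast
    show "vec.dim E = Suc (vec.dim (vec.span (D - {a})))"
      using vec.dim_span_eq_card_independent[OF ind] vec.dim_span_eq_card_independent[OF D(3)] ED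
        card_gt_0_iff[of D] \<open>finite D\<close> a(1) by auto
  qed
qed

section \<open>Complements of \<open>B / T\<close> in \<open>E / T\<close> and their number\<close>

definition relative_complements :: "('k::field ^ 'n) set \<Rightarrow> ('k ^ 'n) set \<Rightarrow> ('k ^ 'n) set \<Rightarrow> ('k ^ 'n) set set" where
  "relative_complements E B T =
     {W. vec.subspace W \<and> W \<subseteq> E \<and> W \<inter> B = T \<and> E \<subseteq> vec.span (W \<union> B)}"

text \<open>\<open>W + B\<close> lies inside \<open>E\<close>, so whether it fills \<open>E\<close>
  is decided by its dimension, which the dimension formula for sums and intersections
  provides.\<close>

lemma relative_complements_iff_dim:
  assumes "vec.subspace E" "vec.subspace B" "B \<subseteq> E" "vec.subspace W" "W \<subseteq> E" "W \<inter> B = T"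
  shows "W \<in> relative_complements E B T \<longleftrightarrow> vec.dim W + vec.dim B = vec.dim E + vec.dim T"
proof -
  have sub: "vec.span (W \<union> B) \<subseteq> E" using assms by (intro vec.span_minimal) auto
  have dim: "vec.dim (vec.span (W \<union> B)) + vec.dim T = vec.dim W + vec.dim B"
    using dim_span_Un_Int[OF assms(4,2)] assms(6) by simp
  have "E \<subseteq> vec.span (W \<union> B) \<longleftrightarrow> vec.dim E = vec.dim (vec.span (W \<union> B))"
    using sub assms(1) vec.subspace_dim_equal[of "vec.span (W \<union> B)" E]
    by (metis order.eq_iff vec.subspace_span)
  then show ?thesis using assms dim unfolding relative_complements_def by auto
qed

text \<open>With \<open>e\<close> in \<open>E\<close> outside \<open>B\<close>, every such
  \<open>W\<close> is generated by \<open>T\<close> and a vector \<open>e + v\<close> with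
  \<open>v\<close> in \<open>B\<close>, and \<open>v\<close> is determined up to \<open>T\<close>.
  The answer is therefore the index of \<open>T\<close> in \<open>B\<close>.\<close>

lemma card_relative_complements_hyperplane:
  fixes E :: "('k::{field,finite} ^ 'n) set"
  assumes E: "vec.subspace E" and B: "vec.subspace B" and T: "vec.subspace T"
    and "T \<subseteq> B" "B \<subseteq> E" "vec.dim E = Suc (vec.dim B)"
  shows "card (relative_complements E B T) = CARD('k) ^ (vec.dim B - vec.dim T)"
proof -
  have "B \<noteq> E" using assms(6) by auto
  then obtain e where e: "e \<in> E" "e \<notin> B" using assms(5) by blast
  have span_e: "vec.span (insert e B) = E"
  proof (rule vec.subspace_dim_equal)
    show "vec.span (insert e B) \<subseteq> E" using e assms by (intro vec.span_minimal) auto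
    show "vec.dim E \<le> vec.dim (vec.span (insert e B))"
      using e assms(6) dim_span_insert[of e B] by (simp only: span_of_subspace[OF B]) simp
  qed (use E in auto)
  have scale_e: "k = 0" if "k *s e \<in> B" for k
  proof (rule ccontr)
    assume "k \<noteq> 0"
    then have "e = inverse k *s (k *s e)" by simp
    then show False using vec.subspace_scale[OF B that] e by metis
  qed
  define f where "f v = vec.span (insert (e + v) T)" for v
  have f_mem: "f v \<in> relative_complements E B T" if v: "v \<in> B" for v
  proof -
    have "insert (e + v) T \<subseteq> E" using v e assms(4,5) vec.subspace_add[OF E] by blast
    then have 1: "f v \<subseteq> E" unfolding f_def using E by (intro vec.span_minimal)
    have 2: "f v \<inter> B = T"
    proof (intro equalityI subsetI)
      fix w assume w: "w \<in> f v \<inter> B"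
      then obtain k where k: "w - k *s (e + v) \<in> T"
        using mem_span_insert[OF T] unfolding f_def by blast
      then have "k *s e = w - (w - k *s (e + v)) - k *s v"
        by (simp add: vector_add_ldistrib)
      also have "\<dots> \<in> B" using w k v assms(4) vec.subspace_diff[OF B]
          vec.subspace_scale[OF B] by blast
      finally have "k = 0" using scale_e by blast
      then show "w \<in> T" using k by simp
    next
      fix w assume "w \<in> T"
      then show "w \<in> f v \<inter> B" unfolding f_def using assms by (auto intro: vec.span_base)
    qed
    have "e = (e + v) - v" by simp
    moreover have "e + v \<in> vec.span (f v \<union> B)" "v \<in> vec.span (f v \<union> B)"
      unfolding f_def using v by (auto intro!: vec.span_base)
    ultimately have "e \<in> vec.span (f v \<union> B)" using vec.span_diff by metis
    then have "E \<subseteq> vec.span (f v \<union> B)"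
      unfolding span_e[symmetric] by (intro vec.span_minimal) (auto intro: vec.span_base)
    then show ?thesis using 1 2 unfolding relative_complements_def f_def by auto
  qed
  have "card {v \<in> B. f v = W} = card T" if W: "W \<in> relative_complements E B T" for W
  proof -
    have W': "vec.subspace W" "W \<subseteq> E" "W \<inter> B = T" "E \<subseteq> vec.span (W \<union> B)"
      using W unfolding relative_complements_def by auto
    have "\<not> W \<subseteq> B"
    proof
      assume "W \<subseteq> B"
      then have "vec.span (W \<union> B) = B" using B by (simp add: Un_absorb1)
      then show False using W'(4) e by blast
    qed
    then obtain w where w: "w \<in> W" "w \<notin> B" by blast
    then obtain k where k: "w - k *s e \<in> B"
      using W'(2) span_e mem_span_insert[OF B] by blast
    have "k \<noteq> 0" using k w by auto
    \<comment> \<open>Dividing \<open>w\<close> by its nonzero \<open>e\<close>-component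
      \<open>k\<close> normalises that component to one, and \<open>v0\<close> is the remaining part
      in \<open>B\<close>. The fibre over \<open>W\<close> is the coset of \<open>T\<close> through
      \<open>v0\<close>.\<close>
    define v0 where "v0 = inverse k *s (w - k *s e)"
    have v0: "v0 \<in> B" unfolding v0_def using vec.subspace_scale[OF B k] .
    have "e + v0 = inverse k *s w"
      unfolding v0_def using \<open>k \<noteq> 0\<close> by (simp add: vec.scale_right_diff_distrib)
    then have ev0: "e + v0 \<in> W" using vec.subspace_scale[OF W'(1) w(1)] by simp
    have "{v \<in> B. f v = W} = (+) v0 ` T"
    proof (intro equalityI subsetI)
      fix v assume v: "v \<in> {v \<in> B. f v = W}"
      then have "e + v \<in> W" unfolding f_def by (auto intro: vec.span_base)
      then have "(e + v) - (e + v0) \<in> W" using ev0 vec.subspace_diff[OF W'(1)] by blast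
      then have "v - v0 \<in> W \<inter> B" using v v0 vec.subspace_diff[OF B] by simp
      then show "v \<in> (+) v0 ` T" using W'(3) by (intro image_eqI[of _ _ "v - v0"]) auto
    next
      fix v assume "v \<in> (+) v0 ` T"
      then obtain t where t: "t \<in> T" "v = v0 + t" by blast
      then have vB: "v \<in> B" using v0 assms(4) vec.subspace_add[OF B] by blast
      have "(e + v0) + t \<in> W" using t ev0 W'(3) vec.subspace_add[OF W'(1)] by blast
      then have evW: "e + v \<in> W" using t by (simp add: add.assoc)
      have "f v \<subseteq> W" unfolding f_def using evW W' by (intro vec.span_minimal) auto
      moreover have "vec.dim W + vec.dim B = vec.dim E + vec.dim T"
        using W relative_complements_iff_dim[OF E B assms(5) W'(1-3)] by blast
      moreover have "vec.dim (f v) + vec.dim B = vec.dim E + vec.dim T"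
        using f_mem[OF vB] relative_complements_iff_dim[OF E B assms(5), of "f v" T]
        unfolding relative_complements_def by blast
      ultimately have "f v = W"
        using W'(1) by (intro vec.subspace_dim_equal) (auto simp: f_def)
      then show "v \<in> {v \<in> B. f v = W}" using vB by blast
    qed
    then show ?thesis by (simp add: card_image)
  qed
  then have "card B = card T * card (relative_complements E B T)"
    using f_mem by (intro card_const_fibres[where f = f]) auto
  then have "CARD('k) ^ vec.dim T * CARD('k) ^ (vec.dim B - vec.dim T)
      = CARD('k) ^ vec.dim T * card (relative_complements E B T)"
    using vec.dim_subset[OF assms(4)] card_subspace[OF B] card_subspace[OF T]
    by (simp flip: power_add)
  then show ?thesis by simp
qed

text \<open>Complements of \<open>B / T\<close> in \<open>E / T\<close> correspond to linear maps
  from \<open>E / B\<close> to \<open>B / T\<close>, which explains the exponent. The induction on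
  the codimension of \<open>B\<close> intersects \<open>W\<close> with a hyperplane
  \<open>E'\<close> containing \<open>B\<close>; the fibre over \<open>W'\<close> is again a set of
  relative complements, of \<open>E'\<close> over \<open>W'\<close>.\<close>

lemma card_relative_complements:
  fixes E :: "('k::{field,finite} ^ 'n) set"
  assumes "vec.subspace E" "vec.subspace B" "vec.subspace T" "T \<subseteq> B" "B \<subseteq> E"
  shows "card (relative_complements E B T)
    = CARD('k) ^ ((vec.dim E - vec.dim B) * (vec.dim B - vec.dim T))"
  using assms
proof (induction "vec.dim E - vec.dim B" arbitrary: E)
  case 0
  then have "B = E"
    using vec.dim_subset[of B E] by (intro vec.subspace_dim_equal) auto
  then have "relative_complements E B T = {T}"
    using 0 unfolding relative_complements_def by (auto intro: vec.span_base)
  then show ?case using \<open>B = E\<close> by simp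
next
  case (Suc m)
  then have "B \<noteq> E" by auto
  then obtain E' where E': "vec.subspace E'" "B \<subseteq> E'" "E' \<subseteq> E" "vec.dim E = Suc (vec.dim E')"
    using hyperplane_between[of B E] Suc by metis
  have m: "m = vec.dim E' - vec.dim B" using Suc(2) E' by simp
  have IH: "card (relative_complements E' B T) = CARD('k) ^ (m * (vec.dim B - vec.dim T))"
    using Suc.hyps(1)[OF m] Suc.prems E' m by simp
  have dim_B: "vec.dim B \<le> vec.dim E'" "vec.dim T \<le> vec.dim B"
    using E' Suc.prems by (simp_all add: vec.dim_subset)
  have mem: "W \<inter> E' \<in> relative_complements E' B T" if W: "W \<in> relative_complements E B T" for W
  proof -
    have W': "vec.subspace W" "W \<subseteq> E" "W \<inter> B = T" "E \<subseteq> vec.span (W \<union> B)"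
      using W unfolding relative_complements_def by auto
    have "E' \<subseteq> vec.span ((W \<inter> E') \<union> B)"
    proof
      fix x assume x: "x \<in> E'"
      then have "x \<in> vec.span (W \<union> B)" using W' E' by blast
      then obtain w b where wb: "x = w + b" "w \<in> W" "b \<in> B"
        unfolding vec.span_Un span_of_subspace[OF W'(1)] span_of_subspace[OF Suc.prems(2)] by blast
      then have "w = x - b" by simp
      then have "w \<in> E'" using x wb E' vec.subspace_diff[OF E'(1)] by blast
      then show "x \<in> vec.span ((W \<inter> E') \<union> B)"
        using wb by (auto intro!: vec.span_add intro: vec.span_base)
    qed
    then show ?thesis using W' E' unfolding relative_complements_def
      by (auto intro: vec.subspace_inter)
  qed
  have fibre: "{W \<in> relative_complements E B T. W \<inter> E' = W'} = relative_complements E E' W'"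
    if W': "W' \<in> relative_complements E' B T" for W'
  proof (intro equalityI subsetI)
    fix W assume W: "W \<in> {W \<in> relative_complements E B T. W \<inter> E' = W'}"
    then have "E \<subseteq> vec.span (W \<union> B)" unfolding relative_complements_def by blast
    also have "\<dots> \<subseteq> vec.span (W \<union> E')" using E' by (intro vec.span_mono) blast
    finally show "W \<in> relative_complements E E' W'"
      using W unfolding relative_complements_def by blast
  next
    fix W assume "W \<in> relative_complements E E' W'"
    then have W: "vec.subspace W" "W \<subseteq> E" "W \<inter> E' = W'" "E \<subseteq> vec.span (W \<union> E')"
      unfolding relative_complements_def by auto
    have "E' \<subseteq> vec.span (W' \<union> B)" and WB: "W' \<inter> B = T"
      using W' unfolding relative_complements_def by auto
    moreover have "vec.span (W' \<union> B) \<subseteq> vec.span (W \<union> B)"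
      using W by (intro vec.span_mono) blast
    ultimately have "vec.span (W \<union> E') \<subseteq> vec.span (W \<union> B)"
      by (intro vec.span_minimal) (auto intro: vec.span_base)
    moreover have "W \<inter> B = T" using W(3) WB E'(2) by blast
    ultimately show "W \<in> {W \<in> relative_complements E B T. W \<inter> E' = W'}"
      using W unfolding relative_complements_def by blast
  qed
  have card_fibre: "card {W \<in> relative_complements E B T. W \<inter> E' = W'}
      = CARD('k) ^ (vec.dim B - vec.dim T)"
    if W': "W' \<in> relative_complements E' B T" for W'
  proof -
    have sub: "vec.subspace W'" "W' \<subseteq> E'" "W' \<inter> B = T"
      using W' unfolding relative_complements_def by auto
    have "vec.dim W' + vec.dim B = vec.dim E' + vec.dim T"
      using W' relative_complements_iff_dim[OF E'(1) Suc.prems(2) E'(2) sub] by blast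
    \<comment> \<open>The fibre size does not depend on \<open>W'\<close>, because \<open>W'\<close>
      has the same codimension in \<open>E'\<close> as \<open>T\<close> in \<open>B\<close>.\<close>
    then have "vec.dim E' - vec.dim W' = vec.dim B - vec.dim T" by simp
    then show ?thesis
      using fibre[OF W'] card_relative_complements_hyperplane[OF Suc.prems(1) E'(1) sub(1,2) E'(3,4)]
      by simp
  qed
  have "card (relative_complements E B T)
      = CARD('k) ^ (vec.dim B - vec.dim T) * card (relative_complements E' B T)"
    using mem card_fibre by (intro card_const_fibres[where f = "\<lambda>W. W \<inter> E'"]) auto
  moreover have "vec.dim E - vec.dim B = Suc m" using Suc(2) by simp
  ultimately show ?case using IH by (simp add: power_add)
qed

text \<open>Gaussian binomial coefficient, by the Pascal rule that results from splitting subspaces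
  according to whether a fixed hyperplane contains them. A recursion without division can be reduced
  modulo any number. The truncated \<open>n - k\<close> is harmless, since
  \<open>qbinomial q n k\<close> vanishes for \<open>k > n\<close>.\<close>

fun qbinomial :: "nat \<Rightarrow> nat \<Rightarrow> nat \<Rightarrow> nat" where
  "qbinomial q n 0 = 1"
| "qbinomial q 0 (Suc k) = 0"
| "qbinomial q (Suc n) (Suc k) = qbinomial q n (Suc k) + q ^ (n - k) * qbinomial q n k"

lemma qbinomial_cong:
  assumes "[q = 1] (mod m)"
  shows "[qbinomial q n k = n choose k] (mod m)"
proof (induction n arbitrary: k)
  case 0
  then show ?case by (cases k) auto
next
  case (Suc n)
  show ?case
  proof (cases k)
    case (Suc j)
    have "[q ^ (n - j) * qbinomial q n j = 1 * (n choose j)] (mod m)"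
      using cong_pow[OF assms, of "n - j"] Suc.IH by (intro cong_mult) auto
    then have "[q ^ (n - j) * qbinomial q n j + qbinomial q n (Suc j)
        = (n choose j) + (n choose Suc j)] (mod m)"
      using Suc.IH[of "Suc j"] by (intro cong_add) auto
    then show ?thesis using Suc by (simp add: add.commute)
  qed auto
qed

text \<open>Subspaces inside a hyperplane \<open>E'\<close> are counted by induction. Any other
  \<open>U\<close> meets \<open>E'\<close> in one dimension less, and the \<open>U\<close> with a
  given intersection are relative complements; their number is the power of \<open>q\<close> in the
  Pascal rule.\<close>

lemma card_subspaces_between:
  fixes E T :: "('k::{field,finite} ^ 'n) set"
  assumes "vec.subspace E" "vec.subspace T" "T \<subseteq> E"
  shows "card {U. vec.subspace U \<and> T \<subseteq> U \<and> U \<subseteq> E \<and> vec.dim U = vec.dim T + k}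
    = qbinomial (CARD('k)) (vec.dim E - vec.dim T) k"
  using assms
proof (induction "vec.dim E - vec.dim T" arbitrary: E k)
  case 0
  then have "T = E"
    using vec.dim_subset[of T E] by (intro vec.subspace_dim_equal) auto
  then have "{U. vec.subspace U \<and> T \<subseteq> U \<and> U \<subseteq> E \<and> vec.dim U = vec.dim T + k}
      = (if k = 0 then {T} else {})" using 0 by auto
  then show ?case using \<open>T = E\<close> by (cases k) auto
next
  case (Suc n)
  let ?S = "\<lambda>E k. {U. vec.subspace U \<and> T \<subseteq> U \<and> U \<subseteq> E \<and> vec.dim U = vec.dim T + k}"
  show ?case
  proof (cases k)
    case 0
    have "U = T" if "U \<in> ?S E 0" for U
      using vec.subspace_dim_equal[of T U] that Suc.prems by simp
    then have "?S E 0 = {T}" using Suc.prems by auto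
    then show ?thesis using 0 by simp
  next
    case k: (Suc j)
    have "T \<noteq> E" using Suc(2) by auto
    then obtain E' where E': "vec.subspace E'" "T \<subseteq> E'" "E' \<subseteq> E" "vec.dim E = Suc (vec.dim E')"
      using hyperplane_between[of T E] Suc by metis
    have n: "n = vec.dim E' - vec.dim T" using Suc(2) E' by simp
    have IH: "card (?S E' i) = qbinomial (CARD('k)) n i" for i
      using Suc.hyps(1)[OF n] Suc.prems E' n by simp
    have dim_T: "vec.dim T \<le> vec.dim E'" using E' vec.dim_subset by blast
    let ?N = "{U \<in> ?S E k. \<not> U \<subseteq> E'}"
    have compl: "U \<in> relative_complements E E' (U \<inter> E')" if U: "U \<in> ?N" for U
    proof -
      have "vec.dim U + vec.dim E' = vec.dim (vec.span (U \<union> E')) + vec.dim (U \<inter> E')"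
        using U dim_span_Un_Int[of U E'] E' by simp
      moreover have "vec.dim E' < vec.dim (vec.span (U \<union> E'))"
      proof (rule vec.dim_psubset)
        have "E' \<subset> vec.span (U \<union> E')" using U by (auto intro: vec.span_base)
        then show "vec.span E' \<subset> vec.span (vec.span (U \<union> E'))"
          by (simp only: vec.span_span span_of_subspace[OF E'(1)])
      qed
      moreover have "vec.dim (vec.span (U \<union> E')) \<le> vec.dim E"
        using U E' Suc.prems by (intro vec.dim_subset vec.span_minimal) auto
      ultimately show ?thesis
        using relative_complements_iff_dim[OF Suc.prems(1) E'(1,3), of U "U \<inter> E'"] U E' by auto
    qed
    have dims: "vec.dim U = Suc (vec.dim U')"
      if "U \<in> relative_complements E E' U'" for U U'
      using that relative_complements_iff_dim[OF Suc.prems(1) E'(1,3), of U U'] E'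
      unfolding relative_complements_def by auto
    have mem: "U \<inter> E' \<in> ?S E' j" if U: "U \<in> ?N" for U
      using U dims[OF compl[OF U]] E' Suc.prems k by (auto intro: vec.subspace_inter)
    have "card {U \<in> ?N. U \<inter> E' = U'} = CARD('k) ^ (n - j)" if U': "U' \<in> ?S E' j" for U'
    proof -
      have "{U \<in> ?N. U \<inter> E' = U'} = relative_complements E E' U'"
      proof (intro equalityI subsetI)
        fix U assume "U \<in> {U \<in> ?N. U \<inter> E' = U'}"
        then show "U \<in> relative_complements E E' U'" using compl by blast
      next
        fix U assume U: "U \<in> relative_complements E E' U'"
        then have "\<not> U \<subseteq> E'" using dims[OF U] unfolding relative_complements_def
          by (auto simp: Int_absorb2)
        then show "U \<in> {U \<in> ?N. U \<inter> E' = U'}"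
          using U dims[OF U] U' k unfolding relative_complements_def by auto
      qed
      moreover have "vec.dim E' - vec.dim U' = n - j" using U' n dim_T by simp
      ultimately show ?thesis
        using card_relative_complements_hyperplane[OF Suc.prems(1) E'(1) _ _ E'(3,4), of U'] U' by simp
    qed
    then have "card ?N = CARD('k) ^ (n - j) * card (?S E' j)"
      using mem by (intro card_const_fibres[where f = "\<lambda>U. U \<inter> E'"]) auto
    moreover have "card (?S E k) = card (?S E' k) + card ?N"
    proof -
      have "?S E k = ?S E' k \<union> ?N" using E' by auto
      moreover have "card (?S E' k \<union> ?N) = card (?S E' k) + card ?N"
        by (intro card_Un_disjoint) auto
      ultimately show ?thesis by presburger
    qed
    moreover have "vec.dim E - vec.dim T = Suc n" using Suc(2) by simp
    ultimately show ?thesis using IH k by (simp only: qbinomial.simps)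
  qed
qed

section \<open>Hermitian spaces\<close>

text \<open>The rank \<open>d\<close> is arbitrary here and becomes \<open>p ^ l - 1\<close> only in
  the final theorem; \<open>p\<close> enters later, through divisibility of
  \<open>r + 1\<close>.\<close>

locale hermitian_space =
  fixes H :: "'k::{field,finite} ^ 'n::finite \<Rightarrow> 'k ^ 'n \<Rightarrow> 'k" and r d :: nat
  assumes primepow_r: "primepow r"
    and card_field: "CARD('k) = r ^ 2"
    and card_index: "CARD('n) = 2 * d + 1"
    and hermitian: "hermitian_form r H"
    and nondegenerate: "nondegenerate H"
begin

abbreviation points where "points \<equiv> dual_polar_points H"
abbreviation isotropic where "isotropic \<equiv> totally_isotropic H"

definition perp :: "('k ^ 'n) set \<Rightarrow> ('k ^ 'n) set" where
  "perp U = {v. \<forall>u\<in>U. H v u = 0}"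

lemma r_gt_1: "r > 1"
  using primepow_gt_Suc_0[OF primepow_r] by simp

lemma H_add_left: "H (u + v) w = H u w + H v w"
  using hermitian unfolding hermitian_form_def by blast

lemma H_scale_left: "H (a *s u) w = a * H u w"
  using hermitian unfolding hermitian_form_def by blast

lemma H_swap: "H v u = H u v ^ r"
  using hermitian unfolding hermitian_form_def by blast

lemma H_zero_left [simp]: "H 0 w = 0"
  using H_scale_left[of 0 0 w] by simp

lemma orthogonal_sym: "H u v = 0 \<longleftrightarrow> H v u = 0"
  using H_swap[of u v] H_swap[of v u] r_gt_1 by auto

lemma H_zero_right [simp]: "H w 0 = 0"
  using orthogonal_sym[of 0 w] by simp

text \<open>The characteristic divides the order \<open>r ^ 2\<close> of the field, hence is the
  prime underlying \<open>r\<close>, and raising to the power \<open>r\<close> iterates the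
  Frobenius map.\<close>

lemma frobenius_add: "(a + b) ^ r = a ^ r + (b::'k) ^ r"
proof -
  obtain s m where s: "Factorial_Ring.prime s" "m > 0" "r = s ^ m"
    using primepow_r unfolding primepow_def by auto
  have pos: "CHAR('k) > 0" by (rule finite_imp_CHAR_pos) simp
  then have pr: "Factorial_Ring.prime CHAR('k)" by (rule prime_CHAR_semidom)
  have "CHAR('k) dvd s ^ (m * 2)"
    using CHAR_dvd_CARD[where 'a = 'k] card_field s(3) by (simp add: power_mult)
  then have "CHAR('k) dvd s" using pr prime_dvd_power by blast
  then have "CHAR('k) = s" using pr s(1) primes_dvd_imp_eq by blast
  then show ?thesis using freshmans_dream'[of r m a b] pr s(3) by simp
qed

lemma frobenius_uminus: "(- a) ^ r = - ((a::'k) ^ r)"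
proof -
  have "a ^ r + (- a) ^ r = (a + - a) ^ r" by (rule frobenius_add[symmetric])
  also have "\<dots> = 0" using r_gt_1 by simp
  finally show ?thesis by (simp add: eq_neg_iff_add_eq_0 add.commute)
qed

lemma H_add_right: "H w (u + v) = H w u + H w v"
  using H_swap[of w "u + v"] H_swap[of w u] H_swap[of w v] by (simp add: H_add_left frobenius_add)

lemma H_scale_right: "H w (a *s u) = a ^ r * H w u"
  using H_swap[of w "a *s u"] H_swap[of w u] by (simp add: H_scale_left power_mult_distrib)

lemma dim_UNIV: "vec.dim (UNIV :: ('k ^ 'n) set) = 2 * d + 1"
  using vec_dim_card[where 'a = 'k and 'n = 'n] card_index by simp

text \<open>By nondegeneracy every scalar is a value of \<open>H\<close>, and swapping the arguments
  twice restores this value while raising it to the power \<open>r\<close> twice.\<close>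

lemma frobenius_involutive: "(a ^ r) ^ r = (a::'k)"
proof -
  obtain u :: "'k ^ 'n" where "u \<noteq> 0"
    by (metis zero_neq_one vec_eq_iff zero_index one_index)
  then obtain v where v: "H v u \<noteq> 0"
    using nondegenerate orthogonal_sym unfolding nondegenerate_def by blast
  have "a = H ((a / H v u) *s v) u" using v by (simp add: H_scale_left)
  then show ?thesis using H_swap by metis
qed

section \<open>Trace and norm onto the scalars fixed by the power \<open>r\<close>\<close>

lemma card_frobenius_fixed: "card {t::'k. t ^ r = t} \<le> r"
proof -
  let ?p = "Polynomial.monom 1 r - Polynomial.monom 1 1 :: 'k poly"
  have "poly.coeff ?p r \<noteq> 0" using r_gt_1 by simp
  then have "?p \<noteq> 0" by (metis Polynomial.coeff_0)
  then have "card {t. poly ?p t = 0} \<le> degree ?p" by (rule card_poly_roots_bound)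
  also have "\<dots> \<le> r"
    using r_gt_1 by (intro degree_diff_le) (auto intro: order_trans[OF degree_monom_le])
  finally show ?thesis by (simp add: poly_monom)
qed

text \<open>The trace \<open>c ^ r + c\<close> maps \<open>r ^ 2\<close> scalars to at most
  \<open>r\<close> fixed ones, with fibres of at most \<open>r\<close> roots. The product of the two
  bounds is attained, so every fibre is full.\<close>

lemma card_trace_fibre:
  assumes "t ^ r = (t::'k)"
  shows "card {c. c ^ r + c = t} = r"
proof -
  have *: "card {c::'k. c ^ r + c = b} \<le> r" for b
  proof -
    let ?p = "Polynomial.monom 1 r + [:- b, 1:] :: 'k poly"
    have "degree ?p = degree (Polynomial.monom 1 r :: 'k poly)"
      using r_gt_1 by (intro degree_add_eq_left) (simp add: degree_monom_eq)
    then have deg: "degree ?p = r" by (simp add: degree_monom_eq)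
    then have "?p \<noteq> 0" using r_gt_1 by (metis degree_0 not_one_less_zero)
    then have "card {c. poly ?p c = 0} \<le> degree ?p" by (rule card_poly_roots_bound)
    moreover have "{c. poly ?p c = 0} = {c. c ^ r + c = b}"
      by (auto simp: poly_monom algebra_simps)
    ultimately show ?thesis using deg by simp
  qed
  have "card {c \<in> UNIV. c ^ r + c = t} = r"
  proof (rule card_fibres_extremal[where B = "{t. t ^ r = t}" and n = r])
    show "a ^ r + a \<in> {t. t ^ r = t}" for a :: 'k
      by (simp add: frobenius_add frobenius_involutive add.commute)
  qed (use * assms card_frobenius_fixed card_field in \<open>auto simp: power2_eq_square\<close>)
  then show ?thesis by simp
qed

text \<open>The same count for the norm: \<open>r ^ 2 - 1\<close> nonzero scalars, at most
  \<open>r - 1\<close> nonzero fixed values, and fibres of at most \<open>r + 1\<close>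
  roots.\<close>

lemma norm_surjective:
  assumes "t ^ r = (t::'k)" "t \<noteq> 0"
  obtains c where "c ^ r * c = t"
proof -
  have *: "card {c::'k. c ^ r * c = b} \<le> r + 1" for b
  proof -
    let ?p = "Polynomial.monom 1 (r + 1) + [:- b:] :: 'k poly"
    have "degree ?p = degree (Polynomial.monom 1 (r + 1) :: 'k poly)"
      using r_gt_1 by (intro degree_add_eq_left) (simp add: degree_monom_eq)
    then have deg: "degree ?p = r + 1" by (simp add: degree_monom_eq)
    then have "?p \<noteq> 0" by auto
    then have "card {c. poly ?p c = 0} \<le> degree ?p" by (rule card_poly_roots_bound)
    moreover have "{c. poly ?p c = 0} = {c. c ^ r * c = b}"
      by (auto simp: poly_monom algebra_simps)
    ultimately show ?thesis using deg by simp
  qed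
  have fixed: "card {t::'k. t ^ r = t \<and> t \<noteq> 0} \<le> r - 1"
  proof -
    have "{t::'k. t ^ r = t} = insert 0 {t::'k. t ^ r = t \<and> t \<noteq> 0}" using r_gt_1 by auto
    then show ?thesis using card_frobenius_fixed by simp
  qed
  have "card {c \<in> UNIV - {0}. c ^ r * c = t} = r + 1"
  proof (rule card_fibres_extremal[where B = "{t. t ^ r = t \<and> t \<noteq> 0}" and n = "r - 1"])
    show "a ^ r * a \<in> {t. t ^ r = t \<and> t \<noteq> 0}" if "a \<in> UNIV - {0}" for a :: 'k
      using that by (simp add: power_mult_distrib frobenius_involutive mult.commute)
    show "card {a \<in> UNIV - {0}. a ^ r * a = b} \<le> r + 1" for b :: 'k
      using *[of b] card_mono[of "{c::'k. c ^ r * c = b}" "{a \<in> UNIV - {0}. a ^ r * a = b}"]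
      by fastforce
    have "r \<le> r * r" using r_gt_1 by simp
    then show "(r + 1) * (r - 1) \<le> card (UNIV - {0::'k})"
      using r_gt_1 by (simp add: card_field power2_eq_square algebra_simps card_Diff_singleton)
  qed (use assms fixed in \<open>simp_all add: finite\<close>)
  then have "{c \<in> UNIV - {0}. c ^ r * c = t} \<noteq> {}"
    by (metis card.empty add_is_0 one_neq_zero)
  then show ?thesis using that by blast
qed

section \<open>Orthogonal complements\<close>

lemma subspace_perp: "vec.subspace (perp U)"
  unfolding perp_def vec.subspace_def by (auto simp: H_add_left H_scale_left)

lemma perp_antimono: "U \<subseteq> W \<Longrightarrow> perp W \<subseteq> perp U"
  unfolding perp_def by blast

lemma mem_perp_swap: "v \<in> perp U \<longleftrightarrow> (\<forall>u\<in>U. H u v = 0)"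
  unfolding perp_def using orthogonal_sym by blast

lemma subset_perp_swap: "U \<subseteq> perp W \<longleftrightarrow> W \<subseteq> perp U"
  unfolding perp_def using orthogonal_sym by blast

lemma perp_span: "perp (vec.span U) = perp U"
proof
  show "perp (vec.span U) \<subseteq> perp U" by (intro perp_antimono vec.span_superset)
  have "vec.span U \<subseteq> perp (perp U)"
    using subset_perp_swap by (intro vec.span_minimal subspace_perp) blast
  then show "perp U \<subseteq> perp (vec.span U)" using subset_perp_swap by blast
qed

lemma dim_perp_Int_ge:
  assumes "finite B" "vec.subspace Z"
  shows "vec.dim Z \<le> vec.dim (Z \<inter> perp B) + card B"
  using assms(1)
proof (induction B)
  case empty
  then show ?case by (simp add: perp_def)
next
  case (insert b B)
  let ?S = "Z \<inter> perp B" and ?S' = "Z \<inter> perp (insert b B)"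
  have S: "vec.subspace ?S" "vec.subspace ?S'"
    using assms(2) subspace_perp by (auto intro: vec.subspace_inter)
  have "vec.dim ?S \<le> Suc (vec.dim ?S')"
  proof (cases "?S = ?S'")
    case False
    then obtain a where a: "a \<in> ?S" "H a b \<noteq> 0" unfolding perp_def by auto
    have "?S \<subseteq> vec.span (insert a ?S')"
    proof
      fix v assume v: "v \<in> ?S"
      let ?w = "v - (H v b / H a b) *s a"
      have "?w \<in> ?S"
        using v a(1) vec.subspace_diff[OF S(1)] vec.subspace_scale[OF S(1)] by blast
      moreover have "H v b = H ?w b + H v b"
        using H_add_left[of ?w "(H v b / H a b) *s a" b] a(2) by (simp add: H_scale_left)
      ultimately have "?w \<in> ?S'" unfolding perp_def by auto
      then show "v \<in> vec.span (insert a ?S')" using mem_span_insert[OF S(2)] by blast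
    qed
    then have "vec.dim ?S \<le> vec.dim (vec.span (insert a ?S'))" by (rule vec.dim_subset)
    then show ?thesis by (auto simp: vec.dim_insert split: if_splits)
  qed simp
  then show ?case using insert by simp
qed

text \<open>Vectors of \<open>U\<close> orthogonal to all of \<open>Z\<close> impose no condition on
  \<open>Z\<close>. A basis of them is extended to a basis of \<open>U\<close>, and only the added
  vectors can cost a dimension.\<close>

lemma dim_Int_perp_le:
  assumes "vec.subspace U" "vec.subspace Z"
  shows "vec.dim Z + vec.dim (U \<inter> perp Z) \<le> vec.dim (Z \<inter> perp U) + vec.dim U"
proof -
  let ?U0 = "U \<inter> perp Z"
  obtain B0 where B0: "B0 \<subseteq> ?U0" "vec.independent B0" "?U0 \<subseteq> vec.span B0" "card B0 = vec.dim ?U0"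
    by (rule vec.basis_exists)
  have "B0 \<subseteq> U" using B0 by blast
  then obtain B where B: "B0 \<subseteq> B" "B \<subseteq> U" "vec.independent B" "U \<subseteq> vec.span B"
    using B0(2) by (rule vec.maximal_independent_subset_extend)
  have fin: "finite B" using B(3) vec.finiteI_independent by blast
  have cardB: "card B = vec.dim U" using B vec.basis_card_eq_dim by blast
  have spanB: "vec.span B = U" using B assms(1) vec.span_subspace by blast
  have "Z \<inter> perp (B - B0) \<subseteq> Z \<inter> perp B"
    using B0(1) orthogonal_sym unfolding perp_def by blast
  then have "Z \<inter> perp (B - B0) \<subseteq> Z \<inter> perp U" using perp_span[of B] spanB by simp
  then have "vec.dim (Z \<inter> perp (B - B0)) \<le> vec.dim (Z \<inter> perp U)" by (rule vec.dim_subset)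
  moreover have "vec.dim Z \<le> vec.dim (Z \<inter> perp (B - B0)) + card (B - B0)"
    using fin assms(2) by (intro dim_perp_Int_ge) auto
  moreover have "card (B - B0) + card B0 = card B"
    using B(1) fin by (metis card_Diff_subset card_mono finite_subset le_add_diff_inverse2)
  ultimately show ?thesis using B0(4) cardB by linarith
qed

text \<open>The codimension of \<open>U \<inter> perp Z\<close> in \<open>U\<close> and that of
  \<open>Z \<inter> perp U\<close> in \<open>Z\<close> are both the rank of the pairing between
  \<open>U\<close> and \<open>Z\<close>.\<close>

lemma dim_Int_perp:
  assumes "vec.subspace U" "vec.subspace Z"
  shows "vec.dim (Z \<inter> perp U) + vec.dim U = vec.dim Z + vec.dim (U \<inter> perp Z)"
  using dim_Int_perp_le[OF assms] dim_Int_perp_le[OF assms(2,1)] by linarith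

lemma dim_perp:
  assumes "vec.subspace U"
  shows "vec.dim (perp U) + vec.dim U = 2 * d + 1"
proof -
  have "perp UNIV = {0}" using nondegenerate unfolding perp_def nondegenerate_def by auto
  then have "vec.dim (U \<inter> perp UNIV) = 0" by simp
  then show ?thesis using dim_Int_perp[OF assms vec.subspace_UNIV] dim_UNIV by simp
qed

section \<open>Isotropic subspaces and points\<close>

lemma isotropic_iff: "isotropic U \<longleftrightarrow> vec.subspace U \<and> U \<subseteq> perp U"
  unfolding totally_isotropic_def perp_def by blast

lemma isotropic_subset:
  "isotropic W \<Longrightarrow> vec.subspace U \<Longrightarrow> U \<subseteq> W \<Longrightarrow> isotropic U"
  unfolding totally_isotropic_def by blast

lemma isotropic_span:
  assumes "\<And>u v. u \<in> U \<Longrightarrow> v \<in> U \<Longrightarrow> H u v = 0"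
  shows "isotropic (vec.span U)"
proof -
  have "U \<subseteq> perp U" unfolding perp_def using assms by blast
  then have "U \<subseteq> perp (vec.span U)" unfolding perp_span .
  then have "vec.span U \<subseteq> perp (vec.span U)" by (intro vec.span_minimal subspace_perp)
  then show ?thesis using isotropic_iff by simp
qed

lemma isotropic_span_insert:
  assumes "isotropic U" "v \<in> perp U" "H v v = 0"
  shows "isotropic (vec.span (insert v U))"
proof (rule isotropic_span)
  fix x y assume "x \<in> insert v U" "y \<in> insert v U"
  moreover have "H a v = 0" "H v a = 0" if "a \<in> U" for a
    using that assms(2) mem_perp_swap perp_def by auto
  moreover have "H a b = 0" if "a \<in> U" "b \<in> U" for a b
    using that assms(1) unfolding totally_isotropic_def by blast
  ultimately show "H x y = 0" using assms(3) by auto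
qed

lemma dim_isotropic_le:
  assumes "isotropic U"
  shows "vec.dim U \<le> d"
  using assms dim_perp[of U] vec.dim_subset[of U "perp U"] isotropic_iff[of U] by auto

lemma point_isotropic: "y \<in> points \<Longrightarrow> isotropic y"
  unfolding dual_polar_points_def by blast

lemma point_subspace: "y \<in> points \<Longrightarrow> vec.subspace y"
  using point_isotropic isotropic_iff by blast

lemma point_orthogonal: "y \<in> points \<Longrightarrow> u \<in> y \<Longrightarrow> v \<in> y \<Longrightarrow> H u v = 0"
  using point_isotropic unfolding totally_isotropic_def by blast

lemma isotropic_vector_in_point:
  assumes "y \<in> points" "v \<in> perp y" "H v v = 0"
  shows "v \<in> y"
proof -
  have "isotropic (vec.span (insert v y))"
    using assms point_isotropic isotropic_span_insert by blast
  moreover have "y \<subseteq> vec.span (insert v y)" by (auto intro: vec.span_base)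
  ultimately have "vec.span (insert v y) = y" using assms(1) unfolding dual_polar_points_def by blast
  then show ?thesis using vec.span_base[of v "insert v y"] by blast
qed

text \<open>If \<open>y\<close> had dimension less than \<open>d\<close>, the quotient of
  \<open>perp y\<close> by \<open>y\<close> would have dimension at least three. Two orthogonal
  vectors that are independent there combine to an isotropic one because the norm is surjective,
  against maximality.\<close>

lemma dim_point:
  assumes y: "y \<in> points"
  shows "vec.dim y = d"
proof (rule ccontr)
  have sub: "vec.subspace y" and iso: "y \<subseteq> perp y"
    using point_isotropic[OF y] isotropic_iff by auto
  assume "vec.dim y \<noteq> d"
  then have "vec.dim y + 3 \<le> vec.dim (perp y)"
    using dim_isotropic_le[OF point_isotropic[OF y]] dim_perp[OF sub] by linarith
  then have "\<not> perp y \<subseteq> vec.span y" using vec.dim_subset[of "perp y" "vec.span y"] by auto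
  then obtain u where u: "u \<in> perp y" "u \<notin> y" unfolding span_of_subspace[OF sub] by blast
  have "\<not> perp y \<subseteq> vec.span (insert u y)"
    using vec.dim_subset[of "perp y" "vec.span (insert u y)"] \<open>vec.dim y + 3 \<le> vec.dim (perp y)\<close>
    by (auto simp: vec.dim_insert split: if_splits)
  then obtain w where w: "w \<in> perp y" "w \<notin> vec.span (insert u y)" by blast
  have Huu: "H u u \<noteq> 0" using isotropic_vector_in_point[OF y] u by blast
  define a where "a = - H w u / H u u"
  define w' where "w' = w + a *s u"
  have w': "w' \<in> perp y"
    unfolding w'_def using u w subspace_perp vec.subspace_add vec.subspace_scale by metis
  have w'_nin: "w' \<notin> vec.span (insert u y)"
  proof
    assume "w' \<in> vec.span (insert u y)"
    moreover have "u \<in> vec.span (insert u y)" by (auto intro: vec.span_base)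
    ultimately have "w' - a *s u \<in> vec.span (insert u y)" by (intro vec.span_diff vec.span_scale)
    then show False using w unfolding w'_def by simp
  qed
  have orth: "H w' u = 0" "H u w' = 0"
  proof -
    show "H w' u = 0"
      using H_add_left[of w "a *s u" u] H_scale_left[of a u u] Huu unfolding w'_def a_def by auto
    then show "H u w' = 0" using orthogonal_sym by blast
  qed
  have "w' \<notin> y" using w'_nin vec.span_base by blast
  then have Hww: "H w' w' \<noteq> 0" using isotropic_vector_in_point[OF y] w' by blast
  \<comment> \<open>Values \<open>H v v\<close> are fixed by the power \<open>r\<close>, hence so is
    \<open>t\<close>, and \<open>t\<close> is a norm. A scalar \<open>c\<close> of norm
    \<open>t\<close> makes \<open>u + c *s w'\<close> isotropic; by maximality this vector is in
    \<open>y\<close>, which would put \<open>w'\<close> into the span of \<open>u\<close> and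
    \<open>y\<close>.\<close>
  define t where "t = - H u u / H w' w'"
  have "t ^ r = t" unfolding t_def
    by (simp add: power_divide frobenius_uminus H_swap[of u u, symmetric] H_swap[of w' w', symmetric])
  moreover have "t \<noteq> 0" unfolding t_def using Huu Hww by simp
  ultimately obtain c where c: "c ^ r * c = t" by (rule norm_surjective)
  let ?v = "u + c *s w'"
  have "H ?v ?v = H u u + c ^ r * c * H w' w'"
    by (simp add: H_add_left H_add_right H_scale_left H_scale_right orth algebra_simps)
  also have "\<dots> = 0" unfolding c t_def using Hww by simp
  finally have "H ?v ?v = 0" .
  moreover have "?v \<in> perp y"
    using u w' subspace_perp vec.subspace_add vec.subspace_scale by metis
  ultimately have v: "?v \<in> y" using isotropic_vector_in_point[OF y] by blast
  have "c \<noteq> 0" using c \<open>t \<noteq> 0\<close> r_gt_1 by auto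
  then have "w' = inverse c *s (?v - u)" by simp
  moreover have "?v \<in> vec.span (insert u y)" "u \<in> vec.span (insert u y)"
    using v by (auto intro: vec.span_base)
  ultimately show False using w'_nin vec.span_diff vec.span_scale by metis
qed

lemma pointI:
  assumes "isotropic y" "vec.dim y = d"
  shows "y \<in> points"
proof -
  have "W = y" if "isotropic W" "y \<subseteq> W" for W
    using that assms dim_isotropic_le[of W] vec.subspace_dim_equal[of y W]
    unfolding isotropic_iff by auto
  then show ?thesis using assms(1) unfolding dual_polar_points_def by blast
qed

lemma point_eqI: "x \<in> points \<Longrightarrow> y \<in> points \<Longrightarrow> x \<subseteq> y \<Longrightarrow> x = y"
  using point_isotropic unfolding dual_polar_points_def by blast

lemma isotropic_in_point:
  assumes "isotropic U"
  obtains y where "y \<in> points" "U \<subseteq> y"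
proof -
  let ?S = "{W. isotropic W \<and> U \<subseteq> W}"
  have "\<exists>y\<in>?S. U \<subseteq> y \<and> (\<forall>W\<in>?S. y \<subseteq> W \<longrightarrow> y = W)"
    using assms by (intro finite_has_maximal2 finite) simp
  then obtain y where y: "y \<in> ?S" "U \<subseteq> y" "\<forall>W\<in>?S. y \<subseteq> W \<longrightarrow> y = W"
    by (elim bexE conjE)
  have "W = y" if "isotropic W" "y \<subseteq> W" for W
    using y(2) y(3)[rule_format, of W] that by simp
  then have "y \<in> points" unfolding dual_polar_points_def using y(1) by simp
  then show ?thesis using that y(2) by simp
qed

lemma points_nonempty: "points \<noteq> {}"
proof -
  have "isotropic {0}" unfolding totally_isotropic_def by auto
  then show ?thesis using isotropic_in_point by blast
qed

lemma span_insert_point: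
  assumes "isotropic Z" "Suc (vec.dim Z) = d" "v \<in> perp Z" "H v v = 0" "v \<notin> Z"
  shows "vec.span (insert v Z) \<in> points"
proof -
  have "v \<notin> vec.span Z" using assms(1,5) span_of_subspace isotropic_iff by metis
  then have "vec.dim (vec.span (insert v Z)) = d" using assms(2) dim_span_insert by metis
  then show ?thesis using isotropic_span_insert[OF assms(1,3,4)] pointI by blast
qed

lemma span_insert_eq_point:
  assumes "y \<in> points" "isotropic Z" "Suc (vec.dim Z) = d" "Z \<subseteq> y" "v \<in> y" "v \<notin> Z"
  shows "vec.span (insert v Z) = y"
proof (rule point_eqI)
  show "vec.span (insert v Z) \<in> points"
    using assms point_orthogonal by (intro span_insert_point) (auto simp: perp_def)
  show "vec.span (insert v Z) \<subseteq> y"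
    using assms point_subspace by (intro vec.span_minimal) auto
qed (use assms in simp)

text \<open>The points above \<open>Z\<close> are the isotropic lines of \<open>perp Z / Z\<close>,
  a Hermitian space of dimension three, and there are \<open>r ^ 3 + 1\<close> of these. The count
  uses the isotropic \<open>v\<close> in \<open>perp Z\<close> with \<open>H v e = 1\<close>, where
  \<open>e\<close> generates \<open>y0\<close> over \<open>Z\<close>: each point other than
  \<open>y0\<close> contains \<open>card Z\<close> of them.\<close>

lemma card_points_above_other:
  assumes Z: "isotropic Z" "Suc (vec.dim Z) = d" and y0: "y0 \<in> points" "Z \<subseteq> y0"
  shows "card {y \<in> points. Z \<subseteq> y \<and> y \<noteq> y0} = r ^ 3"
proof -
  have subZ: "vec.subspace Z" and ZpZ: "Z \<subseteq> perp Z" using Z(1) isotropic_iff by auto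
  have sub0: "vec.subspace y0" using point_subspace y0 by blast
  have "Z \<noteq> y0" using dim_point[OF y0(1)] Z(2) by auto
  then obtain e where e: "e \<in> y0" "e \<notin> Z" using y0 by blast
  have span_e: "vec.span (insert e Z) = y0" using span_insert_eq_point y0 Z e by blast
  have He: "H e e = 0" and eZ: "e \<in> perp Z"
    using point_orthogonal[OF y0(1)] e y0 unfolding perp_def by auto
  have perp_y0: "v \<in> perp y0 \<longleftrightarrow> v \<in> perp Z \<and> H v e = 0" for v
    using span_e perp_span[of "insert e Z"] unfolding perp_def by auto
  have "vec.dim (perp y0) < vec.dim (perp Z)"
    using dim_perp[OF subZ] dim_perp[OF sub0] dim_point[OF y0(1)] Z(2) by linarith
  then have "\<not> perp Z \<subseteq> perp y0" using vec.dim_subset by (metis not_le)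
  then obtain v1 where v1: "v1 \<in> perp Z" "H v1 e \<noteq> 0" using perp_y0 by blast
  define v0 where "v0 = inverse (H v1 e) *s v1"
  have v0: "v0 \<in> perp Z" "H v0 e = 1"
    using v1 vec.subspace_scale[OF subspace_perp] by (auto simp: v0_def H_scale_left)
  define S where "S = {v \<in> perp Z. H v v = 0 \<and> H v e = 1}"
  \<comment> \<open>The pairs \<open>(w, c)\<close> parametrise \<open>S\<close> by
    \<open>v0 + w + c *s e\<close>. For fixed \<open>w\<close>, isotropy is a trace equation in
    \<open>c\<close> with \<open>r\<close> solutions.\<close>
  define Q where "Q = {(w, c). w \<in> perp y0 \<and> v0 + w + c *s e \<in> S}"
  have "card Q = r * card (perp y0)"
  proof (rule card_const_fibres[where f = fst])
    fix w assume w: "w \<in> perp y0"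
    let ?u = "v0 + w"
    have u: "?u \<in> perp Z" "H ?u e = 1"
      using v0 w perp_y0[of w] vec.subspace_add[OF subspace_perp] by (auto simp: H_add_left)
    have eu: "H e ?u = 1" using H_swap[of e ?u] u(2) by simp
    have "?u + c *s e \<in> S \<longleftrightarrow> c ^ r + c = - H ?u ?u" for c
    proof -
      have "H (?u + c *s e) (?u + c *s e) = H ?u ?u + (c ^ r + c)"
        using u(2) eu He H_add_left[of ?u "c *s e"] H_add_right[of _ ?u "c *s e"]
        by (simp add: H_scale_left H_scale_right)
      moreover have "?u + c *s e \<in> perp Z"
        using u(1) eZ vec.subspace_add[OF subspace_perp] vec.subspace_scale[OF subspace_perp] by blast
      moreover have "H (?u + c *s e) e = 1"
        using u(2) He H_add_left[of ?u "c *s e" e] by (simp add: H_scale_left)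
      ultimately show ?thesis unfolding S_def by (simp add: eq_neg_iff_add_eq_0 add.commute)
    qed
    then have "{a \<in> Q. fst a = w} = Pair w ` {c. c ^ r + c = - H ?u ?u}"
      using w unfolding Q_def by auto
    moreover have "(- H ?u ?u) ^ r = - H ?u ?u"
      using H_swap[of ?u ?u] by (simp add: frobenius_uminus)
    ultimately show "card {a \<in> Q. fst a = w} = r"
      using card_trace_fibre by (simp add: card_image inj_on_def)
  qed (auto simp: Q_def)
  \<comment> \<open>The parametrisation is redundant: \<open>e\<close> lies in
    \<open>perp y0\<close>, so a multiple of \<open>e\<close> can be shifted between
    \<open>w\<close> and \<open>c *s e\<close>, and every \<open>v\<close> arises once for each
    scalar.\<close>
  moreover have "card Q = CARD('k) * card S"
  proof (rule card_const_fibres[where f = "\<lambda>(w, c). v0 + w + c *s e"])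
    fix v assume v: "v \<in> S"
    have "{a \<in> Q. (\<lambda>(w, c). v0 + w + c *s e) a = v} = (\<lambda>c. (v - v0 - c *s e, c)) ` UNIV"
    proof (intro equalityI subsetI)
      fix a assume "a \<in> (\<lambda>c. (v - v0 - c *s e, c)) ` UNIV"
      then obtain c where a: "a = (v - v0 - c *s e, c)" by blast
      let ?w = "v - v0 - c *s e"
      have "?w \<in> perp Z"
        using v v0 eZ vec.subspace_diff[OF subspace_perp] vec.subspace_scale[OF subspace_perp]
        unfolding S_def by blast
      moreover have "H v e = H (?w + (v0 + c *s e)) e" by simp
      then have "H ?w e = 0" using v v0 He unfolding H_add_left S_def by (simp add: H_scale_left)
      ultimately have "?w \<in> perp y0" using perp_y0 by blast
      then show "a \<in> {a \<in> Q. (\<lambda>(w, c). v0 + w + c *s e) a = v}" using v a unfolding Q_def by simp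
    qed (auto simp: algebra_simps)
    then show "card {a \<in> Q. (\<lambda>(w, c). v0 + w + c *s e) a = v} = CARD('k)"
      by (simp add: card_image inj_on_def)
  qed (auto simp: Q_def)
  moreover have "card S = card Z * card {y \<in> points. Z \<subseteq> y \<and> y \<noteq> y0}"
  proof (rule card_const_fibres[where f = "\<lambda>v. vec.span (insert v Z)"])
    fix v assume v: "v \<in> S"
    have "v \<notin> y0" using v point_orthogonal[OF y0(1) _ e(1), of v] unfolding S_def by auto
    moreover have "vec.span (insert v Z) \<in> points"
      using v \<open>v \<notin> y0\<close> y0 Z unfolding S_def by (intro span_insert_point) auto
    ultimately show "vec.span (insert v Z) \<in> {y \<in> points. Z \<subseteq> y \<and> y \<noteq> y0}"
      using vec.span_base[of _ "insert v Z"] by blast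
  next
    fix y assume "y \<in> {y \<in> points. Z \<subseteq> y \<and> y \<noteq> y0}"
    then have y: "y \<in> points" "Z \<subseteq> y" "y \<noteq> y0" by auto
    have suby: "vec.subspace y" using point_subspace y by blast
    \<comment> \<open>A point other than \<open>y0\<close> misses \<open>e\<close>, so it is not
      orthogonal to \<open>e\<close> and contains a normalised vector \<open>v3\<close>; its members
      in \<open>S\<close> form the coset of \<open>Z\<close> through \<open>v3\<close>.\<close>
    have "e \<notin> y" using span_insert_eq_point[of y Z e] y Z e span_e by blast
    then have "e \<notin> perp y" using isotropic_vector_in_point[OF y(1)] He by blast
    then obtain v2 where v2: "v2 \<in> y" "H v2 e \<noteq> 0" using mem_perp_swap by blast
    define v3 where "v3 = inverse (H v2 e) *s v2"
    have v3: "v3 \<in> y" "H v3 e = 1"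
      using v2 vec.subspace_scale[OF suby] by (auto simp: v3_def H_scale_left)
    have in_Z: "z \<in> Z" if z: "z \<in> y" "H z e = 0" for z
    proof (rule ccontr)
      assume "z \<notin> Z"
      then have "vec.span (insert z Z) = y" using span_insert_eq_point y Z z by blast
      moreover have "insert z Z \<subseteq> perp {e}"
        using z eZ mem_perp_swap[of e Z] unfolding perp_def by auto
      ultimately have "y \<subseteq> perp {e}" using vec.span_minimal[OF _ subspace_perp] by blast
      then show False using v3 unfolding perp_def by auto
    qed
    have Ze: "H z e = 0" if "z \<in> Z" for z using that eZ mem_perp_swap by blast
    have "{v \<in> S. vec.span (insert v Z) = y} = (+) v3 ` Z"
    proof (intro equalityI subsetI)
      fix v assume v: "v \<in> {v \<in> S. vec.span (insert v Z) = y}"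
      then have "v \<in> y" by (auto intro: vec.span_base)
      moreover have "H v e = H ((v - v3) + v3) e" by simp
      then have "H (v - v3) e = 0" using v v3 unfolding H_add_left S_def by auto
      ultimately have "v - v3 \<in> Z" using in_Z v3 vec.subspace_diff[OF suby] by blast
      then show "v \<in> (+) v3 ` Z" by (intro image_eqI[of _ _ "v - v3"]) auto
    next
      fix v assume "v \<in> (+) v3 ` Z"
      then obtain z where z: "z \<in> Z" "v = v3 + z" by blast
      then have vy: "v \<in> y" using v3 y vec.subspace_add[OF suby] by blast
      have vS: "v \<in> S"
        using vy y(2) z(2) v3(2) Ze[OF z(1)] point_orthogonal[OF y(1) vy] H_add_left[of v3 z e]
        unfolding S_def perp_def by auto
      then have "v \<notin> Z" using Ze unfolding S_def by auto
      then have "vec.span (insert v Z) = y" using span_insert_eq_point y Z vy by blast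
      then show "v \<in> {v \<in> S. vec.span (insert v Z) = y}" using vS by blast
    qed
    then show "card {v \<in> S. vec.span (insert v Z) = y} = card Z" by (simp add: card_image)
  qed (auto simp: S_def)
  ultimately have "r * card (perp y0)
      = CARD('k) * (card Z * card {y \<in> points. Z \<subseteq> y \<and> y \<noteq> y0})" by simp
  \<comment> \<open>\<open>perp y0\<close> has dimension \<open>d + 1\<close>, so cancelling the
    powers of the field order leaves \<open>r * CARD('k)\<close>.\<close>
  moreover have "vec.dim (perp y0) = vec.dim Z + 2"
    using dim_perp[OF sub0] dim_point[OF y0(1)] Z(2) by linarith
  ultimately have "(CARD('k) * CARD('k) ^ vec.dim Z) * (r * CARD('k))
      = (CARD('k) * CARD('k) ^ vec.dim Z) * card {y \<in> points. Z \<subseteq> y \<and> y \<noteq> y0}"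
    using card_subspace[OF subspace_perp, of y0] card_subspace[OF subZ]
    by (simp add: power_add power2_eq_square mult_ac)
  then have "r * CARD('k) = card {y \<in> points. Z \<subseteq> y \<and> y \<noteq> y0}"
    by (subst (asm) mult_cancel1) auto
  then show ?thesis using card_field by (simp add: power2_eq_square power3_eq_cube)
qed

end

section \<open>Counting maximal isotropic subspaces\<close>

lemma sum_card_swap:
  assumes "finite A" "finite B"
  shows "(\<Sum>a\<in>A. card {b \<in> B. R a b}) = (\<Sum>b\<in>B. card {a \<in> A. R a b})"
proof -
  have "(\<Sum>a\<in>A. card {b \<in> B. R a b}) = (\<Sum>a\<in>A. \<Sum>b\<in>B. if R a b then 1 else 0)"
    using assms by (intro sum.cong refl) (simp add: sum.If_cases Int_def)
  also have "\<dots> = (\<Sum>b\<in>B. \<Sum>a\<in>A. if R a b then 1 else 0)" by (rule sum.swap)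
  also have "\<dots> = (\<Sum>b\<in>B. card {a \<in> A. R a b})"
    using assms by (intro sum.cong refl) (simp add: sum.If_cases Int_def)
  finally show ?thesis .
qed

context hermitian_space
begin

section \<open>Hyperplanes of a point and its neighbours\<close>

lemma hyperplane_avoiding_iff:
  assumes "x \<in> points" "e \<in> x" "e \<noteq> 0"
  shows "Z \<in> relative_complements x (vec.span {e}) {0}
    \<longleftrightarrow> vec.subspace Z \<and> Z \<subseteq> x \<and> Suc (vec.dim Z) = d \<and> e \<notin> Z"
proof -
  have sub: "vec.span {e} \<subseteq> x"
    using assms point_subspace by (intro vec.span_minimal) auto
  have dim: "vec.dim (vec.span {e}) = 1" using assms(3) by simp
  have "Z \<inter> vec.span {e} = {0} \<longleftrightarrow> e \<notin> Z" if Z: "vec.subspace Z"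
  proof
    assume "Z \<inter> vec.span {e} = {0}"
    then show "e \<notin> Z" using assms(3) vec.span_base[of e "{e}"] by auto
  next
    assume e: "e \<notin> Z"
    have "v = 0" if v: "v \<in> Z" "v \<in> vec.span {e}" for v
    proof (rule ccontr)
      assume "v \<noteq> 0"
      obtain k where k: "v = k *s e" using v(2) unfolding vec.span_singleton by blast
      then have "e = inverse k *s v" using \<open>v \<noteq> 0\<close> by auto
      then show False using vec.subspace_scale[OF Z v(1)] e by metis
    qed
    then show "Z \<inter> vec.span {e} = {0}"
      using vec.subspace_0[OF Z] vec.span_zero by blast
  qed
  moreover have "Z \<in> relative_complements x (vec.span {e}) {0} \<longleftrightarrow> Suc (vec.dim Z) = d"
    if "vec.subspace Z" "Z \<subseteq> x" "Z \<inter> vec.span {e} = {0}"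
    using relative_complements_iff_dim[OF point_subspace[OF assms(1)] _ sub that]
      dim dim_point[OF assms(1)] by simp
  moreover have "vec.subspace Z \<and> Z \<subseteq> x \<and> Z \<inter> vec.span {e} = {0}"
    if "Z \<in> relative_complements x (vec.span {e}) {0}"
    using that unfolding relative_complements_def by blast
  ultimately show ?thesis by blast
qed

lemma card_hyperplanes_avoiding:
  assumes "x \<in> points" "e \<in> x" "e \<noteq> 0"
  shows "card {Z. vec.subspace Z \<and> Z \<subseteq> x \<and> Suc (vec.dim Z) = d \<and> e \<notin> Z} = CARD('k) ^ (d - 1)"
proof -
  have "vec.span {e} \<subseteq> x"
    using assms point_subspace by (intro vec.span_minimal) auto
  then have "card (relative_complements x (vec.span {e}) {0}) = CARD('k) ^ ((d - 1) * 1)"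
    using card_relative_complements[of x "vec.span {e}" "{0}"] assms point_subspace dim_point
    by (simp add: vec.span_zero)
  moreover have "relative_complements x (vec.span {e}) {0}
      = {Z. vec.subspace Z \<and> Z \<subseteq> x \<and> Suc (vec.dim Z) = d \<and> e \<notin> Z}"
    using hyperplane_avoiding_iff[OF assms] by blast
  ultimately show ?thesis by simp
qed

text \<open>From \<open>y\<close> one passes to another point \<open>y'\<close> above a hyperplane
  \<open>Z\<close> of \<open>y\<close> that misses some \<open>e\<close> in
  \<open>x \<inter> y\<close>; the intersection with \<open>x\<close> loses exactly the direction of
  \<open>e\<close>. As every distance occurs, linear relations between the matrices can be tested on
  each intersection dimension.\<close>

lemma point_at_codim:
  assumes x: "x \<in> points" and "k \<le> d"
  shows "\<exists>y\<in>points. vec.dim (x \<inter> y) = d - k"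
  using assms(2)
proof (induction k)
  case 0
  then show ?case using x dim_point[OF x] by (intro bexI[of _ x]) auto
next
  case (Suc k)
  then obtain y where y: "y \<in> points" "vec.dim (x \<inter> y) = d - k" by auto
  have "\<not> x \<inter> y \<subseteq> {0}" using y(2) Suc.prems by (metis vec.dim_eq_0 zero_less_diff not_gr0 Suc_le_eq)
  then obtain e where e: "e \<in> x" "e \<in> y" "e \<noteq> 0" by blast
  have "card {Z. vec.subspace Z \<and> Z \<subseteq> y \<and> Suc (vec.dim Z) = d \<and> e \<notin> Z} \<noteq> 0"
    using card_hyperplanes_avoiding[OF y(1) e(2,3)] by simp
  then have "{Z. vec.subspace Z \<and> Z \<subseteq> y \<and> Suc (vec.dim Z) = d \<and> e \<notin> Z} \<noteq> {}"
    by (metis card.empty)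
  then obtain Z where Z: "vec.subspace Z" "Z \<subseteq> y" "Suc (vec.dim Z) = d" "e \<notin> Z" by blast
  have isoZ: "isotropic Z" using isotropic_subset[OF point_isotropic[OF y(1)] Z(1,2)] .
  have "card {y' \<in> points. Z \<subseteq> y' \<and> y' \<noteq> y} \<noteq> 0"
    using card_points_above_other[OF isoZ Z(3) y(1) Z(2)] r_gt_1 by simp
  then have "{y' \<in> points. Z \<subseteq> y' \<and> y' \<noteq> y} \<noteq> {}" by (metis card.empty)
  then obtain y' where y': "y' \<in> points" "Z \<subseteq> y'" "y' \<noteq> y" by blast
  have span_y: "vec.span (insert e Z) = y" using span_insert_eq_point y isoZ Z e by blast
  have "e \<notin> y'" using span_insert_eq_point[OF y'(1) isoZ Z(3) y'(2) _ Z(4)] span_y y'(3) by blast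
  have "x \<inter> y' = x \<inter> Z"
  proof
    \<comment> \<open>A vector \<open>v\<close> of \<open>x \<inter> y'\<close> outside
      \<open>Z\<close> generates \<open>y'\<close> over \<open>Z\<close>. Now \<open>e\<close> is
      orthogonal to \<open>v\<close> within \<open>x\<close> and to \<open>Z\<close> within
      \<open>y\<close>, so it would belong to \<open>y'\<close>.\<close>
    show "x \<inter> y' \<subseteq> x \<inter> Z"
    proof (rule ccontr)
      assume "\<not> x \<inter> y' \<subseteq> x \<inter> Z"
      then obtain v where v: "v \<in> x" "v \<in> y'" "v \<notin> Z" by blast
      have "vec.span (insert v Z) = y'"
        using span_insert_eq_point[OF y'(1) isoZ Z(3) y'(2) v(2,3)] .
      moreover have "e \<in> perp (insert v Z)"
        using point_orthogonal[OF x e(1) v(1)] point_orthogonal[OF y(1) e(2)] Z(2)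
        unfolding perp_def by auto
      ultimately have "e \<in> perp y'" using perp_span by metis
      then show False
        using isotropic_vector_in_point[OF y'(1)] point_orthogonal[OF x e(1) e(1)] \<open>e \<notin> y'\<close> by blast
    qed
  qed (use y' in blast)
  moreover have subxZ: "vec.subspace (x \<inter> Z)"
    using vec.subspace_inter point_subspace[OF x] Z(1) by blast
  have "x \<inter> y = vec.span (insert e (x \<inter> Z))"
  proof
    show "x \<inter> y \<subseteq> vec.span (insert e (x \<inter> Z))"
    proof
      fix v assume v: "v \<in> x \<inter> y"
      then obtain k where "v - k *s e \<in> Z" using span_y mem_span_insert[OF Z(1)] by blast
      moreover have "v - k *s e \<in> x"
        using v e vec.subspace_diff[OF point_subspace[OF x]] vec.subspace_scale[OF point_subspace[OF x]]
        by blast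
      ultimately show "v \<in> vec.span (insert e (x \<inter> Z))" using mem_span_insert[OF subxZ] by blast
    qed
    show "vec.span (insert e (x \<inter> Z)) \<subseteq> x \<inter> y"
      using e Z(2) vec.subspace_inter[OF point_subspace[OF x] point_subspace[OF y(1)]]
      by (intro vec.span_minimal) auto
  qed
  moreover have "e \<notin> vec.span (x \<inter> Z)" unfolding span_of_subspace[OF subxZ] using Z(4) by blast
  ultimately have "vec.dim (x \<inter> y) = Suc (vec.dim (x \<inter> y'))"
    using dim_span_insert[of e "x \<inter> Z"] by simp
  then show ?case using y(2) y'(1) by (intro bexI[of _ y']) auto
qed

lemma dim_Int_points_le:
  assumes "x \<in> points"
  shows "vec.dim (x \<inter> y) \<le> d"
  using vec.dim_subset[of "x \<inter> y" x] dim_point[OF assms] by auto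

lemma dim_Int_points_less:
  assumes "x \<in> points" "y \<in> points" "x \<noteq> y"
  shows "vec.dim (x \<inter> y) < d"
proof (rule ccontr)
  assume "\<not> vec.dim (x \<inter> y) < d"
  then have "x \<inter> y = x"
    using dim_point[OF assms(1)] vec.subspace_inter point_subspace assms
    by (intro vec.subspace_dim_equal) auto
  then show False using point_eqI assms by blast
qed

text \<open>Neighbours are sorted by the hyperplane in which they meet \<open>x\<close>, each
  hyperplane carrying \<open>r ^ 3\<close> of them. The set \<open>S\<close> allows all neighbours
  and those through a given vector to be counted alike.\<close>

lemma card_neighbours_meeting_in:
  assumes x: "x \<in> points"
    and S: "\<And>Z. Z \<in> S \<Longrightarrow> vec.subspace Z \<and> Z \<subseteq> x \<and> Suc (vec.dim Z) = d"
  shows "card {y \<in> points. x \<inter> y \<in> S} = r ^ 3 * card S"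
proof (rule card_const_fibres[where f = "\<lambda>y. x \<inter> y"])
  fix Z assume "Z \<in> S"
  then have Z: "vec.subspace Z" "Z \<subseteq> x" "Suc (vec.dim Z) = d" "Z \<in> S" using S by auto
  have isoZ: "isotropic Z" using isotropic_subset[OF point_isotropic[OF x] Z(1,2)] .
  have "{y \<in> {y \<in> points. x \<inter> y \<in> S}. x \<inter> y = Z} = {y \<in> points. Z \<subseteq> y \<and> y \<noteq> x}"
  proof (intro equalityI subsetI)
    fix y assume "y \<in> {y \<in> {y \<in> points. x \<inter> y \<in> S}. x \<inter> y = Z}"
    then have "y \<in> points" "x \<inter> y = Z" by auto
    moreover from this have "y \<noteq> x" using dim_point[OF x] Z(3) by auto
    ultimately show "y \<in> {y \<in> points. Z \<subseteq> y \<and> y \<noteq> x}" by blast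
  next
    fix y assume "y \<in> {y \<in> points. Z \<subseteq> y \<and> y \<noteq> x}"
    then have y: "y \<in> points" "Z \<subseteq> y" "y \<noteq> x" by auto
    have "Z = x \<inter> y"
      using dim_Int_points_less[OF x y(1)] y Z(1-3)
        vec.subspace_inter[OF point_subspace[OF x] point_subspace[OF y(1)]]
      by (intro vec.subspace_dim_equal) auto
    then show "y \<in> {y \<in> {y \<in> points. x \<inter> y \<in> S}. x \<inter> y = Z}" using y Z(4) by simp
  qed
  then show "card {y \<in> {y \<in> points. x \<inter> y \<in> S}. x \<inter> y = Z} = r ^ 3"
    using card_points_above_other[OF isoZ Z(3) x Z(2)] by simp
qed (simp_all add: finite)

lemma card_hyperplanes:
  assumes "x \<in> points" "d > 0"
  shows "card {Z. vec.subspace Z \<and> Z \<subseteq> x \<and> Suc (vec.dim Z) = d} = qbinomial CARD('k) d (d - 1)"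
proof -
  have "card {Z. vec.subspace Z \<and> {0} \<subseteq> Z \<and> Z \<subseteq> x \<and> vec.dim Z = vec.dim ({0} :: ('k ^ 'n) set) + (d - 1)}
      = qbinomial CARD('k) (vec.dim x - vec.dim ({0} :: ('k ^ 'n) set)) (d - 1)"
    using vec.subspace_0[OF point_subspace[OF assms(1)]]
    by (intro card_subspaces_between point_subspace[OF assms(1)]) auto
  moreover have "{Z. vec.subspace Z \<and> {0} \<subseteq> Z \<and> Z \<subseteq> x \<and> vec.dim Z = vec.dim ({0} :: ('k ^ 'n) set) + (d - 1)}
      = {Z. vec.subspace Z \<and> Z \<subseteq> x \<and> Suc (vec.dim Z) = d}"
    using assms(2) vec.subspace_0 by auto
  ultimately show ?thesis using dim_point[OF assms(1)] by simp
qed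

lemma card_neighbours:
  assumes "x \<in> points" "d > 0"
  shows "card {y \<in> points. Suc (vec.dim (x \<inter> y)) = d} = r ^ 3 * qbinomial CARD('k) d (d - 1)"
proof -
  let ?S = "{Z. vec.subspace Z \<and> Z \<subseteq> x \<and> Suc (vec.dim Z) = d}"
  have "{y \<in> points. Suc (vec.dim (x \<inter> y)) = d} = {y \<in> points. x \<inter> y \<in> ?S}"
    using vec.subspace_inter point_subspace assms(1) by auto
  then show ?thesis
    using card_neighbours_meeting_in[OF assms(1), of ?S] card_hyperplanes[OF assms] by simp
qed

text \<open>For \<open>e\<close> in \<open>x\<close>, a neighbour contains \<open>e\<close> exactly
  if its hyperplane does, so the hyperplanes avoiding \<open>e\<close> are discarded. The equation
  is additive to keep subtraction out of the natural numbers.\<close>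

lemma card_neighbours_through:
  assumes "x \<in> points" "d > 0" "e \<in> x" "e \<noteq> 0"
  shows "card {y \<in> points. Suc (vec.dim (x \<inter> y)) = d \<and> e \<in> y} + r ^ 3 * CARD('k) ^ (d - 1)
    = r ^ 3 * qbinomial CARD('k) d (d - 1)"
proof -
  let ?S = "{Z. vec.subspace Z \<and> Z \<subseteq> x \<and> Suc (vec.dim Z) = d \<and> e \<in> Z}"
  let ?S' = "{Z. vec.subspace Z \<and> Z \<subseteq> x \<and> Suc (vec.dim Z) = d \<and> e \<notin> Z}"
  have "{y \<in> points. Suc (vec.dim (x \<inter> y)) = d \<and> e \<in> y} = {y \<in> points. x \<inter> y \<in> ?S}"
    using vec.subspace_inter point_subspace assms(1,3) by auto
  then have "card {y \<in> points. Suc (vec.dim (x \<inter> y)) = d \<and> e \<in> y} = r ^ 3 * card ?S"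
    using card_neighbours_meeting_in[OF assms(1), of ?S] by simp
  moreover have "card {Z. vec.subspace Z \<and> Z \<subseteq> x \<and> Suc (vec.dim Z) = d} = card ?S + card ?S'"
  proof -
    have "{Z. vec.subspace Z \<and> Z \<subseteq> x \<and> Suc (vec.dim Z) = d} = ?S \<union> ?S'" by blast
    moreover have "card (?S \<union> ?S') = card ?S + card ?S'"
      by (rule card_Un_disjoint) (auto simp: finite)
    ultimately show ?thesis by presburger
  qed
  ultimately show ?thesis
    using card_hyperplanes[OF assms(1,2)] card_hyperplanes_avoiding[OF assms(1,3,4)]
    by (simp add: distrib_left)
qed

lemma Suc_dim_Int_perp:
  assumes "y \<in> points" "e \<notin> y" "H e e = 0"
  shows "Suc (vec.dim (y \<inter> perp {e})) = d"
proof -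
  have sub: "vec.subspace y" "vec.subspace (y \<inter> perp {e})"
    using point_subspace[OF assms(1)] subspace_perp vec.subspace_inter by auto
  have "e \<notin> perp y" using isotropic_vector_in_point assms by blast
  then have "\<not> y \<subseteq> perp {e}" using subset_perp_swap[of y "{e}"] by blast
  then have "vec.dim (y \<inter> perp {e}) < d"
    using vec.subspace_dim_equal[OF sub(2,1)] dim_point[OF assms(1)] by (metis inf.orderI inf_le1 not_le)
  moreover have "d \<le> vec.dim (y \<inter> perp {e}) + 1"
    using dim_perp_Int_ge[of "{e}" y] sub(1) dim_point[OF assms(1)] by simp
  ultimately show ?thesis by simp
qed

text \<open>A neighbour through \<open>e\<close> meets \<open>x\<close> inside
  \<open>perp {e}\<close>, and \<open>x \<inter> perp {e}\<close> is already a hyperplane of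
  \<open>x\<close>. The neighbour is thus spanned by this hyperplane and \<open>e\<close>.\<close>

lemma card_neighbours_through_outside:
  assumes x: "x \<in> points" and e: "e \<notin> x" "H e e = 0"
  shows "card {y \<in> points. Suc (vec.dim (x \<inter> y)) = d \<and> e \<in> y} = 1"
proof -
  let ?Z = "x \<inter> perp {e}"
  have Z: "vec.subspace ?Z" "Suc (vec.dim ?Z) = d"
    using point_subspace[OF x] subspace_perp vec.subspace_inter Suc_dim_Int_perp[OF x e] by auto
  have isoZ: "isotropic ?Z" using isotropic_subset[OF point_isotropic[OF x] Z(1)] by blast
  have eZ: "e \<in> perp ?Z" "e \<notin> ?Z" using subset_perp_swap[of "{e}" ?Z] e by auto
  have "{y \<in> points. Suc (vec.dim (x \<inter> y)) = d \<and> e \<in> y} = {vec.span (insert e ?Z)}"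
  proof (intro equalityI subsetI)
    fix y assume "y \<in> {y \<in> points. Suc (vec.dim (x \<inter> y)) = d \<and> e \<in> y}"
    then have y: "y \<in> points" "Suc (vec.dim (x \<inter> y)) = d" "e \<in> y" by auto
    have "x \<inter> y \<subseteq> ?Z" using point_orthogonal[OF y(1) _ y(3)] unfolding perp_def by blast
    then have "x \<inter> y = ?Z"
      using y(2) Z vec.subspace_inter[OF point_subspace[OF x] point_subspace[OF y(1)]]
      by (intro vec.subspace_dim_equal) auto
    then have "vec.span (insert e ?Z) = y"
      using span_insert_eq_point[OF y(1) isoZ Z(2) _ y(3) eZ(2)] by blast
    then show "y \<in> {vec.span (insert e ?Z)}" by simp
  next
    fix y assume "y \<in> {vec.span (insert e ?Z)}"
    then have y: "y = vec.span (insert e ?Z)" by simp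
    have yp: "y \<in> points" unfolding y using span_insert_point[OF isoZ Z(2) eZ(1) e(2) eZ(2)] .
    have ey: "e \<in> y" unfolding y by (auto intro: vec.span_base)
    then have "y \<noteq> x" using e by blast
    then have "vec.dim (x \<inter> y) < d" using dim_Int_points_less[OF x yp] by blast
    moreover have "vec.dim ?Z \<le> vec.dim (x \<inter> y)"
      unfolding y by (intro vec.dim_subset) (auto intro: vec.span_base)
    ultimately show "y \<in> {y \<in> points. Suc (vec.dim (x \<inter> y)) = d \<and> e \<in> y}"
      using Z(2) yp ey by simp
  qed
  then show ?thesis by simp
qed

section \<open>Counts modulo a divisor of \<open>r + 1\<close>\<close>

context
  fixes p :: nat
  assumes p_dvd: "p dvd r + 1"
begin

lemma card_field_cong: "[CARD('k) = 1] (mod p)"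
proof -
  have "r ^ 2 - 1 = (r + 1) * (r - 1)" by (simp add: power2_eq_square algebra_simps)
  then have "p dvd r ^ 2 - 1" using p_dvd by (simp only: dvd_mult2)
  then show ?thesis using r_gt_1 by (simp add: card_field cong_altdef_nat)
qed

lemma cube_cong: "p dvd r ^ 3 + 1"
proof -
  have "int (r ^ 3 + 1) = int (r + 1) * (int r ^ 2 - int r + 1)"
    by (simp add: power2_eq_square power3_eq_cube algebra_simps)
  then have "int p dvd int (r ^ 3 + 1)" using p_dvd by (metis dvd_mult2 int_dvd_int_iff)
  then show ?thesis by (simp only: int_dvd_int_iff)
qed

lemma card_relative_complements_cong:
  fixes E :: "('k ^ 'n) set"
  assumes "vec.subspace E" "vec.subspace B" "vec.subspace T" "T \<subseteq> B" "B \<subseteq> E"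
  shows "[card (relative_complements E B T) = 1] (mod p)"
  using card_relative_complements[OF assms] cong_pow[OF card_field_cong] by simp

lemma card_subspaces_between_cong:
  fixes E :: "('k ^ 'n) set"
  assumes "vec.subspace E" "vec.subspace T" "T \<subseteq> E" "vec.dim T \<le> k"
  shows "[card {U. vec.subspace U \<and> T \<subseteq> U \<and> U \<subseteq> E \<and> vec.dim U = k}
    = (vec.dim E - vec.dim T) choose (k - vec.dim T)] (mod p)"
  using card_subspaces_between[OF assms(1-3), of "k - vec.dim T"] assms(4)
    qbinomial_cong[OF card_field_cong] by simp

lemma card_subspaces_cong:
  fixes E :: "('k ^ 'n) set"
  assumes "vec.subspace E"
  shows "[card {U. vec.subspace U \<and> U \<subseteq> E \<and> vec.dim U = k} = vec.dim E choose k] (mod p)"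
proof -
  have "{U. vec.subspace U \<and> {0} \<subseteq> U \<and> U \<subseteq> E \<and> vec.dim U = k}
      = {U. vec.subspace U \<and> U \<subseteq> E \<and> vec.dim U = k}"
    using vec.subspace_0 by auto
  then show ?thesis
    using card_subspaces_between_cong[of E "{0}" k] assms vec.subspace_0[OF assms] by simp
qed

text \<open>The points above \<open>T\<close> are split by a vector \<open>e\<close> outside
  \<open>T\<close> taken from one of them. Modulo \<open>p\<close>, those missing \<open>e\<close>
  are \<open>r ^ 3\<close> times as many as those through \<open>e\<close>, so the total is a
  multiple of \<open>r ^ 3 + 1\<close>, which \<open>r + 1\<close> divides.\<close>

lemma dvd_card_points_above:
  assumes T: "isotropic T" "vec.dim T < d"
  shows "p dvd card {y \<in> points. T \<subseteq> y}"
proof -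
  obtain y0 where y0: "y0 \<in> points" "T \<subseteq> y0" using isotropic_in_point[OF T(1)] .
  have subT: "vec.subspace T" using T isotropic_iff by blast
  have "T \<noteq> y0" using dim_point[OF y0(1)] T(2) by auto
  then obtain e where e: "e \<in> y0" "e \<notin> T" using y0 by blast
  have He: "H e e = 0" and eT: "\<And>t. t \<in> T \<Longrightarrow> H t e = 0"
    using point_orthogonal[OF y0(1)] e y0 by auto
  define Y1 where "Y1 = {y \<in> points. T \<subseteq> y \<and> e \<in> y}"
  define Y0 where "Y0 = {y \<in> points. T \<subseteq> y \<and> e \<notin> y}"
  \<comment> \<open>\<open>ZZ\<close> links the two kinds of points: a point missing
    \<open>e\<close> has its part orthogonal to \<open>e\<close> in \<open>ZZ\<close>, and adding
    \<open>e\<close> to a member of \<open>ZZ\<close> gives a point through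
    \<open>e\<close>.\<close>
  define ZZ where "ZZ = {Z. isotropic Z \<and> T \<subseteq> Z \<and> Suc (vec.dim Z) = d \<and> e \<in> perp Z \<and> e \<notin> Z}"
  have cardY0: "card Y0 = r ^ 3 * card ZZ"
  proof (rule card_const_fibres[where f = "\<lambda>y. y \<inter> perp {e}"])
    fix y assume "y \<in> Y0"
    then have y: "y \<in> points" "T \<subseteq> y" "e \<notin> y" unfolding Y0_def by auto
    have "isotropic (y \<inter> perp {e})"
      using isotropic_subset[OF point_isotropic[OF y(1)]] vec.subspace_inter
        point_subspace[OF y(1)] subspace_perp by blast
    moreover have "T \<subseteq> y \<inter> perp {e}" using y eT unfolding perp_def by auto
    moreover have "e \<in> perp (y \<inter> perp {e})" using subset_perp_swap[of "{e}" "y \<inter> perp {e}"] by auto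
    ultimately show "y \<inter> perp {e} \<in> ZZ"
      using Suc_dim_Int_perp[OF y(1,3) He] y(3) unfolding ZZ_def by auto
  next
    fix Z assume "Z \<in> ZZ"
    then have Z: "isotropic Z" "T \<subseteq> Z" "Suc (vec.dim Z) = d" "e \<in> perp Z" "e \<notin> Z"
      unfolding ZZ_def by auto
    have y': "vec.span (insert e Z) \<in> points" using span_insert_point[OF Z(1,3,4) He Z(5)] .
    have Zp: "Z \<subseteq> perp {e}" using Z(4) subset_perp_swap[of Z "{e}"] by blast
    have "{y \<in> Y0. y \<inter> perp {e} = Z} = {y \<in> points. Z \<subseteq> y \<and> y \<noteq> vec.span (insert e Z)}"
    proof (intro equalityI subsetI)
      fix y assume y: "y \<in> {y \<in> Y0. y \<inter> perp {e} = Z}"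
      have "e \<in> vec.span (insert e Z)" by (auto intro: vec.span_base)
      then show "y \<in> {y \<in> points. Z \<subseteq> y \<and> y \<noteq> vec.span (insert e Z)}"
        using y unfolding Y0_def by blast
    next
      fix y assume "y \<in> {y \<in> points. Z \<subseteq> y \<and> y \<noteq> vec.span (insert e Z)}"
      then have y: "y \<in> points" "Z \<subseteq> y" "y \<noteq> vec.span (insert e Z)" by auto
      have ey: "e \<notin> y" using span_insert_eq_point[OF y(1) Z(1,3) y(2) _ Z(5)] y(3) by blast
      have "Z = y \<inter> perp {e}"
        using Suc_dim_Int_perp[OF y(1) ey He] Z(1,3) Zp y(2) isotropic_iff
          vec.subspace_inter[OF point_subspace[OF y(1)] subspace_perp]
        by (intro vec.subspace_dim_equal) auto
      then show "y \<in> {y \<in> Y0. y \<inter> perp {e} = Z}" using y ey Z(2) unfolding Y0_def by blast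
    qed
    moreover have "Z \<subseteq> vec.span (insert e Z)" by (auto intro: vec.span_base)
    ultimately show "card {y \<in> Y0. y \<inter> perp {e} = Z} = r ^ 3"
      using card_points_above_other[OF Z(1,3) y'] by simp
  qed (simp_all add: finite)
  have cardZZ: "[card ZZ = 1 * card Y1] (mod p)"
  proof (rule card_fibres_cong[where f = "\<lambda>Z. vec.span (insert e Z)"])
    fix Z assume "Z \<in> ZZ"
    then have "isotropic Z" "T \<subseteq> Z" "Suc (vec.dim Z) = d" "e \<in> perp Z" "e \<notin> Z"
      unfolding ZZ_def by auto
    moreover have "insert e Z \<subseteq> vec.span (insert e Z)" by (rule vec.span_superset)
    ultimately show "vec.span (insert e Z) \<in> Y1" using span_insert_point He unfolding Y1_def by blast
  next
    fix y assume "y \<in> Y1"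
    then have y: "y \<in> points" "T \<subseteq> y" "e \<in> y" unfolding Y1_def by auto
    let ?B = "vec.span (insert e T)"
    have suby: "vec.subspace y" using point_subspace[OF y(1)] .
    have B: "?B \<subseteq> y" using y suby by (intro vec.span_minimal) auto
    have TB: "insert e T \<subseteq> ?B" by (rule vec.span_superset)
    have "e \<notin> vec.span T" unfolding span_of_subspace[OF subT] by (rule e(2))
    then have dimB: "vec.dim ?B = Suc (vec.dim T)" by (rule dim_span_insert)
    \<comment> \<open>Over a point \<open>y\<close> through \<open>e\<close> lie the complements in
      \<open>y\<close>, over \<open>T\<close>, of the span of \<open>e\<close> and \<open>T\<close>.
      Their number is a power of \<open>CARD('k)\<close>, hence one modulo \<open>p\<close>.\<close>
    have "{Z \<in> ZZ. vec.span (insert e Z) = y} = relative_complements y ?B T"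
    proof (intro equalityI subsetI)
      fix Z assume "Z \<in> {Z \<in> ZZ. vec.span (insert e Z) = y}"
      then have Z: "isotropic Z" "T \<subseteq> Z" "Suc (vec.dim Z) = d" "e \<notin> Z" "vec.span (insert e Z) = y"
        unfolding ZZ_def by auto
      have subZ: "vec.subspace Z" using Z isotropic_iff by blast
      have Zy: "Z \<subseteq> y" using Z(5) vec.span_superset[of "insert e Z"] by blast
      have "Z \<inter> ?B \<subseteq> T"
      proof
        fix v assume v: "v \<in> Z \<inter> ?B"
        then obtain k where k: "v - k *s e \<in> T" using mem_span_insert[OF subT] by blast
        have "k *s e = v - (v - k *s e)" by simp
        then have ke: "k *s e \<in> Z" using v k Z(2) vec.subspace_diff[OF subZ] by (metis IntD1 subsetD)
        have "k = 0"
        proof (rule ccontr)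
          assume "k \<noteq> 0"
          then have "e = inverse k *s (k *s e)" by simp
          then show False using vec.subspace_scale[OF subZ ke] Z(4) by metis
        qed
        then show "v \<in> T" using k by simp
      qed
      then have "Z \<inter> ?B = T" using Z(2) TB by blast
      then show "Z \<in> relative_complements y ?B T"
        using relative_complements_iff_dim[OF suby _ B subZ Zy, of T] dimB dim_point[OF y(1)] Z(3) by simp
    next
      fix Z assume ZC: "Z \<in> relative_complements y ?B T"
      then have Z: "vec.subspace Z" "Z \<subseteq> y" "Z \<inter> ?B = T"
        unfolding relative_complements_def by auto
      have dimZ: "Suc (vec.dim Z) = d"
        using ZC relative_complements_iff_dim[OF suby _ B Z] dimB dim_point[OF y(1)] by simp
      have eZ: "e \<notin> Z" using Z(3) e(2) TB by blast
      have isoZ: "isotropic Z" using isotropic_subset[OF point_isotropic[OF y(1)] Z(1,2)] .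
      have "e \<in> perp Z" using point_orthogonal[OF y(1) y(3)] Z(2) unfolding perp_def by blast
      moreover have "vec.span (insert e Z) = y"
        using span_insert_eq_point[OF y(1) isoZ dimZ Z(2) y(3) eZ] .
      moreover have "T \<subseteq> Z" using Z(3) by blast
      ultimately show "Z \<in> {Z \<in> ZZ. vec.span (insert e Z) = y}"
        using isoZ dimZ eZ unfolding ZZ_def by simp
    qed
    then show "[card {Z \<in> ZZ. vec.span (insert e Z) = y} = 1] (mod p)"
      using card_relative_complements_cong[OF suby _ subT _ B] TB by simp
  qed (simp_all add: finite)
  have "{y \<in> points. T \<subseteq> y} = Y1 \<union> Y0" unfolding Y1_def Y0_def by blast
  moreover have "card (Y1 \<union> Y0) = card Y1 + card Y0"
    by (rule card_Un_disjoint) (auto simp: Y1_def Y0_def finite)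
  ultimately have "card {y \<in> points. T \<subseteq> y} = card Y1 + r ^ 3 * card ZZ" using cardY0 by simp
  moreover have "[card Y1 + r ^ 3 * card ZZ = card Y1 + r ^ 3 * (1 * card Y1)] (mod p)"
    using cardZZ by (intro cong_add cong_mult cong_refl)
  moreover have "card Y1 + r ^ 3 * (1 * card Y1) = (r ^ 3 + 1) * card Y1" by simp
  ultimately show ?thesis using cube_cong by (metis cong_dvd_iff dvd_mult2)
qed

text \<open>A point contains \<open>U\<close> and \<open>W\<close> exactly if it contains their
  span, which is isotropic only if they are orthogonal. A span of dimension \<open>d\<close> is
  itself the only such point; over a smaller one the number of points vanishes modulo
  \<open>p\<close>.\<close>

lemma card_points_above_two_cong:
  assumes x: "x \<in> points" and z: "z \<in> points"
    and U: "vec.subspace U" "U \<subseteq> x" and W: "vec.subspace W" "W \<subseteq> z"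
  shows "[card {y \<in> points. U \<subseteq> y \<and> W \<subseteq> y}
    = (if W \<subseteq> perp U \<and> vec.dim (U \<inter> W) + d = vec.dim U + vec.dim W then 1 else 0)] (mod p)"
proof (cases "W \<subseteq> perp U")
  case False
  have "{y \<in> points. U \<subseteq> y \<and> W \<subseteq> y} = {}"
    using False point_orthogonal unfolding perp_def by blast
  then show ?thesis using False by (simp only:) simp
next
  case True
  let ?T = "vec.span (U \<union> W)"
  have UW: "H u w = 0" "H w u = 0" if "u \<in> U" "w \<in> W" for u w
    using that True orthogonal_sym[of u w] unfolding perp_def by auto
  have "H u v = 0" if "u \<in> U \<union> W" "v \<in> U \<union> W" for u v
    using that UW subsetD[OF U(2)] subsetD[OF W(2)] point_orthogonal[OF x, of u v]
      point_orthogonal[OF z, of u v] by blast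
  then have iso: "isotropic ?T" by (rule isotropic_span)
  have above: "{y \<in> points. U \<subseteq> y \<and> W \<subseteq> y} = {y \<in> points. ?T \<subseteq> y}"
  proof (intro equalityI subsetI)
    fix y assume "y \<in> {y \<in> points. U \<subseteq> y \<and> W \<subseteq> y}"
    then show "y \<in> {y \<in> points. ?T \<subseteq> y}"
      using vec.span_minimal[of "U \<union> W" y] point_subspace by auto
  next
    fix y assume "y \<in> {y \<in> points. ?T \<subseteq> y}"
    then show "y \<in> {y \<in> points. U \<subseteq> y \<and> W \<subseteq> y}"
      using vec.span_superset[of "U \<union> W"] by blast
  qed
  have dim: "vec.dim ?T + vec.dim (U \<inter> W) = vec.dim U + vec.dim W"
    using dim_span_Un_Int U W by blast
  show ?thesis
  proof (cases "vec.dim ?T = d")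
    case d: True
    have "?T \<in> points" using pointI iso d by blast
    then have "{y \<in> points. ?T \<subseteq> y} = {?T}" using point_eqI by blast
    then show ?thesis using above True d dim by simp
  next
    case False
    then have "vec.dim ?T < d" using dim_isotropic_le[OF iso] by simp
    then have "p dvd card {y \<in> points. ?T \<subseteq> y}" using dvd_card_points_above[OF iso] by blast
    then show ?thesis using above dim False by (simp add: cong_0_iff)
  qed
qed

text \<open>The relation between \<open>dim U\<close>, \<open>b\<close> and \<open>t\<close> says
  that the span of \<open>U\<close> and \<open>W\<close> has dimension \<open>d\<close>. The
  \<open>W\<close> meeting \<open>U\<close> in a given \<open>T\<close> are then the complements of
  \<open>U \<inter> z\<close> in \<open>z \<inter> perp U\<close> over \<open>T\<close>, one modulo
  \<open>p\<close>.\<close>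

lemma card_complementary_cong:
  assumes x: "x \<in> points" and z: "z \<in> points"
    and U: "vec.subspace U" "U \<subseteq> x" and ab: "vec.dim U + b = d + t"
  shows "[card {W. vec.subspace W \<and> W \<subseteq> z \<and> vec.dim W = b \<and> W \<subseteq> perp U \<and> vec.dim (U \<inter> W) = t}
    = card {T. vec.subspace T \<and> T \<subseteq> U \<inter> z \<and> vec.dim T = t}] (mod p)"
proof -
  let ?A = "{W. vec.subspace W \<and> W \<subseteq> z \<and> vec.dim W = b \<and> W \<subseteq> perp U \<and> vec.dim (U \<inter> W) = t}"
  let ?B = "{T. vec.subspace T \<and> T \<subseteq> U \<inter> z \<and> vec.dim T = t}"
  have subz: "vec.subspace z" using point_subspace[OF z] .
  let ?E = "z \<inter> perp U" and ?F = "U \<inter> z"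
  have E: "vec.subspace ?E" and F: "vec.subspace ?F"
    using subz subspace_perp U vec.subspace_inter by auto
  have FE: "?F \<subseteq> ?E" using point_orthogonal[OF x] U(2) unfolding perp_def by blast
  \<comment> \<open>The vectors of \<open>U\<close> are isotropic, so those orthogonal to
    \<open>z\<close> lie in \<open>z\<close> by maximality.\<close>
  have "U \<inter> perp z = ?F"
    using isotropic_vector_in_point[OF z] point_orthogonal[OF x] point_orthogonal[OF z] U(2)
    unfolding perp_def by blast
  then have dimE: "vec.dim ?E + vec.dim U = d + vec.dim ?F"
    using dim_Int_perp[OF U(1) subz] dim_point[OF z] by simp
  have "[card ?A = 1 * card ?B] (mod p)"
  proof (rule card_fibres_cong[where f = "\<lambda>W. U \<inter> W"])
    fix W assume "W \<in> ?A"
    then show "U \<inter> W \<in> ?B" using U(1) vec.subspace_inter by blast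
  next
    fix T assume T: "T \<in> ?B"
    have "{W \<in> ?A. U \<inter> W = T} = relative_complements ?E ?F T"
    proof (intro equalityI subsetI)
      fix W assume "W \<in> {W \<in> ?A. U \<inter> W = T}"
      then have W: "vec.subspace W" "W \<subseteq> z" "vec.dim W = b" "W \<subseteq> perp U" "U \<inter> W = T" by auto
      then have "W \<subseteq> ?E" "W \<inter> ?F = T" by auto
      then show "W \<in> relative_complements ?E ?F T"
        using relative_complements_iff_dim[OF E F FE W(1)] W(3) dimE ab T by auto
    next
      fix W assume WC: "W \<in> relative_complements ?E ?F T"
      then have W: "vec.subspace W" "W \<subseteq> ?E" "W \<inter> ?F = T"
        unfolding relative_complements_def by auto
      have "vec.dim W + vec.dim ?F = vec.dim ?E + vec.dim T"
        using WC relative_complements_iff_dim[OF E F FE W] by blast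
      then have "vec.dim W = b" using dimE ab T by auto
      moreover have "U \<inter> W = T" using W by blast
      ultimately show "W \<in> {W \<in> ?A. U \<inter> W = T}" using W T by auto
    qed
    then show "[card {W \<in> ?A. U \<inter> W = T} = 1] (mod p)"
      using card_relative_complements_cong[OF E F _ _ FE, of T] T by auto
  qed (simp_all add: finite)
  then show ?thesis by simp
qed

text \<open>With \<open>a = d - i\<close> and \<open>b = d - j\<close> this is the multiplication
  rule of divided powers. Modulo \<open>p\<close> the binomials count subspaces \<open>U\<close> of
  \<open>x \<inter> y\<close> and \<open>W\<close> of \<open>y \<inter> z\<close>; the sum over
  \<open>y\<close> is traded for one over pairs \<open>(U, W)\<close>, and \<open>W\<close> for its
  intersection \<open>T\<close> with \<open>U\<close>.\<close>

lemma intersection_product_cong: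
  assumes x: "x \<in> points" and z: "z \<in> points" and a: "a \<le> d" and b: "b \<le> d"
  shows "[(\<Sum>y\<in>points. (vec.dim (x \<inter> y) choose a) * (vec.dim (y \<inter> z) choose b))
    = (if d \<le> a + b then ((2 * d - (a + b)) choose (d - b)) * (vec.dim (x \<inter> z) choose (a + b - d))
       else 0)] (mod p)"
proof -
  define SU where "SU = {U. vec.subspace U \<and> U \<subseteq> x \<and> vec.dim U = a}"
  define SW where "SW = {W. vec.subspace W \<and> W \<subseteq> z \<and> vec.dim W = b}"
  define Q where "Q U W \<longleftrightarrow> W \<subseteq> perp U \<and> vec.dim (U \<inter> W) + d = a + b" for U W
  note subx = point_subspace[OF x] and subz = point_subspace[OF z]
  have fin: "finite S" for S :: "('k ^ 'n) set set" by (rule finite)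
  have "[(\<Sum>y\<in>points. (vec.dim (x \<inter> y) choose a) * (vec.dim (y \<inter> z) choose b))
      = (\<Sum>y\<in>points. card {U \<in> SU. U \<subseteq> y} * card {W \<in> SW. W \<subseteq> y})] (mod p)"
  proof (intro cong_sum cong_mult)
    fix y assume y: "y \<in> points"
    have "{U. vec.subspace U \<and> U \<subseteq> x \<inter> y \<and> vec.dim U = a} = {U \<in> SU. U \<subseteq> y}"
      unfolding SU_def by blast
    then show "[vec.dim (x \<inter> y) choose a = card {U \<in> SU. U \<subseteq> y}] (mod p)"
      using card_subspaces_cong[OF vec.subspace_inter[OF subx point_subspace[OF y]], of a]
      by (simp add: cong_sym)
    have "{U. vec.subspace U \<and> U \<subseteq> y \<inter> z \<and> vec.dim U = b} = {W \<in> SW. W \<subseteq> y}"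
      unfolding SW_def by blast
    then show "[vec.dim (y \<inter> z) choose b = card {W \<in> SW. W \<subseteq> y}] (mod p)"
      using card_subspaces_cong[OF vec.subspace_inter[OF point_subspace[OF y] subz], of b]
      by (simp add: cong_sym)
  qed
  also have "(\<Sum>y\<in>points. card {U \<in> SU. U \<subseteq> y} * card {W \<in> SW. W \<subseteq> y})
      = (\<Sum>y\<in>points. card {UW \<in> SU \<times> SW. fst UW \<subseteq> y \<and> snd UW \<subseteq> y})"
  proof (intro sum.cong refl)
    fix y
    have "{UW \<in> SU \<times> SW. fst UW \<subseteq> y \<and> snd UW \<subseteq> y} = {U \<in> SU. U \<subseteq> y} \<times> {W \<in> SW. W \<subseteq> y}"
      by auto
    then show "card {U \<in> SU. U \<subseteq> y} * card {W \<in> SW. W \<subseteq> y}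
        = card {UW \<in> SU \<times> SW. fst UW \<subseteq> y \<and> snd UW \<subseteq> y}"
      by (simp add: card_cartesian_product)
  qed
  also have "\<dots> = (\<Sum>UW\<in>SU \<times> SW. card {y \<in> points. fst UW \<subseteq> y \<and> snd UW \<subseteq> y})"
    using fin by (intro sum_card_swap) auto
  also have "[\<dots> = (\<Sum>UW\<in>SU \<times> SW. if Q (fst UW) (snd UW) then 1 else 0)] (mod p)"
  proof (rule cong_sum)
    fix UW assume "UW \<in> SU \<times> SW"
    then have UW: "vec.subspace (fst UW)" "fst UW \<subseteq> x" "vec.dim (fst UW) = a"
      "vec.subspace (snd UW)" "snd UW \<subseteq> z" "vec.dim (snd UW) = b"
      unfolding SU_def SW_def by auto
    show "[card {y \<in> points. fst UW \<subseteq> y \<and> snd UW \<subseteq> y} = (if Q (fst UW) (snd UW) then 1 else 0)] (mod p)"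
      using card_points_above_two_cong[OF x z UW(1,2,4,5)] unfolding Q_def UW(3,6) .
  qed
  also have "(\<Sum>UW\<in>SU \<times> SW. if Q (fst UW) (snd UW) then 1 else 0) = (\<Sum>U\<in>SU. card {W \<in> SW. Q U W})"
  proof -
    have "(\<Sum>UW\<in>SU \<times> SW. if Q (fst UW) (snd UW) then 1 else 0)
        = (\<Sum>U\<in>SU. \<Sum>W\<in>SW. if Q U W then 1 else (0::nat))"
      unfolding sum.cartesian_product by (simp add: case_prod_beta')
    then show ?thesis using fin[of SW] by (simp add: sum.If_cases Int_def)
  qed
  finally have main: "[(\<Sum>y\<in>points. (vec.dim (x \<inter> y) choose a) * (vec.dim (y \<inter> z) choose b))
      = (\<Sum>U\<in>SU. card {W \<in> SW. Q U W})] (mod p)" .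
  show ?thesis
  proof (cases "d \<le> a + b")
    case False
    then have "\<not> Q U W" for U W unfolding Q_def by simp
    then have "(\<Sum>U\<in>SU. card {W \<in> SW. Q U W}) = 0" by simp
    then show ?thesis using main False by (simp only: if_False)
  next
    case True
    define t where "t = a + b - d"
    define ST where "ST = {T. vec.subspace T \<and> T \<subseteq> x \<inter> z \<and> vec.dim T = t}"
    have "[(\<Sum>U\<in>SU. card {W \<in> SW. Q U W}) = (\<Sum>U\<in>SU. card {T \<in> ST. T \<subseteq> U})] (mod p)"
    proof (rule cong_sum)
      fix U assume "U \<in> SU"
      then have U: "vec.subspace U" "U \<subseteq> x" "vec.dim U = a" unfolding SU_def by auto
      have "{W \<in> SW. Q U W}
          = {W. vec.subspace W \<and> W \<subseteq> z \<and> vec.dim W = b \<and> W \<subseteq> perp U \<and> vec.dim (U \<inter> W) = t}"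
        using True unfolding SW_def Q_def t_def by auto
      moreover have "{T \<in> ST. T \<subseteq> U} = {T. vec.subspace T \<and> T \<subseteq> U \<inter> z \<and> vec.dim T = t}"
        using U(2) unfolding ST_def by blast
      moreover have "vec.dim U + b = d + t" using U(3) True unfolding t_def by simp
      ultimately show "[card {W \<in> SW. Q U W} = card {T \<in> ST. T \<subseteq> U}] (mod p)"
        using card_complementary_cong[OF x z U(1,2)] by simp
    qed
    also have "(\<Sum>U\<in>SU. card {T \<in> ST. T \<subseteq> U}) = (\<Sum>T\<in>ST. card {U \<in> SU. T \<subseteq> U})"
      using fin by (intro sum_card_swap)
    also have "[\<dots> = (\<Sum>T\<in>ST. (2 * d - (a + b)) choose (d - b))] (mod p)"
    proof (rule cong_sum)
      fix T assume "T \<in> ST"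
      then have T: "vec.subspace T" "T \<subseteq> x" "vec.dim T = t" unfolding ST_def by auto
      have "{U \<in> SU. T \<subseteq> U} = {U. vec.subspace U \<and> T \<subseteq> U \<and> U \<subseteq> x \<and> vec.dim U = a}"
        unfolding SU_def by blast
      \<comment> \<open>These identities give the binomial coefficient its shape: \<open>U\<close>
        ranges over subspaces between \<open>T\<close> and \<open>x\<close>, an interval of length
        \<open>d - t\<close>, at height \<open>a - t\<close>.\<close>
      moreover have "t \<le> a" "d - t = 2 * d - (a + b)" "a - t = d - b"
        using True a b unfolding t_def by auto
      ultimately show "[card {U \<in> SU. T \<subseteq> U} = (2 * d - (a + b)) choose (d - b)] (mod p)"
        using card_subspaces_between_cong[OF subx T(1,2), of a] T(3) dim_point[OF x] by simp
    qed
    also have "(\<Sum>T\<in>ST. (2 * d - (a + b)) choose (d - b))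
        = ((2 * d - (a + b)) choose (d - b)) * card ST" by simp
    also have "[\<dots> = ((2 * d - (a + b)) choose (d - b)) * (vec.dim (x \<inter> z) choose t)] (mod p)"
      unfolding ST_def using card_subspaces_cong[OF vec.subspace_inter[OF subx subz], of t]
      by (intro cong_mult cong_refl)
    finally show ?thesis using cong_trans[OF main] True unfolding t_def by simp
  qed
qed

end

end

section \<open>Multinomial coefficients modulo a prime\<close>

lemma fact_power_dvd_fact: "fact n ^ a dvd (fact (a * n) :: nat)"
proof (induction a)
  case (Suc a)
  have "fact n ^ Suc a dvd (fact n * fact (a * n) :: nat)" using Suc by simp
  also have "\<dots> dvd fact (n + a * n)" by (rule fact_fact_dvd_fact)
  finally show ?case by simp
qed auto

lemma prod_fact_dvd_fact_sum: "(\<Prod>k\<in>S. fact (f k)) dvd (fact (\<Sum>k\<in>S. f k) :: nat)"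
proof (induction S rule: infinite_finite_induct)
  case (insert k S)
  have "fact (f k) * (\<Prod>k\<in>S. fact (f k)) dvd (fact (f k) * fact (\<Sum>k\<in>S. f k) :: nat)"
    using insert by simp
  also have "\<dots> dvd fact (f k + (\<Sum>k\<in>S. f k))" by (rule fact_fact_dvd_fact)
  finally show ?case using insert by simp
qed auto

text \<open>An instance of the theorem of Lucas: adding \<open>b\<close> to a multiple of
  \<open>p ^ k\<close> produces no carry. In the induction, \<open>Suc b\<close> and
  \<open>a * p ^ k + Suc b\<close> contain the same power of \<open>p\<close>, which cancels from
  the absorption identity.\<close>

lemma prime_not_dvd_choose_digit:
  assumes p: "Factorial_Ring.prime p" and "b < p ^ k"
  shows "\<not> p dvd (a * p ^ k + b choose b)"
  using assms(2)
proof (induction b)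
  case 0
  then show ?case using p by auto
next
  case (Suc b)
  obtain c where c: "Suc b = p ^ multiplicity p (Suc b) * c" "\<not> p dvd c"
    using multiplicity_decompose'[of "Suc b" p] p by (metis nat.simps(3) not_prime_unit)
  define v where "v = multiplicity p (Suc b)"
  have cv: "Suc b = p ^ v * c" unfolding v_def by (rule c(1))
  have "c > 0" using cv by (cases c) auto
  then have "p ^ v < p ^ k" using Suc.prems cv by (metis le_less_trans mult.right_neutral mult_le_mono2 Suc_leI One_nat_def)
  then have "v < k" using p prime_gt_1_nat power_less_imp_less_exp by blast
  then have k: "p ^ k = p ^ v * p ^ (k - v)" by (simp flip: power_add)
  have Suc_n: "Suc (a * p ^ k + b) = p ^ v * (a * p ^ (k - v) + c)"
  proof -
    have "Suc (a * p ^ k + b) = a * p ^ k + Suc b" by simp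
    also have "\<dots> = p ^ v * (a * p ^ (k - v) + c)"
      unfolding cv k by (simp only: distrib_left mult_ac)
    finally show ?thesis .
  qed
  have "Suc (a * p ^ k + b) * (a * p ^ k + b choose b)
      = (a * p ^ k + Suc b choose Suc b) * Suc b"
    unfolding add_Suc_right by (rule Suc_times_binomial_eq)
  then have "p ^ v * ((a * p ^ (k - v) + c) * (a * p ^ k + b choose b))
      = p ^ v * ((a * p ^ k + Suc b choose Suc b) * c)"
    by (metis Suc_n cv mult.assoc mult.left_commute)
  then have eq: "(a * p ^ (k - v) + c) * (a * p ^ k + b choose b)
      = (a * p ^ k + Suc b choose Suc b) * c"
    using p by (simp add: prime_gt_0_nat)
  show ?case
  proof
    assume "p dvd (a * p ^ k + Suc b choose Suc b)"
    then have "p dvd (a * p ^ (k - v) + c) * (a * p ^ k + b choose b)" unfolding eq by simp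
    then have "p dvd a * p ^ (k - v) + c"
      using Suc p prime_dvd_mult_iff[OF p] by auto
    moreover have "p dvd a * p ^ (k - v)" using \<open>v < k\<close> by simp
    ultimately show False using c(2) dvd_add_right_iff by blast
  qed
qed

definition digit_value :: "nat \<Rightarrow> nat \<Rightarrow> (nat \<Rightarrow>\<^sub>0 nat) \<Rightarrow> nat" where
  "digit_value p l m = (\<Sum>k=1..l. Poly_Mapping.lookup m k * p ^ (k - 1))"

text \<open>The denominator that arises when \<open>e\<close> at \<open>n\<close> is read as
  \<open>x ^ n / fact n\<close> and the factors of a monomial are multiplied.\<close>

definition digit_fact :: "nat \<Rightarrow> nat \<Rightarrow> (nat \<Rightarrow>\<^sub>0 nat) \<Rightarrow> nat" where
  "digit_fact p l m = (\<Prod>k=1..l. fact (p ^ (k - 1)) ^ Poly_Mapping.lookup m k)"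

text \<open>
  In the divided power algebra with basis \<open>e\<^sub>0, e\<^sub>1, \<dots>\<close>, the product over \<open>k\<close> of the
  \<open>m\<^sub>k\<close>-th powers of \<open>e\<close> at \<open>p ^ (k - 1)\<close> is this multiple of \<open>e\<close> at \<open>digit_value p l m\<close>.
\<close>

definition digit_weight :: "nat \<Rightarrow> nat \<Rightarrow> (nat \<Rightarrow>\<^sub>0 nat) \<Rightarrow> nat" where
  "digit_weight p l m = fact (digit_value p l m) div digit_fact p l m"

lemma digit_value_add: "digit_value p l (m + m') = digit_value p l m + digit_value p l m'"
  unfolding digit_value_def by (simp add: lookup_add distrib_right sum.distrib)

lemma digit_fact_add: "digit_fact p l (m + m') = digit_fact p l m * digit_fact p l m'"
  unfolding digit_fact_def by (simp add: lookup_add power_add prod.distrib)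

lemma digit_value_0 [simp]: "digit_value p l 0 = 0"
  unfolding digit_value_def by simp

lemma digit_weight_0 [simp]: "digit_weight p l 0 = 1"
  unfolding digit_weight_def digit_fact_def by simp

lemma digit_fact_pos: "digit_fact p l m > 0"
  unfolding digit_fact_def by (simp add: prod_pos)

text \<open>The division in \<open>digit_weight\<close> is exact, its value being a multinomial
  coefficient.\<close>

lemma digit_weight_mult: "digit_weight p l m * digit_fact p l m = fact (digit_value p l m)"
proof -
  have "digit_fact p l m dvd (\<Prod>k=1..l. fact (Poly_Mapping.lookup m k * p ^ (k - 1)))"
    unfolding digit_fact_def by (intro prod_dvd_prod fact_power_dvd_fact)
  also have "\<dots> dvd fact (digit_value p l m)"
    unfolding digit_value_def by (rule prod_fact_dvd_fact_sum)
  finally show ?thesis unfolding digit_weight_def by simp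
qed

lemma fact_add_eq_choose: "fact (a + b) = (fact a * fact b * (a + b choose a) :: nat)"
  using binomial_fact_lemma[of a "a + b"] by simp

text \<open>The binomial is the structure constant of the divided power basis, so this is what makes
  the evaluation of monomials multiplicative.\<close>

lemma digit_weight_add:
  "digit_weight p l (m + m') = digit_weight p l m * digit_weight p l m'
     * (digit_value p l m + digit_value p l m' choose digit_value p l m)"
proof -
  have "digit_weight p l (m + m') * (digit_fact p l m * digit_fact p l m')
      = (digit_weight p l m * digit_fact p l m) * (digit_weight p l m' * digit_fact p l m')
         * (digit_value p l m + digit_value p l m' choose digit_value p l m)"
    using digit_weight_mult[of p l "m + m'"]
    unfolding digit_fact_add digit_value_add fact_add_eq_choose digit_weight_mult .
  then have "digit_weight p l (m + m') * (digit_fact p l m * digit_fact p l m')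
      = (digit_weight p l m * digit_weight p l m'
     * (digit_value p l m + digit_value p l m' choose digit_value p l m))
     * (digit_fact p l m * digit_fact p l m')" by (simp only: mult_ac)
  then show ?thesis using digit_fact_pos[of p l m] digit_fact_pos[of p l m']
    by (subst (asm) mult_cancel2) auto
qed

lemma digit_value_single:
  assumes "k \<in> {1..l}"
  shows "digit_value p l (Poly_Mapping.single k a) = a * p ^ (k - 1)"
proof -
  have "digit_value p l (Poly_Mapping.single k a) = (\<Sum>j=1..l. if j = k then a * p ^ (j - 1) else 0)"
    unfolding digit_value_def by (intro sum.cong) (auto simp: lookup_single)
  then show ?thesis using assms by simp
qed

text \<open>Splitting off \<open>p\<close> copies of variable \<open>k\<close> produces the factor
  \<open>p * P choose P\<close> with \<open>P = p ^ (k - 1)\<close>, which by absorption is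
  \<open>p\<close> times another binomial.\<close>

lemma prime_dvd_digit_weight:
  assumes p: "Factorial_Ring.prime p" and k: "k \<in> {1..l}" and pk: "p \<le> Poly_Mapping.lookup m k"
  shows "p dvd digit_weight p l m"
proof -
  let ?s = "\<lambda>a. Poly_Mapping.single k a :: nat \<Rightarrow>\<^sub>0 nat"
  let ?P = "p ^ (k - 1)"
  have "m = ?s p + (m - ?s p)"
    by (rule poly_mapping_eqI) (use pk in \<open>auto simp: lookup_add lookup_minus lookup_single when_def\<close>)
  moreover have "p dvd digit_weight p l (?s p)"
  proof -
    have p0: "p > 0" using p prime_gt_0_nat by blast
    have "?s p = ?s 1 + ?s (p - 1)" using p0 by (simp flip: single_add)
    moreover have "p dvd (?P + (p - 1) * ?P choose ?P)"
    proof -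
      have sum: "?P + (p - 1) * ?P = p * ?P" using p0 by (cases p) auto
      have "?P > 0" using p0 by simp
      then have "?P * (p * ?P choose ?P) = p * ?P * (p * ?P - 1 choose (?P - 1))"
        by (rule times_binomial_minus1_eq)
      then have "?P * (p * ?P choose ?P) = ?P * (p * (p * ?P - 1 choose (?P - 1)))"
        by (simp only: mult_ac)
      then have "(p * ?P choose ?P) = p * (p * ?P - 1 choose (?P - 1))"
        using \<open>?P > 0\<close> by (subst (asm) mult_cancel1) auto
      then show ?thesis unfolding sum by simp
    qed
    ultimately show ?thesis
      using digit_weight_add[of p l "?s 1" "?s (p - 1)"] digit_value_single[OF k, of p 1]
        digit_value_single[OF k, of p "p - 1"] by simp
  qed
  ultimately show ?thesis using digit_weight_add[of p l "?s p" "m - ?s p"] by simp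
qed

lemma digit_value_Suc:
  "digit_value p (Suc l) m = digit_value p l m + Poly_Mapping.lookup m (Suc l) * p ^ l"
  unfolding digit_value_def by simp

lemma digit_value_less:
  assumes "\<And>k. k \<in> {1..l} \<Longrightarrow> Poly_Mapping.lookup m k < p"
  shows "digit_value p l m < p ^ l"
  using assms
proof (induction l)
  case (Suc l)
  have "Poly_Mapping.lookup m (Suc l) < p" using Suc.prems by simp
  then have "Suc (Poly_Mapping.lookup m (Suc l)) * p ^ l \<le> p * p ^ l"
    by (intro mult_le_mono1) simp
  then show ?case using Suc unfolding digit_value_Suc by fastforce
qed (simp add: digit_value_def)

text \<open>A new leading digit \<open>a\<close> multiplies the weight by
  \<open>fact (a * p ^ l) / fact (p ^ l) ^ a\<close> and by a binomial without carries, and neither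
  is divisible by \<open>p\<close> while \<open>a < p\<close>.\<close>

lemma prime_not_dvd_digit_weight:
  assumes p: "Factorial_Ring.prime p" and "\<And>k. k \<in> {1..l} \<Longrightarrow> Poly_Mapping.lookup m k < p"
  shows "\<not> p dvd digit_weight p l m"
  using assms(2)
proof (induction l)
  case 0
  then show ?case using p prime_gt_1_nat[OF p]
    unfolding digit_weight_def digit_value_def digit_fact_def by simp
next
  case (Suc l)
  let ?P = "p ^ l" and ?a = "Poly_Mapping.lookup m (Suc l)" and ?v = "digit_value p l m"
  have P0: "?P > 0" using p prime_gt_0_nat by simp
  \<comment> \<open>The quotient \<open>g\<close> is built from factors
    \<open>Suc a * ?P choose ?P\<close>, each of them \<open>Suc a\<close> times a binomial without
    carries.\<close>
  have "\<exists>g::nat. fact (a * ?P) = g * fact ?P ^ a \<and> \<not> p dvd g" if "a < p" for a :: nat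
    using that
  proof (induction a)
    case 0
    then show ?case using prime_gt_1_nat[OF p] by simp
  next
    case (Suc a)
    then obtain g where g: "fact (a * ?P) = g * fact ?P ^ a" "\<not> p dvd g" by auto
    have "?P * (Suc a * ?P choose ?P) = Suc a * ?P * (Suc a * ?P - 1 choose (?P - 1))"
      using P0 by (rule times_binomial_minus1_eq)
    then have "?P * (Suc a * ?P choose ?P) = ?P * (Suc a * (Suc a * ?P - 1 choose (?P - 1)))"
      by (simp only: mult_ac)
    then have ch: "(Suc a * ?P choose ?P) = Suc a * (a * ?P + (?P - 1) choose (?P - 1))"
      using P0 by (subst (asm) mult_cancel1) (auto simp: add.commute)
    have "\<not> p dvd (a * ?P + (?P - 1) choose (?P - 1))"
      using P0 by (intro prime_not_dvd_choose_digit[OF p]) simp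
    moreover have "\<not> p dvd Suc a" using Suc.prems by (auto dest: dvd_imp_le)
    ultimately have "\<not> p dvd (Suc a * ?P choose ?P)"
      unfolding ch using prime_dvd_mult_iff[OF p] by blast
    moreover have "fact (Suc a * ?P) = g * (Suc a * ?P choose ?P) * fact ?P ^ Suc a"
      using fact_add_eq_choose[of ?P "a * ?P"] g(1) by (simp add: mult_ac)
    ultimately show ?case using g(2) prime_dvd_mult_iff[OF p] by blast
  qed
  then obtain g :: nat where g: "fact (?a * ?P) = g * fact ?P ^ ?a" "\<not> p dvd g"
    using Suc.prems[of "Suc l"] by auto
  have "?v < ?P" using Suc.prems by (intro digit_value_less) auto
  then have ch: "\<not> p dvd (?a * ?P + ?v choose ?v)" by (rule prime_not_dvd_choose_digit[OF p])
  have "digit_weight p (Suc l) m * (digit_fact p l m * fact ?P ^ ?a) = fact (?v + ?a * ?P)"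
    using digit_weight_mult[of p "Suc l" m] unfolding digit_value_Suc
    by (simp add: digit_fact_def)
  also have "\<dots> = (digit_weight p l m * digit_fact p l m) * (g * fact ?P ^ ?a)
      * (?v + ?a * ?P choose ?v)"
    unfolding fact_add_eq_choose g(1) digit_weight_mult ..
  also have "\<dots> = (digit_weight p l m * g * (?a * ?P + ?v choose ?v)) * (digit_fact p l m * fact ?P ^ ?a)"
    by (simp add: add.commute mult_ac)
  finally have "digit_weight p (Suc l) m = digit_weight p l m * g * (?a * ?P + ?v choose ?v)"
    using digit_fact_pos[of p l m] by (subst (asm) mult_cancel2) auto
  moreover have "\<not> p dvd digit_weight p l m" using Suc by simp
  ultimately show ?case using g(2) ch prime_dvd_mult_iff[OF p] by metis
qed

lemma digit_value_inj:
  assumes "\<And>k. k \<in> {1..l} \<Longrightarrow> Poly_Mapping.lookup m k < p"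
    and "\<And>k. k \<in> {1..l} \<Longrightarrow> Poly_Mapping.lookup m' k < p"
    and "digit_value p l m = digit_value p l m'" "k \<in> {1..l}"
  shows "Poly_Mapping.lookup m k = Poly_Mapping.lookup m' k"
  using assms
proof (induction l)
  case (Suc l)
  have less: "digit_value p l m < p ^ l" "digit_value p l m' < p ^ l"
    using Suc.prems by (intro digit_value_less; simp)+
  have eq: "digit_value p l m + Poly_Mapping.lookup m (Suc l) * p ^ l
      = digit_value p l m' + Poly_Mapping.lookup m' (Suc l) * p ^ l"
    using Suc.prems(3) unfolding digit_value_Suc .
  have "(digit_value p l m + Poly_Mapping.lookup m (Suc l) * p ^ l) mod p ^ l = digit_value p l m"
    "(digit_value p l m' + Poly_Mapping.lookup m' (Suc l) * p ^ l) mod p ^ l = digit_value p l m'"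
    using less by auto
  then have eq': "digit_value p l m = digit_value p l m'" using eq by metis
  then have "Poly_Mapping.lookup m (Suc l) = Poly_Mapping.lookup m' (Suc l)"
    using eq Suc.prems(1)[of "Suc l"] by auto
  then show ?case using Suc.IH[OF _ _ eq'] Suc.prems by (cases "k = Suc l") auto
qed auto

lemma digit_value_surj:
  assumes "p > 0" "n < p ^ l"
  shows "\<exists>m. Poly_Mapping.keys m \<subseteq> {1..l} \<and> (\<forall>k. Poly_Mapping.lookup m k < p) \<and> digit_value p l m = n"
  using assms(2)
proof (induction l arbitrary: n)
  case 0
  then show ?case using assms(1) by (intro exI[of _ 0]) auto
next
  case (Suc l)
  have "n mod p ^ l < p ^ l" using assms(1) by simp
  then obtain m where m: "Poly_Mapping.keys m \<subseteq> {1..l}" "\<And>k. Poly_Mapping.lookup m k < p"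
      "digit_value p l m = n mod p ^ l"
    using Suc.IH by blast
  define m' where "m' = m + Poly_Mapping.single (Suc l) (n div p ^ l)"
  have m_Suc: "Poly_Mapping.lookup m (Suc l) = 0"
    using m(1) by (metis Suc_n_not_le_n atLeastAtMost_iff in_keys_iff subsetD)
  have "n div p ^ l < p" using Suc.prems by (simp add: less_mult_imp_div_less mult.commute)
  then have "Poly_Mapping.lookup m' k < p" for k
    using m(2)[of k] m_Suc unfolding m'_def by (auto simp: lookup_add lookup_single when_def)
  moreover have "Poly_Mapping.keys m' \<subseteq> {1..Suc l}"
    using m(1) keys_add[of m "Poly_Mapping.single (Suc l) (n div p ^ l)"]
    unfolding m'_def by (fastforce split: if_splits)
  moreover have "digit_value p (Suc l) m' = n"
  proof -
    have "digit_value p l (Poly_Mapping.single (Suc l) (n div p ^ l)) = 0"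
      unfolding digit_value_def by (simp add: lookup_single when_def)
    then show ?thesis using m(3) m_Suc unfolding digit_value_Suc
      by (simp add: m'_def digit_value_add lookup_add lookup_single mod_div_mult_eq)
  qed
  ultimately show ?case by blast
qed

section \<open>Truncated divided power algebras\<close>

lemma poly_mapping_sum_single:
  "P = (\<Sum>m\<in>Poly_Mapping.keys P. Poly_Mapping.single m (Poly_Mapping.lookup P m))"
proof (rule poly_mapping_eqI)
  fix k
  have "Poly_Mapping.lookup (\<Sum>m\<in>Poly_Mapping.keys P. Poly_Mapping.single m (Poly_Mapping.lookup P m)) k
      = (\<Sum>m\<in>Poly_Mapping.keys P. if m = k then Poly_Mapping.lookup P m else 0)"
    unfolding lookup_sum by (intro sum.cong) (auto simp: lookup_single)
  then show "Poly_Mapping.lookup P k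
      = Poly_Mapping.lookup (\<Sum>m\<in>Poly_Mapping.keys P. Poly_Mapping.single m (Poly_Mapping.lookup P m)) k"
    by (simp add: in_keys_iff)
qed

lemma mpoly_alg_simps:
  "carrier (mpoly_alg l) = {P. \<forall>m \<in> Poly_Mapping.keys P. Poly_Mapping.keys m \<subseteq> {1..l}}"
  "mult (mpoly_alg l) = (*)" "one (mpoly_alg l) = 1" "zero (mpoly_alg l) = 0"
  "add (mpoly_alg l) = (+)" "module.smult (mpoly_alg l) = (\<lambda>c P. Poly_Mapping.single 0 c * P)"
  unfolding mpoly_alg_def by simp_all

lemma mpoly_closed_add:
  assumes "P \<in> carrier (mpoly_alg l)" "Q \<in> carrier (mpoly_alg l)"
  shows "P + Q \<in> carrier (mpoly_alg l)"
  using assms keys_add[of P Q] unfolding mpoly_alg_simps by blast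

lemma mpoly_closed_mult:
  assumes "P \<in> carrier (mpoly_alg l)" "Q \<in> carrier (mpoly_alg l)"
  shows "P * Q \<in> carrier (mpoly_alg l)"
proof -
  have "Poly_Mapping.keys m \<subseteq> {1..l}" if m: "m \<in> Poly_Mapping.keys (P * Q)" for m
  proof -
    obtain a b where "m = a + b" "a \<in> Poly_Mapping.keys P" "b \<in> Poly_Mapping.keys Q"
      using m keys_mult[of P Q] by blast
    then show ?thesis using assms keys_add[of a b] unfolding mpoly_alg_simps by blast
  qed
  then show ?thesis unfolding mpoly_alg_simps by blast
qed

lemma mpoly_closed_single:
  "Poly_Mapping.keys m \<subseteq> {1..l} \<Longrightarrow> Poly_Mapping.single m c \<in> carrier (mpoly_alg l)"
  unfolding mpoly_alg_simps by (auto split: if_splits)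

lemma mpoly_closed_uminus: "P \<in> carrier (mpoly_alg l) \<Longrightarrow> - P \<in> carrier (mpoly_alg l)"
  unfolding mpoly_alg_simps by (simp add: in_keys_iff)

lemma mpoly_cring: "cring (mpoly_alg l)"
proof (rule cringI)
  have zero: "0 \<in> carrier (mpoly_alg l)" unfolding mpoly_alg_simps by simp
  have one: "1 \<in> carrier (mpoly_alg l)" unfolding mpoly_alg_simps by auto
  show "abelian_group (mpoly_alg l)"
  proof (rule abelian_groupI)
    fix P assume P: "P \<in> carrier (mpoly_alg l)"
    then show "\<exists>y\<in>carrier (mpoly_alg l). y \<oplus>\<^bsub>mpoly_alg l\<^esub> P = \<zero>\<^bsub>mpoly_alg l\<^esub>"
      using mpoly_closed_uminus[OF P] by (intro bexI[of _ "- P"]) (auto simp: mpoly_alg_simps(2-6))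
  qed (use zero mpoly_closed_add in \<open>auto simp: mpoly_alg_simps(2-6) add_ac\<close>)
  show "comm_monoid (mpoly_alg l)"
    by (rule comm_monoidI) (use one mpoly_closed_mult in \<open>auto simp: mpoly_alg_simps(2-6) mult_ac\<close>)
qed (auto simp: mpoly_alg_simps(2-6) distrib_right)

lemma mvar_power: "mvar k ^ n = Poly_Mapping.single (Poly_Mapping.single k n) 1"
proof (induction n)
  case (Suc n)
  then show ?case unfolding power_Suc by (simp add: mvar_def mult_single flip: single_add)
qed auto

text \<open>
  Matrices \<open>e n\<close> that multiply like the divided powers of one nilpotent element, truncated
  at \<open>p ^ l\<close>.
\<close>

locale divided_power_matrices =
  fixes A :: "('f::field, 'x \<Rightarrow> 'x \<Rightarrow> 'f) module" and X :: "'x set"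
    and e :: "nat \<Rightarrow> 'x \<Rightarrow> 'x \<Rightarrow> 'f" and p l :: nat
  assumes ring_A: "ring A"
    and carrier_A: "carrier A = {(\<lambda>x y. \<Sum>n<p ^ l. c n * e n x y) | c. True}"
    and mult_A: "mult A = (\<lambda>M N x z. \<Sum>y\<in>X. M x y * N y z)"
    and one_A: "one A = e 0"
    and zero_A: "zero A = (\<lambda>x y. 0)"
    and add_A: "add A = (\<lambda>M N x y. M x y + N x y)"
    and smult_A: "module.smult A = (\<lambda>a M x y. a * M x y)"
    and prime_p: "Factorial_Ring.prime p"
    and char_f: "CHAR('f) = p"
    and e_product: "\<And>i j x z. (\<Sum>y\<in>X. e i x y * e j y z) = of_nat (i + j choose i) * e (i + j) x z"
    and e_beyond: "\<And>n x y. p ^ l \<le> n \<Longrightarrow> e n x y = 0"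
    and e_independent: "\<And>c n. (\<And>x y. (\<Sum>n<p ^ l. c n * e n x y) = 0) \<Longrightarrow> n < p ^ l \<Longrightarrow> c n = 0"
begin

text \<open>The image of a monomial when \<open>e\<close> at \<open>p ^ (k - 1)\<close> is
  substituted for variable \<open>k\<close>. The closed form replaces matrix powers by arithmetic of
  multinomial coefficients.\<close>

definition monomial_value :: "(nat \<Rightarrow>\<^sub>0 nat) \<Rightarrow> 'x \<Rightarrow> 'x \<Rightarrow> 'f" where
  "monomial_value m x y = of_nat (digit_weight p l m) * e (digit_value p l m) x y"

definition poly_value :: "((nat \<Rightarrow>\<^sub>0 nat) \<Rightarrow>\<^sub>0 'f) \<Rightarrow> 'x \<Rightarrow> 'x \<Rightarrow> 'f" where
  "poly_value P x y = (\<Sum>m\<in>Poly_Mapping.keys P. Poly_Mapping.lookup P m * monomial_value m x y)"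

text \<open>The reduced monomials in the variables \<open>1\<close> to \<open>l\<close> represent a
  basis of the truncated polynomial algebra; they are the ones whose weight is nonzero in the
  field.\<close>

definition reduced :: "(nat \<Rightarrow>\<^sub>0 nat) \<Rightarrow> bool" where
  "reduced m \<longleftrightarrow> (\<forall>k\<in>{1..l}. Poly_Mapping.lookup m k < p)"

lemma monomial_value_add:
  "(\<Sum>y\<in>X. monomial_value m x y * monomial_value m' y z) = monomial_value (m + m') x z"
proof -
  have "(\<Sum>y\<in>X. monomial_value m x y * monomial_value m' y z)
      = of_nat (digit_weight p l m) * of_nat (digit_weight p l m')
        * (\<Sum>y\<in>X. e (digit_value p l m) x y * e (digit_value p l m') y z)"
    unfolding monomial_value_def sum_distrib_left by (intro sum.cong) (auto simp: mult_ac)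
  also have "\<dots> = monomial_value (m + m') x z"
    unfolding e_product monomial_value_def digit_weight_add digit_value_add by (simp add: mult_ac)
  finally show ?thesis .
qed

lemma monomial_value_not_reduced:
  assumes "\<not> reduced m"
  shows "monomial_value m x y = 0"
proof -
  obtain k where "k \<in> {1..l}" "p \<le> Poly_Mapping.lookup m k"
    using assms unfolding reduced_def by (meson not_le)
  then have "p dvd digit_weight p l m" using prime_dvd_digit_weight prime_p by blast
  then have "of_nat (digit_weight p l m) = (0::'f)"
    using char_f by (simp add: of_nat_eq_0_iff_char_dvd)
  then show ?thesis unfolding monomial_value_def by simp
qed

lemma digit_weight_reduced:
  assumes "reduced m"
  shows "of_nat (digit_weight p l m) \<noteq> (0::'f)"
  using prime_not_dvd_digit_weight[OF prime_p, of l m] assms char_f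
  by (simp add: reduced_def of_nat_eq_0_iff_char_dvd)

lemma poly_value_superset:
  assumes "finite S" "Poly_Mapping.keys P \<subseteq> S"
  shows "poly_value P x y = (\<Sum>m\<in>S. Poly_Mapping.lookup P m * monomial_value m x y)"
  unfolding poly_value_def
  using assms by (intro sum.mono_neutral_left) (auto simp: in_keys_iff)

lemma poly_value_0 [simp]: "poly_value 0 x y = 0"
  unfolding poly_value_def by simp

lemma poly_value_single: "poly_value (Poly_Mapping.single m c) x y = c * monomial_value m x y"
  by (subst poly_value_superset[of "{m}"]) auto

lemma poly_value_add: "poly_value (P + Q) x y = poly_value P x y + poly_value Q x y"
proof -
  let ?S = "Poly_Mapping.keys P \<union> Poly_Mapping.keys Q"
  have "Poly_Mapping.keys (P + Q) \<subseteq> ?S" by (rule keys_add)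
  then show ?thesis
    using poly_value_superset[of ?S P] poly_value_superset[of ?S Q] poly_value_superset[of ?S "P + Q"]
    by (simp add: lookup_add distrib_right sum.distrib)
qed

lemma poly_value_sum: "poly_value (sum f I) x y = (\<Sum>i\<in>I. poly_value (f i) x y)"
  by (induction I rule: infinite_finite_induct) (auto simp: poly_value_add)

lemma poly_value_mult:
  "poly_value (P * Q) x z = (\<Sum>y\<in>X. poly_value P x y * poly_value Q y z)"
proof -
  let ?p = "Poly_Mapping.lookup P" and ?q = "Poly_Mapping.lookup Q"
  have "P * Q = (\<Sum>m\<in>Poly_Mapping.keys P. \<Sum>m'\<in>Poly_Mapping.keys Q.
      Poly_Mapping.single (m + m') (?p m * ?q m'))"
    by (subst poly_mapping_sum_single[of P], subst poly_mapping_sum_single[of Q])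
      (simp add: sum_product mult_single)
  then have "poly_value (P * Q) x z = (\<Sum>m\<in>Poly_Mapping.keys P. \<Sum>m'\<in>Poly_Mapping.keys Q.
      ?p m * ?q m' * (\<Sum>y\<in>X. monomial_value m x y * monomial_value m' y z))"
    by (simp add: poly_value_sum poly_value_single monomial_value_add)
  also have "\<dots> = (\<Sum>m\<in>Poly_Mapping.keys P. \<Sum>m'\<in>Poly_Mapping.keys Q.
      \<Sum>y\<in>X. (?p m * monomial_value m x y) * (?q m' * monomial_value m' y z))"
    unfolding sum_distrib_left by (intro sum.cong refl) (simp only: mult_ac)
  also have "\<dots> = (\<Sum>m\<in>Poly_Mapping.keys P. \<Sum>y\<in>X. \<Sum>m'\<in>Poly_Mapping.keys Q.
      (?p m * monomial_value m x y) * (?q m' * monomial_value m' y z))"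
    by (intro sum.cong refl sum.swap)
  also have "\<dots> = (\<Sum>y\<in>X. \<Sum>m\<in>Poly_Mapping.keys P. \<Sum>m'\<in>Poly_Mapping.keys Q.
      (?p m * monomial_value m x y) * (?q m' * monomial_value m' y z))"
    by (rule sum.swap)
  also have "\<dots> = (\<Sum>y\<in>X. poly_value P x y * poly_value Q y z)"
    unfolding poly_value_def sum_product ..
  finally show ?thesis .
qed

lemma poly_value_smult: "poly_value (Poly_Mapping.single 0 c * P) x y = c * poly_value P x y"
proof -
  have "Poly_Mapping.single 0 c * P = (\<Sum>m\<in>Poly_Mapping.keys P. Poly_Mapping.single m (c * Poly_Mapping.lookup P m))"
    by (subst poly_mapping_sum_single[of P]) (simp add: sum_distrib_left mult_single)
  then show ?thesis
    by (simp add: poly_value_sum poly_value_single mult.assoc flip: sum_distrib_left)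
      (simp add: poly_value_def)
qed

lemma poly_value_one: "poly_value 1 = e 0"
proof (intro ext)
  fix x y
  have "poly_value (Poly_Mapping.single 0 1) x y = e 0 x y"
    unfolding poly_value_single monomial_value_def by simp
  then show "poly_value 1 x y = e 0 x y" by simp
qed

text \<open>Monomials are gathered by weighted degree, and from degree \<open>p ^ l\<close> on
  \<open>e\<close> vanishes. These coefficients serve both for membership in the carrier and for the
  kernel.\<close>

lemma poly_value_coeffs:
  "poly_value P = (\<lambda>x y. \<Sum>n<p ^ l.
     (\<Sum>m\<in>{m \<in> Poly_Mapping.keys P. digit_value p l m = n}.
        Poly_Mapping.lookup P m * of_nat (digit_weight p l m)) * e n x y)"
proof (intro ext)
  fix x y
  let ?K = "Poly_Mapping.keys P"
  let ?f = "\<lambda>m. Poly_Mapping.lookup P m * of_nat (digit_weight p l m) * e (digit_value p l m) x y"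
  have "poly_value P x y = sum ?f ?K"
    unfolding poly_value_def monomial_value_def by (simp add: mult_ac)
  also have "\<dots> = sum ?f {m \<in> ?K. digit_value p l m < p ^ l}"
    using e_beyond[of "digit_value p l _" x y] by (intro sum.mono_neutral_right) (auto simp: not_less[symmetric])
  also have "\<dots> = (\<Sum>n<p ^ l. sum ?f {m \<in> {m \<in> ?K. digit_value p l m < p ^ l}. digit_value p l m = n})"
    by (intro sum.group[symmetric]) auto
  also have "\<dots> = (\<Sum>n<p ^ l. (\<Sum>m\<in>{m \<in> ?K. digit_value p l m = n}.
        Poly_Mapping.lookup P m * of_nat (digit_weight p l m)) * e n x y)"
    unfolding sum_distrib_right by (intro sum.cong) auto
  finally show "poly_value P x y = \<dots>" .
qed

lemma poly_value_in_carrier: "poly_value P \<in> carrier A"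
  unfolding carrier_A by (rule CollectI, rule exI, rule conjI[OF _ TrueI], rule poly_value_coeffs)

lemma poly_value_surj:
  assumes "M \<in> carrier A"
  obtains P where "P \<in> carrier (mpoly_alg l)" "poly_value P = M"
proof -
  obtain c where M: "M = (\<lambda>x y. \<Sum>n<p ^ l. c n * e n x y)" using assms carrier_A by auto
  have p0: "p > 0" using prime_p prime_gt_0_nat by blast
  define dg where "dg n = (SOME m. Poly_Mapping.keys m \<subseteq> {1..l} \<and>
      (\<forall>k. Poly_Mapping.lookup m k < p) \<and> digit_value p l m = n)" for n
  have dg: "Poly_Mapping.keys (dg n) \<subseteq> {1..l} \<and> (\<forall>k. Poly_Mapping.lookup (dg n) k < p)
      \<and> digit_value p l (dg n) = n" if "n < p ^ l" for n
    unfolding dg_def by (rule someI_ex) (rule digit_value_surj[OF p0 that])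
  \<comment> \<open>The digits of \<open>n\<close> form a reduced monomial whose value is a nonzero
    multiple of \<open>e n\<close>; the coefficient divides by that multiple.\<close>
  let ?s = "\<lambda>n. Poly_Mapping.single (dg n) (c n / of_nat (digit_weight p l (dg n)))"
  define P where "P = (\<Sum>n<p ^ l. ?s n)"
  have "P \<in> carrier (mpoly_alg l)"
  proof -
    have "Poly_Mapping.keys m \<subseteq> {1..l}" if m: "m \<in> Poly_Mapping.keys P" for m
    proof -
      obtain n where "n < p ^ l" "m \<in> Poly_Mapping.keys (?s n)"
        using m keys_sum[of ?s "{..<p ^ l}"] unfolding P_def by blast
      then show ?thesis using dg[of n] by (auto split: if_splits)
    qed
    then show ?thesis unfolding mpoly_alg_simps by blast
  qed
  moreover have "poly_value P = M"
  proof (intro ext)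
    fix x y
    have "poly_value (?s n) x y = c n * e n x y" if "n < p ^ l" for n
      using dg[OF that] digit_weight_reduced[of "dg n"]
      unfolding poly_value_single monomial_value_def reduced_def by simp
    then show "poly_value P x y = M x y" unfolding P_def poly_value_sum M by simp
  qed
  ultimately show ?thesis using that by blast
qed

text \<open>Independence of the \<open>e n\<close> isolates one degree. There, only one monomial is
  reduced, by uniqueness of base \<open>p\<close> digits, and the others have weight zero in the
  field; so the coefficient of a reduced monomial would have to vanish.\<close>

lemma poly_value_eq_0_imp:
  assumes P: "P \<in> carrier (mpoly_alg l)" and zero: "poly_value P = (\<lambda>x y. 0)"
    and m: "m \<in> Poly_Mapping.keys P"
  shows "\<not> reduced m"
proof
  assume red: "reduced m"
  let ?K = "Poly_Mapping.keys P" and ?n = "digit_value p l m"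
  let ?Q = "\<lambda>n. {m \<in> ?K. digit_value p l m = n}"
  let ?w = "\<lambda>m. Poly_Mapping.lookup P m * of_nat (digit_weight p l m) :: 'f"
  have n: "?n < p ^ l" using red unfolding reduced_def by (intro digit_value_less) auto
  have "(\<Sum>n<p ^ l. sum ?w (?Q n) * e n x y) = 0" for x y
    using zero poly_value_coeffs[of P] by metis
  then have "sum ?w (?Q ?n) = 0" using e_independent[of "\<lambda>n. sum ?w (?Q n)"] n by blast
  moreover have "sum ?w (?Q ?n) = sum ?w {m}"
  proof (rule sum.mono_neutral_right)
    show "\<forall>m'\<in>?Q ?n - {m}. ?w m' = 0"
    proof
      fix m' assume m': "m' \<in> ?Q ?n - {m}"
      have "\<not> reduced m'"
      proof
        assume red': "reduced m'"
        have "Poly_Mapping.lookup m' k = Poly_Mapping.lookup m k" for k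
        proof (cases "k \<in> {1..l}")
          case True
          then show ?thesis using digit_value_inj[of l m' p m k] red red' m'
            unfolding reduced_def by auto
        next
          case False
          have "Poly_Mapping.keys m \<subseteq> {1..l}" "Poly_Mapping.keys m' \<subseteq> {1..l}"
            using P m m' unfolding mpoly_alg_simps by auto
          then have "k \<notin> Poly_Mapping.keys m" "k \<notin> Poly_Mapping.keys m'" using False by auto
          then show ?thesis by (simp add: in_keys_iff)
        qed
        then have "m' = m" by (rule poly_mapping_eqI)
        then show False using m' by simp
      qed
      then obtain k where "k \<in> {1..l}" "p \<le> Poly_Mapping.lookup m' k"
        unfolding reduced_def by (meson not_le)
      then have "p dvd digit_weight p l m'" using prime_dvd_digit_weight prime_p by blast
      then show "?w m' = 0" using char_f by (simp add: of_nat_eq_0_iff_char_dvd)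
    qed
  qed (use m in auto)
  ultimately show False using m digit_weight_reduced[OF red] by (simp add: in_keys_iff)
qed

lemma poly_value_ring_hom: "ring_hom_ring (mpoly_alg l) A poly_value"
proof (rule ring_hom_ringI)
  show "ring (mpoly_alg l)" using mpoly_cring cring.axioms(1) by blast
  show "ring A" by (rule ring_A)
  show "poly_value \<one>\<^bsub>mpoly_alg l\<^esub> = \<one>\<^bsub>A\<^esub>"
    unfolding one_A mpoly_alg_simps(3) by (rule poly_value_one)
qed (auto simp: poly_value_in_carrier mpoly_alg_simps(2-6) mult_A add_A poly_value_mult
    poly_value_add fun_eq_iff)

abbreviation "trunc_ideal \<equiv> genideal (mpoly_alg l) ((\<lambda>i. mvar i ^ p) ` {1..l}) :: ((nat \<Rightarrow>\<^sub>0 nat) \<Rightarrow>\<^sub>0 'f) set"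

lemma mvar_power_in_carrier: "(\<lambda>i. mvar i ^ p) ` {1..l} \<subseteq> carrier (mpoly_alg l)"
proof
  fix P assume "P \<in> (\<lambda>i. mvar i ^ p) ` {1..l}"
  then obtain k where k: "k \<in> {1..l}" "P = mvar k ^ p" by blast
  show "P \<in> carrier (mpoly_alg l)"
    unfolding k(2) mvar_power using k(1) by (intro mpoly_closed_single) auto
qed

text \<open>A monomial that is not reduced is a multiple of some \<open>mvar k ^ p\<close>, and
  polynomials of value zero consist of such monomials. The opposite inclusion only concerns the
  generators.\<close>

lemma kernel_poly_value: "a_kernel (mpoly_alg l) A poly_value = trunc_ideal"
proof
  interpret M: cring "mpoly_alg l" by (rule mpoly_cring)
  interpret h: ring_hom_ring "mpoly_alg l" A poly_value by (rule poly_value_ring_hom)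
  interpret I: ideal trunc_ideal "mpoly_alg l"
    using mvar_power_in_carrier by (rule M.genideal_ideal)
  show "a_kernel (mpoly_alg l) A poly_value \<subseteq> trunc_ideal"
  proof
    fix P assume "P \<in> a_kernel (mpoly_alg l) A poly_value"
    then have P: "P \<in> carrier (mpoly_alg l)" "poly_value P = (\<lambda>x y. 0)"
      unfolding a_kernel_def' zero_A by auto
    have single: "Poly_Mapping.single m c \<in> trunc_ideal" if m: "m \<in> Poly_Mapping.keys P" for m c
    proof -
      have "\<not> reduced m" using poly_value_eq_0_imp P m by blast
      then obtain k where k: "k \<in> {1..l}" "p \<le> Poly_Mapping.lookup m k"
        unfolding reduced_def by (meson not_le)
      let ?m = "m - Poly_Mapping.single k p"
      have "m = ?m + Poly_Mapping.single k p"
        by (rule poly_mapping_eqI) (use k in \<open>auto simp: lookup_add lookup_minus lookup_single when_def\<close>)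
      then have "Poly_Mapping.single m c = Poly_Mapping.single ?m c * mvar k ^ p"
        unfolding mvar_power by (simp add: mult_single)
      moreover have "mvar k ^ p \<in> trunc_ideal"
        using k M.genideal_self[OF mvar_power_in_carrier] by blast
      moreover have "Poly_Mapping.keys ?m \<subseteq> Poly_Mapping.keys m"
        by (auto simp: in_keys_iff lookup_minus)
      then have "Poly_Mapping.single ?m c \<in> carrier (mpoly_alg l)"
        using P(1) m unfolding mpoly_alg_simps(1) by (auto split: if_splits)
      ultimately show ?thesis using I.I_l_closed by (simp add: mpoly_alg_simps(2-6))
    qed
    have "(\<Sum>m\<in>S. Poly_Mapping.single m (Poly_Mapping.lookup P m)) \<in> trunc_ideal"
      if "S \<subseteq> Poly_Mapping.keys P" for S
      using that
    proof (induction S rule: infinite_finite_induct)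
      case (insert m S)
      then show ?case
        using I.a_closed[OF single, of m] by (simp add: mpoly_alg_simps(2-6))
    qed (use I.zero_closed in \<open>auto simp: mpoly_alg_simps(2-6)\<close>)
    from this[OF order_refl] show "P \<in> trunc_ideal" by (simp only: poly_mapping_sum_single[of P, symmetric])
  qed
  show "trunc_ideal \<subseteq> a_kernel (mpoly_alg l) A poly_value"
  proof (rule M.genideal_minimal[OF h.kernel_is_ideal])
    show "(\<lambda>i. mvar i ^ p) ` {1..l} \<subseteq> a_kernel (mpoly_alg l) A poly_value"
    proof
      fix P :: "(nat \<Rightarrow>\<^sub>0 nat) \<Rightarrow>\<^sub>0 'f"
      assume P: "P \<in> (\<lambda>i. mvar i ^ p) ` {1..l}"
      then obtain k where k: "k \<in> {1..l}" "P = mvar k ^ p" by blast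
      have "\<not> reduced (Poly_Mapping.single k p)"
        using k(1) unfolding reduced_def by (auto intro!: bexI[of _ k])
      then have "poly_value P = (\<lambda>x y. 0)"
        unfolding k(2) mvar_power by (simp add: poly_value_single monomial_value_not_reduced fun_eq_iff)
      then show "P \<in> a_kernel (mpoly_alg l) A poly_value"
        using P mvar_power_in_carrier unfolding a_kernel_def' zero_A by blast
    qed
  qed
qed

theorem alg_isomorphic_truncated_poly: "alg_isomorphic A (truncated_poly_alg l p)"
proof -
  interpret M: cring "mpoly_alg l" by (rule mpoly_cring)
  interpret h: ring_hom_ring "mpoly_alg l" A poly_value by (rule poly_value_ring_hom)
  interpret I: ideal trunc_ideal "mpoly_alg l"
    using mvar_power_in_carrier by (rule M.genideal_ideal)
  let ?R = "mpoly_alg l :: ('f, (nat \<Rightarrow>\<^sub>0 nat) \<Rightarrow>\<^sub>0 'f) module"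
  let ?Q = "?R Quot trunc_ideal" and ?B = "truncated_poly_alg l p :: ('f, ((nat \<Rightarrow>\<^sub>0 nat) \<Rightarrow>\<^sub>0 'f) set) module"
  define g where "g C = the_elem (poly_value ` C)" for C
  have surj: "poly_value ` carrier ?R = carrier A"
  proof
    show "carrier A \<subseteq> poly_value ` carrier ?R"
    proof
      fix M assume "M \<in> carrier A"
      then obtain P where "P \<in> carrier ?R" "poly_value P = M" by (rule poly_value_surj)
      then show "M \<in> poly_value ` carrier ?R" by blast
    qed
  qed (use poly_value_in_carrier in blast)
  have g_iso: "g \<in> ring_iso ?Q A"
    using h.FactRing_iso_set[OF surj] unfolding kernel_poly_value g_def .
  have g_coset: "g (trunc_ideal +>\<^bsub>?R\<^esub> P) = poly_value P" if "P \<in> carrier ?R" for P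
    using h.the_elem_simp[OF that] unfolding kernel_poly_value g_def .
  have bij: "bij_betw g (carrier ?Q) (carrier A)" using g_iso unfolding ring_iso_def by blast
  \<comment> \<open>The isomorphism theorem leads from the quotient to \<open>A\<close>, whereas
    \<open>alg_isomorphic\<close> asks for a map out of \<open>A\<close>.\<close>
  define f where "f = inv_into (carrier ?Q) g"
  have f_iso: "f \<in> ring_iso A ?Q"
    unfolding f_def using g_iso I.quotient_is_ring by (intro ring_iso_set_sym)
  then have f_iso': "f \<in> ring_iso A ?B"
    unfolding truncated_poly_alg_def quot_alg_def ring_iso_def ring_hom_def by simp
  have coset_carrier: "trunc_ideal +>\<^bsub>?R\<^esub> P \<in> carrier ?Q" if "P \<in> carrier ?R" for P
    using that unfolding FactRing_def A_RCOSETS_def' by auto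
  have f_value: "f (poly_value P) = trunc_ideal +>\<^bsub>?R\<^esub> P" if "P \<in> carrier ?R" for P
    unfolding f_def g_coset[OF that, symmetric]
    using bij coset_carrier[OF that] by (simp add: bij_betw_def)
  have "f (c \<odot>\<^bsub>A\<^esub> M) = c \<odot>\<^bsub>?B\<^esub> f M" if M: "M \<in> carrier A" for c M
  proof -
    obtain P where P: "P \<in> carrier ?R" "poly_value P = M" using poly_value_surj[OF M] .
    let ?c = "Poly_Mapping.single 0 c"
    have c: "?c \<in> carrier ?R" by (intro mpoly_closed_single) simp
    have cP: "?c * P \<in> carrier ?R" using mpoly_closed_mult c P by blast
    have "c \<odot>\<^bsub>A\<^esub> M = poly_value (?c * P)"
      unfolding smult_A P(2)[symmetric] by (simp add: fun_eq_iff poly_value_smult)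
    then have lhs: "f (c \<odot>\<^bsub>A\<^esub> M) = trunc_ideal +>\<^bsub>?R\<^esub> (?c * P)" using f_value[OF cP] by simp
    \<comment> \<open>The scalar action on a coset is a union over its members. The constant
      polynomial \<open>?c\<close> sends all members into one coset, so the union collapses to
      it.\<close>
    have "trunc_ideal +>\<^bsub>?R\<^esub> (?c * x) = trunc_ideal +>\<^bsub>?R\<^esub> (?c * P)"
      if x: "x \<in> trunc_ideal +>\<^bsub>?R\<^esub> P" for x
    proof -
      obtain i where i: "i \<in> trunc_ideal" "x = i + P"
        using x unfolding a_r_coset_def' by (auto simp: mpoly_alg_simps(2-6))
      have ci: "?c * i \<in> trunc_ideal" using I.I_l_closed[OF i(1) c] by (simp add: mpoly_alg_simps(2-6))
      have "?c * x = ?c * i + ?c * P" unfolding i(2) by (simp add: distrib_left)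
      then have "?c * x \<in> trunc_ideal +>\<^bsub>?R\<^esub> (?c * P)"
        using ci unfolding a_r_coset_def' by (auto simp: mpoly_alg_simps(2-6))
      then show ?thesis using I.a_repr_independence'[OF _ cP] by simp
    qed
    moreover have "P \<in> trunc_ideal +>\<^bsub>?R\<^esub> P" using I.a_rcos_self[OF P(1)] .
    ultimately have "(\<Union>x\<in>trunc_ideal +>\<^bsub>?R\<^esub> P. trunc_ideal +>\<^bsub>?R\<^esub> (?c * x)) = trunc_ideal +>\<^bsub>?R\<^esub> (?c * P)"
      by blast
    then show ?thesis
      unfolding lhs unfolding P(2)[symmetric] f_value[OF P(1)]
      by (simp add: truncated_poly_alg_def quot_alg_def mpoly_alg_simps(6))
  qed
  then show ?thesis unfolding alg_isomorphic_def using f_iso' by blast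
qed

end

section \<open>The adjacency algebra\<close>

text \<open>Zorn's lemma for the ideals that contain \<open>I\<close> and omit the unit element; the
  union of a chain of these still omits it.\<close>

lemma (in cring) exists_maximalideal:
  assumes I: "ideal I R" and "\<one> \<notin> I"
  obtains M where "maximalideal M R" "I \<subseteq> M"
proof -
  let ?A = "{J. ideal J R \<and> I \<subseteq> J \<and> \<one> \<notin> J}"
  have "\<exists>M\<in>?A. \<forall>J\<in>?A. M \<subseteq> J \<longrightarrow> J = M"
  proof (rule subset_Zorn_nonempty)
    show "?A \<noteq> {}" using assms by blast
    fix C assume C: "C \<noteq> {}" "subset.chain ?A C"
    then have "subset.chain {J. ideal J R} C" unfolding subset_chain_def by blast
    then have "ideal (\<Union>C) R" using chain_Union_is_ideal[of C] C(1) by simp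
    then show "\<Union>C \<in> ?A" using C unfolding subset_chain_def by blast
  qed
  then obtain M where "M \<in> ?A" and max: "\<forall>J\<in>?A. M \<subseteq> J \<longrightarrow> J = M"
    by (elim bexE)
  then have M: "ideal M R" "I \<subseteq> M" "\<one> \<notin> M" by auto
  have "maximalideal M R"
  proof (rule maximalidealI[OF M(1)])
    show "carrier R \<noteq> M" using M(3) one_closed by blast
    fix J assume J: "ideal J R" "M \<subseteq> J" "J \<subseteq> carrier R"
    show "J = M \<or> J = carrier R"
    proof (cases "\<one> \<in> J")
      case True
      then show ?thesis using ideal.one_imp_carrier[OF J(1)] by blast
    next
      case False
      then have "J \<in> ?A" using M(2) J(1,2) by simp
      then show ?thesis using max J(2) by simp
    qed
  qed
  then show ?thesis using that M(2) by blast
qed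

text \<open>The maximal ideals above the two principal ideals coincide and contain the sum.
  Non-units appear as generators of proper ideals, the form that \<open>one_notin_cgenideal\<close>
  delivers.\<close>

lemma (in cring) unique_maximalideal_nonunits:
  assumes local: "\<exists>!I. maximalideal I R"
    and a: "a \<in> carrier R" "\<one> \<notin> PIdl a" and b: "b \<in> carrier R" "\<one> \<notin> PIdl b"
  shows "a \<oplus> b \<noteq> \<one>"
proof
  assume sum: "a \<oplus> b = \<one>"
  obtain M where M: "maximalideal M R" "PIdl a \<subseteq> M"
    using exists_maximalideal[OF cgenideal_ideal[OF a(1)] a(2)] .
  obtain N where N: "maximalideal N R" "PIdl b \<subseteq> N"
    using exists_maximalideal[OF cgenideal_ideal[OF b(1)] b(2)] .
  have "M = N" using local M(1) N(1) by blast
  interpret M: maximalideal M R by (rule M(1))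
  have "a \<in> M" "b \<in> M" using M(2) N(2) \<open>M = N\<close> cgenideal_self a(1) b(1) by auto
  then have "\<one> \<in> M" using sum M.a_closed by metis
  then show False using M.one_imp_carrier M.I_notcarr by blast
qed

text \<open>The matrix of \<open>s choose t\<close> is triangular with ones on the diagonal, hence
  invertible over every field.\<close>

lemma binomial_basis_spans:
  fixes g :: "nat \<Rightarrow> 'f::field"
  shows "\<exists>c. \<forall>s\<le>d. g s = (\<Sum>t\<le>d. c t * of_nat (s choose t))"
proof (induction d)
  case 0
  then show ?case by (intro exI[of _ g]) simp
next
  case (Suc d)
  then obtain c where c: "\<And>s. s \<le> d \<Longrightarrow> g s = (\<Sum>t\<le>d. c t * of_nat (s choose t))" by blast
  define c' where "c' = c(Suc d := g (Suc d) - (\<Sum>t\<le>d. c t * of_nat (Suc d choose t)))"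
  have low: "(\<Sum>t\<le>d. c' t * of_nat (s choose t)) = (\<Sum>t\<le>d. c t * of_nat (s choose t))" for s
    unfolding c'_def by (intro sum.cong) auto
  have "g s = (\<Sum>t\<le>Suc d. c' t * of_nat (s choose t))" if "s \<le> Suc d" for s
  proof (cases "s = Suc d")
    case True
    then show ?thesis using low[of "Suc d"] by (simp add: c'_def del: binomial_Suc_Suc)
  next
    case False
    then show ?thesis using low[of s] c[of s] that by (simp add: binomial_eq_0)
  qed
  then show ?case by blast
qed

lemma binomial_basis_independent:
  fixes c :: "nat \<Rightarrow> 'f::field"
  assumes zero: "\<And>s. s \<le> d \<Longrightarrow> (\<Sum>t\<le>d. c t * of_nat (s choose t)) = 0" and "t \<le> d"
  shows "c t = 0"
  using assms(2)
proof (induction t rule: less_induct)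
  case (less s)
  have "(\<Sum>t\<le>d. c t * of_nat (s choose t)) = (\<Sum>t\<in>{s}. c t * of_nat (s choose t))"
  proof (rule sum.mono_neutral_right)
    show "\<forall>t\<in>{..d} - {s}. c t * of_nat (s choose t) = 0"
    proof
      fix t assume "t \<in> {..d} - {s}"
      then show "c t * of_nat (s choose t) = 0"
        using less.IH[of t] by (cases "t < s") (auto simp: binomial_eq_0)
    qed
  qed (use less in auto)
  then show ?case using zero[OF less.prems] by simp
qed

section \<open>Matrices of the scheme as functions of the intersection dimension\<close>

context hermitian_space
begin

lemma dual_polar_algebra_simps:
  "mult (dual_polar_algebra H d :: ('f::field, _) module) = (\<lambda>M N x z. \<Sum>y\<in>points. M x y * N y z)"
  "one (dual_polar_algebra H d :: ('f::field, _) module) = (\<lambda>x y. if x \<in> points \<and> x = y then 1 else 0)"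
  "zero (dual_polar_algebra H d :: ('f::field, _) module) = (\<lambda>x y. 0)"
  "add (dual_polar_algebra H d :: ('f::field, _) module) = (\<lambda>M N x y. M x y + N x y)"
  "module.smult (dual_polar_algebra H d :: ('f::field, _) module) = (\<lambda>a M x y. a * M x y)"
  unfolding dual_polar_algebra_def adjacency_algebra_def by simp_all

text \<open>Elements of the algebra are indexed by the dimension of \<open>x \<inter> y\<close>,
  which is \<open>d\<close> minus the index of the relation. Only the values of \<open>g\<close> up
  to \<open>d\<close> matter.\<close>

definition dim_matrix :: "(nat \<Rightarrow> 'f::field) \<Rightarrow> ('k ^ 'n) set \<Rightarrow> ('k ^ 'n) set \<Rightarrow> 'f" where
  "dim_matrix g x y = (if x \<in> points \<and> y \<in> points then g (vec.dim (x \<inter> y)) else 0)"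

lemma adjacency_sum_eq_dim_matrix:
  "(\<lambda>x y. \<Sum>i\<le>d. c i * adjacency_matrix (dual_polar_rel H d i) x y) = dim_matrix (\<lambda>s. c (d - s))"
proof (intro ext)
  fix x y
  show "(\<Sum>i\<le>d. c i * adjacency_matrix (dual_polar_rel H d i) x y) = dim_matrix (\<lambda>s. c (d - s)) x y"
  proof (cases "x \<in> points \<and> y \<in> points")
    case True
    let ?j = "d - vec.dim (x \<inter> y)"
    have "(\<Sum>i\<le>d. c i * adjacency_matrix (dual_polar_rel H d i) x y) = (\<Sum>i\<le>d. if i = ?j then c i else 0)"
      using True dim_Int_points_le[of x y]
      by (intro sum.cong) (auto simp: adjacency_matrix_def dual_polar_rel_def)
    then show ?thesis using True by (simp add: dim_matrix_def)
  qed (auto simp: adjacency_matrix_def dual_polar_rel_def dim_matrix_def)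
qed

lemma dim_matrix_cong:
  assumes "\<And>s. s \<le> d \<Longrightarrow> g s = g' s"
  shows "dim_matrix g = dim_matrix g'"
  using assms dim_Int_points_le unfolding dim_matrix_def by (intro ext) auto

lemma carrier_dual_polar_algebra:
  "carrier (dual_polar_algebra H d :: ('f::field, _) module) = range dim_matrix"
proof
  show "carrier (dual_polar_algebra H d :: ('f::field, _) module) \<subseteq> range dim_matrix"
    unfolding dual_polar_algebra_def adjacency_algebra_def by (auto simp: adjacency_sum_eq_dim_matrix)
  show "range dim_matrix \<subseteq> carrier (dual_polar_algebra H d :: ('f::field, _) module)"
  proof
    fix M :: "('k ^ 'n) set \<Rightarrow> ('k ^ 'n) set \<Rightarrow> 'f" assume "M \<in> range dim_matrix"
    then obtain g where M: "M = dim_matrix g" by blast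
    have "M = (\<lambda>x y. \<Sum>i\<le>d. g (d - i) * adjacency_matrix (dual_polar_rel H d i) x y)"
      unfolding adjacency_sum_eq_dim_matrix M by (rule dim_matrix_cong) simp
    then show "M \<in> carrier (dual_polar_algebra H d)"
      unfolding dual_polar_algebra_def adjacency_algebra_def by auto
  qed
qed

lemma dim_matrix_sym: "dim_matrix g x y = dim_matrix g y x"
  unfolding dim_matrix_def by (simp add: Int_commute)

text \<open>
  Symmetric matrices whose products are symmetric commute, so closure under products already
  gives commutativity.
\<close>

lemma cring_dual_polar_algebra:
  assumes "ring (dual_polar_algebra H d :: ('f::field, _) module)"
  shows "cring (dual_polar_algebra H d :: ('f::field, _) module)"
proof -
  let ?A = "dual_polar_algebra H d :: ('f, _) module"
  interpret A: ring ?A by (rule assms)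
  have "M \<otimes>\<^bsub>?A\<^esub> N = N \<otimes>\<^bsub>?A\<^esub> M" if MN: "M \<in> carrier ?A" "N \<in> carrier ?A" for M N
  proof (intro ext)
    fix x z
    have sym: "L u v = L v u" if "L \<in> carrier ?A" for L u v
      using that dim_matrix_sym unfolding carrier_dual_polar_algebra by auto
    have "(M \<otimes>\<^bsub>?A\<^esub> N) x z = (M \<otimes>\<^bsub>?A\<^esub> N) z x" using sym[OF A.m_closed[OF MN]] .
    also have "\<dots> = (N \<otimes>\<^bsub>?A\<^esub> M) x z"
      unfolding dual_polar_algebra_simps
      by (intro sum.cong refl) (simp only: sym[OF MN(1), of z] sym[OF MN(2), of x] mult.commute)
    finally show "(M \<otimes>\<^bsub>?A\<^esub> N) x z = (N \<otimes>\<^bsub>?A\<^esub> M) x z" .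
  qed
  then show ?thesis by (intro cring.intro assms comm_monoid.intro A.monoid_axioms comm_monoid_axioms.intro)
qed

text \<open>Every member of the principal ideal is a left multiple of \<open>M\<close> and so
  annihilates \<open>f\<close>, which the identity does not.\<close>

lemma one_notin_cgenideal:
  fixes f :: "('k ^ 'n) set \<Rightarrow> 'f::field"
  assumes M: "\<And>x. x \<in> points \<Longrightarrow> (\<Sum>y\<in>points. M x y * f y) = 0" and x0: "x0 \<in> points" "f x0 \<noteq> 0"
  shows "\<one>\<^bsub>dual_polar_algebra H d\<^esub> \<notin> PIdl\<^bsub>dual_polar_algebra H d\<^esub> M"
proof
  let ?A = "dual_polar_algebra H d :: ('f, _) module"
  assume "\<one>\<^bsub>?A\<^esub> \<in> PIdl\<^bsub>?A\<^esub> M"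
  then obtain N where N: "\<one>\<^bsub>?A\<^esub> = N \<otimes>\<^bsub>?A\<^esub> M" unfolding cgenideal_def by blast
  have "f x0 = (\<Sum>z\<in>points. if x0 = z then f z else 0)" using x0 by simp
  also have "\<dots> = (\<Sum>z\<in>points. \<one>\<^bsub>?A\<^esub> x0 z * f z)"
    using x0 unfolding dual_polar_algebra_simps by (intro sum.cong) auto
  also have "\<dots> = (\<Sum>z\<in>points. \<Sum>y\<in>points. N x0 y * (M y z * f z))"
    unfolding N dual_polar_algebra_simps sum_distrib_right by (simp only: mult.assoc)
  also have "\<dots> = (\<Sum>y\<in>points. \<Sum>z\<in>points. N x0 y * (M y z * f z))" by (rule sum.swap)
  also have "\<dots> = (\<Sum>y\<in>points. N x0 y * (\<Sum>z\<in>points. M y z * f z))"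
    by (simp only: sum_distrib_left)
  also have "\<dots> = 0" using M by simp
  finally show False using x0 by simp
qed

text \<open>
  The collinearity matrix has the eigenvectors \<open>1\<close> and \<open>f\<close>, the difference of the characteristic
  functions of two isotropic vectors; a local algebra forces their eigenvalues to coincide.
\<close>

lemma local_imp_eigenvalues_eq:
  assumes local: "local_algebra (dual_polar_algebra H d :: ('f::field, _) module)" and "d > 0"
  shows "of_nat (r ^ 3 * CARD('k) ^ (d - 1) + 1) = (0::'f)"
proof (rule ccontr)
  let ?A = "dual_polar_algebra H d :: ('f, _) module"
  let ?\<kappa> = "of_nat (r ^ 3 * qbinomial CARD('k) d (d - 1)) :: 'f"
  let ?\<delta> = "of_nat (r ^ 3 * CARD('k) ^ (d - 1) + 1) :: 'f"
  let ?N = "\<lambda>x y. Suc (vec.dim (x \<inter> y)) = d"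
  assume neq: "?\<delta> \<noteq> 0"
  have ex1: "\<exists>!I. maximalideal I ?A" using local unfolding local_algebra_def .
  then obtain I where "maximalideal I ?A" by blast
  then interpret I: maximalideal I ?A .
  interpret A: cring ?A using cring_dual_polar_algebra I.ring_axioms by blast
  obtain x0 where x0: "x0 \<in> points" using points_nonempty by blast
  obtain x1 where x1: "x1 \<in> points" "vec.dim (x0 \<inter> x1) = d - 1"
    using point_at_codim[OF x0, of 1] \<open>d > 0\<close> by auto
  have "x0 \<noteq> x1" using x1 dim_point[OF x0] \<open>d > 0\<close> by auto
  then obtain u v where u: "u \<in> x0" "u \<notin> x1" and v: "v \<in> x1" "v \<notin> x0"
    using point_eqI[OF x0 x1(1)] point_eqI[OF x1(1) x0] by blast
  have u0: "u \<noteq> 0" "H u u = 0" and v0: "v \<noteq> 0" "H v v = 0"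
    using u v vec.subspace_0[OF point_subspace[OF x0]] vec.subspace_0[OF point_subspace[OF x1(1)]]
      point_orthogonal[OF x0] point_orthogonal[OF x1(1)] by auto
  \<comment> \<open>The collinearity matrix applied to the characteristic function of
    \<open>w\<close>. From a point missing \<open>w\<close> exactly one neighbour contains it,
    whence the constant \<open>1\<close>, which cancels in the difference \<open>f\<close>.\<close>
  have count: "(\<Sum>y\<in>points. (if ?N x y then 1 else 0) * (if w \<in> y then 1 else 0))
      = 1 + (?\<kappa> - ?\<delta>) * (if w \<in> x then 1 else 0)"
    if x: "x \<in> points" and w: "w \<noteq> 0" "H w w = 0" for x w
  proof -
    have "(\<Sum>y\<in>points. (if ?N x y then 1 else 0) * (if w \<in> y then 1 else 0))
        = (\<Sum>y\<in>points. if ?N x y \<and> w \<in> y then 1 else (0::'f))"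
      by (intro sum.cong) auto
    also have "\<dots> = of_nat (card {y \<in> points. ?N x y \<and> w \<in> y})"
      by (simp add: sum.If_cases Int_def)
    also have "\<dots> = 1 + (?\<kappa> - ?\<delta>) * (if w \<in> x then 1 else 0)"
    proof (cases "w \<in> x")
      case True
      have "of_nat (card {y \<in> points. ?N x y \<and> w \<in> y} + r ^ 3 * CARD('k) ^ (d - 1)) = ?\<kappa>"
        unfolding card_neighbours_through[OF x \<open>d > 0\<close> True w(1)] ..
      then show ?thesis using True by (simp add: algebra_simps)
    next
      case False
      then show ?thesis using card_neighbours_through_outside[OF x False w(2)] by simp
    qed
    finally show ?thesis .
  qed
  define f where "f y = (if u \<in> y then 1 else 0) - (if v \<in> y then 1 else 0 :: 'f)" for y :: "('k ^ 'n) set"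
  \<comment> \<open>With \<open>A\<close> the collinearity matrix, \<open>a\<close> is
    \<open>(A - (\<kappa> - \<delta>)) / \<delta>\<close> and \<open>b\<close> is
    \<open>(\<kappa> - A) / \<delta>\<close>. Their sum is the identity, yet \<open>a\<close> kills
    \<open>f\<close> and \<open>b\<close> kills the constant function.\<close>
  define a where "a = dim_matrix (\<lambda>s. ((if Suc s = d then 1 else 0) - (if s = d then ?\<kappa> - ?\<delta> else 0)) / ?\<delta>)"
  define b where "b = dim_matrix (\<lambda>s. ((if s = d then ?\<kappa> else 0) - (if Suc s = d then 1 else 0)) / ?\<delta>)"
  have diag: "vec.dim (x \<inter> y) = d \<longleftrightarrow> y = x" if "x \<in> points" "y \<in> points" for x y
    using that dim_Int_points_less[of x y] dim_point by auto
  have act: "(\<Sum>y\<in>points. dim_matrix (\<lambda>s. (\<alpha> * (if Suc s = d then 1 else 0) + \<beta> * (if s = d then 1 else 0)) / ?\<delta>) x y * h y)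
      = (\<alpha> * (\<Sum>y\<in>points. (if ?N x y then 1 else 0) * h y) + \<beta> * h x) / ?\<delta>"
    if x: "x \<in> points" for x \<alpha> \<beta> h
  proof -
    have "(\<Sum>y\<in>points. dim_matrix (\<lambda>s. (\<alpha> * (if Suc s = d then 1 else 0) + \<beta> * (if s = d then 1 else 0)) / ?\<delta>) x y * h y)
        = (\<Sum>y\<in>points. (\<alpha> * ((if ?N x y then 1 else 0) * h y) + \<beta> * (if y = x then h y else 0)) / ?\<delta>)"
      using x diag[OF x] by (intro sum.cong) (auto simp: dim_matrix_def distrib_right)
    also have "\<dots> = (\<alpha> * (\<Sum>y\<in>points. (if ?N x y then 1 else 0) * h y) + \<beta> * h x) / ?\<delta>"
      using x by (simp add: sum.distrib flip: sum_divide_distrib sum_distrib_left)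
    finally show ?thesis .
  qed
  have "a \<in> carrier ?A" "b \<in> carrier ?A"
    unfolding a_def b_def carrier_dual_polar_algebra by auto
  moreover have "\<one>\<^bsub>?A\<^esub> \<notin> PIdl\<^bsub>?A\<^esub> a"
  proof (rule one_notin_cgenideal[of a f x0])
    fix x assume x: "x \<in> points"
    have a': "a = dim_matrix (\<lambda>s. (1 * (if Suc s = d then 1 else 0)
        + (- (?\<kappa> - ?\<delta>)) * (if s = d then 1 else 0)) / ?\<delta>)"
      unfolding a_def by (intro dim_matrix_cong) auto
    have "(\<Sum>y\<in>points. (if ?N x y then 1 else 0) * f y)
        = (\<Sum>y\<in>points. (if ?N x y then 1 else 0) * (if u \<in> y then 1 else 0))
          - (\<Sum>y\<in>points. (if ?N x y then 1 else 0) * (if v \<in> y then 1 else (0::'f)))"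
      unfolding f_def right_diff_distrib sum_subtractf ..
    also have "\<dots> = (?\<kappa> - ?\<delta>) * f x"
      unfolding count[OF x u0] count[OF x v0] f_def by (simp only: right_diff_distrib add_diff_cancel_left)
    finally have Nf: "(\<Sum>y\<in>points. (if ?N x y then 1 else 0) * f y) = (?\<kappa> - ?\<delta>) * f x" .
    show "(\<Sum>y\<in>points. a x y * f y) = 0"
      unfolding a' act[OF x] Nf by (simp only: mult_1 mult_minus_left right_minus div_0)
  qed (use x0 u v in \<open>auto simp: f_def\<close>)
  moreover have "\<one>\<^bsub>?A\<^esub> \<notin> PIdl\<^bsub>?A\<^esub> b"
  proof (rule one_notin_cgenideal[of b "\<lambda>_. 1" x0])
    fix x assume x: "x \<in> points"
    have b': "b = dim_matrix (\<lambda>s. ((- 1) * (if Suc s = d then 1 else 0)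
        + ?\<kappa> * (if s = d then 1 else 0)) / ?\<delta>)"
      unfolding b_def by (intro dim_matrix_cong) auto
    have "(\<Sum>y\<in>points. (if ?N x y then 1 else 0) * (1::'f)) = of_nat (card {y \<in> points. ?N x y})"
      by (simp add: sum.If_cases Int_def)
    also have "\<dots> = ?\<kappa>" unfolding card_neighbours[OF x \<open>d > 0\<close>] ..
    finally have N1: "(\<Sum>y\<in>points. (if ?N x y then 1 else 0) * (1::'f)) = ?\<kappa>" .
    show "(\<Sum>y\<in>points. b x y * 1) = 0"
      unfolding b' act[OF x] N1 by (simp only: mult_1 mult_1_right mult_minus_left left_minus div_0)
  qed (use x0 in auto)
  ultimately have "a \<oplus>\<^bsub>?A\<^esub> b \<noteq> \<one>\<^bsub>?A\<^esub>"
    using A.unique_maximalideal_nonunits[OF ex1] by blast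
  moreover have "a \<oplus>\<^bsub>?A\<^esub> b = \<one>\<^bsub>?A\<^esub>"
  proof (intro ext)
    fix x y
    have "a x y + b x y = (if x \<in> points \<and> x = y then 1 else 0)"
    proof (cases "x \<in> points \<and> y \<in> points")
      case True
      then show ?thesis
        using diag[of x y] neq
        unfolding a_def b_def dim_matrix_def by (auto simp flip: add_divide_distrib)
    qed (auto simp: a_def b_def dim_matrix_def)
    then show "(a \<oplus>\<^bsub>?A\<^esub> b) x y = \<one>\<^bsub>?A\<^esub> x y" unfolding dual_polar_algebra_simps .
  qed
  ultimately show False by blast
qed

lemma divided_power_matrices_dual_polar:
  assumes A: "ring (dual_polar_algebra H d :: ('f::field, _) module)" and "Factorial_Ring.prime p" "CHAR('f) = p"
    and dvd: "p dvd r + 1" and d: "p ^ l = Suc d"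
  shows "divided_power_matrices (dual_polar_algebra H d :: ('f, _) module) points
    (\<lambda>n. if n \<le> d then dim_matrix (\<lambda>s. of_nat (s choose (d - n))) else (\<lambda>x y. 0)) p l"
proof -
  let ?A = "dual_polar_algebra H d :: ('f, _) module"
  \<comment> \<open>The case distinction matters: for \<open>n > d\<close> the truncated
    \<open>d - n\<close> is zero, and \<open>s choose 0\<close> would give the all-one matrix
    instead of zero.\<close>
  define e :: "nat \<Rightarrow> ('k ^ 'n) set \<Rightarrow> ('k ^ 'n) set \<Rightarrow> 'f" where
    "e n = (if n \<le> d then dim_matrix (\<lambda>s. of_nat (s choose (d - n))) else (\<lambda>x y. 0))" for n
  have e_sum: "(\<lambda>x y. \<Sum>n<p ^ l. c n * e n x y)
      = dim_matrix (\<lambda>s. \<Sum>t\<le>d. c (d - t) * of_nat (s choose t))" for c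
  proof (intro ext)
    fix x y
    have "(\<Sum>n<p ^ l. c n * e n x y) = (\<Sum>n\<le>d. c n * dim_matrix (\<lambda>s. of_nat (s choose (d - n))) x y)"
      unfolding d lessThan_Suc_atMost by (intro sum.cong) (auto simp: e_def)
    also have "\<dots> = (\<Sum>t\<le>d. c (d - t) * dim_matrix (\<lambda>s. of_nat (s choose t)) x y)"
      by (rule sum.reindex_bij_witness[of _ "\<lambda>t. d - t" "\<lambda>t. d - t"]) auto
    also have "\<dots> = dim_matrix (\<lambda>s. \<Sum>t\<le>d. c (d - t) * of_nat (s choose t)) x y"
      unfolding dim_matrix_def by (cases "x \<in> points \<and> y \<in> points") auto
    finally show "(\<Sum>n<p ^ l. c n * e n x y)
      = dim_matrix (\<lambda>s. \<Sum>t\<le>d. c (d - t) * of_nat (s choose t)) x y" .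
  qed
  have "divided_power_matrices ?A points e p l"
  proof (rule divided_power_matrices.intro)
    show "ring ?A" by (rule A)
    show "carrier ?A = {(\<lambda>x y. \<Sum>n<p ^ l. c n * e n x y) |c. True}"
    proof (intro equalityI subsetI)
      fix M assume "M \<in> carrier ?A"
      then obtain g where M: "M = dim_matrix g" unfolding carrier_dual_polar_algebra by blast
      obtain c where c: "\<And>s. s \<le> d \<Longrightarrow> g s = (\<Sum>t\<le>d. c t * of_nat (s choose t))"
        using binomial_basis_spans[of d g] by blast
      have "M = (\<lambda>x y. \<Sum>n<p ^ l. c (d - n) * e n x y)"
        unfolding e_sum M by (rule dim_matrix_cong) (simp add: c)
      then show "M \<in> {(\<lambda>x y. \<Sum>n<p ^ l. c n * e n x y) |c. True}"
        by (intro CollectI exI[of _ "\<lambda>n. c (d - n)"] conjI TrueI)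
    next
      fix M assume "M \<in> {(\<lambda>x y. \<Sum>n<p ^ l. c n * e n x y) |c. True}"
      then show "M \<in> carrier ?A" unfolding e_sum carrier_dual_polar_algebra by auto
    qed
    show "\<one>\<^bsub>?A\<^esub> = e 0"
    proof (intro ext)
      fix x y
      \<comment> \<open>Distinct points meet in dimension less than \<open>d\<close>, so the matrix
        at index zero is the identity.\<close>
      have "(vec.dim (x \<inter> y) choose d) = (if x = y then 1 else 0)" if "x \<in> points" "y \<in> points"
        using that dim_point[of x] dim_Int_points_less[of x y] by (auto simp: binomial_eq_0)
      then show "\<one>\<^bsub>?A\<^esub> x y = e 0 x y"
        unfolding dual_polar_algebra_simps e_def dim_matrix_def by auto
    qed
    show "(\<Sum>y\<in>points. e i x y * e j y z) = of_nat (i + j choose i) * e (i + j) x z" for i j x z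
    proof (cases "i \<le> d \<and> j \<le> d \<and> x \<in> points \<and> z \<in> points")
      case True
      then have ij: "i \<le> d" "j \<le> d" and xz: "x \<in> points" "z \<in> points" by auto
      have "(\<Sum>y\<in>points. e i x y * e j y z)
          = of_nat (\<Sum>y\<in>points. (vec.dim (x \<inter> y) choose (d - i)) * (vec.dim (y \<inter> z) choose (d - j)))"
        unfolding of_nat_sum using ij xz by (intro sum.cong) (auto simp: e_def dim_matrix_def)
      also have "\<dots> = of_nat (if d \<le> (d - i) + (d - j)
          then ((2 * d - ((d - i) + (d - j))) choose (d - (d - j)))
            * (vec.dim (x \<inter> z) choose ((d - i) + (d - j) - d)) else 0)"
        using intersection_product_cong[OF dvd xz, of "d - i" "d - j"]
        by (simp add: of_nat_eq_iff_cong_CHAR assms(3) del: of_nat_sum of_nat_mult)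
      also have "\<dots> = of_nat (i + j choose i) * e (i + j) x z"
      proof (cases "i + j \<le> d")
        case le: True
        have "2 * d - ((d - i) + (d - j)) = i + j" "d - (d - j) = j" "(d - i) + (d - j) - d = d - (i + j)"
          "d \<le> (d - i) + (d - j)" using le by auto
        moreover have "(i + j choose j) = (i + j choose i)"
          using binomial_symmetric[of i "i + j"] by simp
        ultimately show ?thesis using le xz by (simp add: e_def dim_matrix_def)
      next
        case False
        then show ?thesis using ij by (simp add: e_def)
      qed
      finally show ?thesis .
    qed (auto simp: e_def dim_matrix_def)
    show "e n x y = 0" if "p ^ l \<le> n" for n x y using that d by (simp add: e_def)
    show "c n = 0" if c: "\<And>x y. (\<Sum>n<p ^ l. c n * e n x y) = 0" and n: "n < p ^ l" for c n
    proof -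
      obtain x0 where x0: "x0 \<in> points" using points_nonempty by blast
      \<comment> \<open>Evaluation at a point \<open>y\<close> with prescribed intersection
        dimension turns the matrix relation into one between binomials at every
        \<open>s\<close>.\<close>
      have "(\<Sum>t\<le>d. c (d - t) * of_nat (s choose t)) = 0" if s: "s \<le> d" for s
      proof -
        obtain y where y: "y \<in> points" "vec.dim (x0 \<inter> y) = s"
          using point_at_codim[OF x0, of "d - s"] s by auto
        then show ?thesis using c[of x0 y] fun_cong[OF fun_cong[OF e_sum[of c], of x0], of y] x0
          by (simp add: dim_matrix_def)
      qed
      then have "c (d - (d - n)) = 0"
        using binomial_basis_independent[of d "\<lambda>t. c (d - t)" "d - n"] by simp
      then show ?thesis using n d by simp
    qed
  qed (use assms in \<open>auto simp: dual_polar_algebra_simps\<close>)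
  then show ?thesis unfolding e_def .
qed

end

theorem theorem13:
  fixes H :: "'k::{field,finite} ^ 'n::finite \<Rightarrow> 'k ^ 'n \<Rightarrow> 'k"
    and p r l :: nat
  assumes "CHAR('f::field) = p" and "odd p"
    and "primepow r" and "odd r" and "\<not> p dvd r"
    and "l \<ge> 1"
    and "CARD('k) = r ^ 2"
    and "CARD('n) = 2 * (p ^ l - 1) + 1"
    and "hermitian_form r H" and "nondegenerate H"
    and "local_algebra (dual_polar_algebra H (p ^ l - 1)
           :: ('f, ('k ^ 'n) set \<Rightarrow> ('k ^ 'n) set \<Rightarrow> 'f) module)"
  shows "alg_isomorphic
           (dual_polar_algebra H (p ^ l - 1)
             :: ('f, ('k ^ 'n) set \<Rightarrow> ('k ^ 'n) set \<Rightarrow> 'f) module)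
           (truncated_poly_alg l p)"
proof -
  let ?A = "dual_polar_algebra H (p ^ l - 1) :: ('f, ('k ^ 'n) set \<Rightarrow> ('k ^ 'n) set \<Rightarrow> 'f) module"
  interpret hermitian_space H r "p ^ l - 1"
    using assms by unfold_locales auto
  have "p > 0" using assms(2) by (auto intro: Nat.gr0I)
  then have p: "Factorial_Ring.prime p" using prime_CHAR_semidom[where 'a = 'f] assms(1) by simp
  have "p ^ 1 \<le> p ^ l" using assms(6) \<open>p > 0\<close> by (intro power_increasing) auto
  then have d: "p ^ l - 1 > 0" using prime_gt_1_nat[OF p] by simp
  have "p dvd r ^ 3 * CARD('k) ^ (p ^ l - 1 - 1) + 1"
    using local_imp_eigenvalues_eq[OF assms(11) d] assms(1) of_nat_eq_0_iff_char_dvd by blast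
  \<comment> \<open>The exponent is \<open>2 d + 1\<close>; separating the square of
    \<open>r ^ d\<close> prepares for Fermat's theorem.\<close>
  also have "r ^ 3 * CARD('k) ^ (p ^ l - 1 - 1) = (r ^ (p ^ l - 1)) ^ 2 * r"
  proof -
    obtain m where "p ^ l - 1 = Suc m" using d gr0_implies_Suc by blast
    then show ?thesis
      using assms(7) by (simp add: power_mult_distrib power2_eq_square power3_eq_cube mult_ac)
  qed
  finally have dvd: "p dvd (r ^ (p ^ l - 1)) ^ 2 * r + 1" .
  have "[r ^ (p ^ l - 1) = 1] (mod p)"
  proof -
    have "p - 1 dvd p ^ l - 1"
      using power_diff_1_eq[of "int p" l] by (metis dvd_triv_left int_dvd_int_iff of_nat_1 of_nat_diff of_nat_power one_le_power prime_ge_1_nat p)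
    then obtain m where m: "p ^ l - 1 = (p - 1) * m" by blast
    show ?thesis
      using cong_pow[OF fermat_theorem[OF p assms(5)], of m] unfolding m power_mult by simp
  qed
  then have "[(r ^ (p ^ l - 1)) ^ 2 * r + 1 = 1 ^ 2 * r + 1] (mod p)"
    by (intro cong_add cong_mult cong_pow cong_refl)
  then have "p dvd r + 1" using dvd cong_dvd_iff by (metis mult_1 power_one)
  \<comment> \<open>The ring axioms, closure under products included, come with the existence of a
    maximal ideal.\<close>
  moreover have "ring ?A"
    using assms(11) unfolding local_algebra_def
    by (meson maximalideal.axioms(1) ideal.axioms(2))
  moreover have "p ^ l = Suc (p ^ l - 1)" using \<open>p > 0\<close> by simp
  ultimately have "divided_power_matrices ?A (dual_polar_points H)
      (\<lambda>n. if n \<le> p ^ l - 1 then dim_matrix (\<lambda>s. of_nat (s choose (p ^ l - 1 - n))) else (\<lambda>x y. 0)) p l"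
    using divided_power_matrices_dual_polar p assms(1) by blast
  then show ?thesis by (rule divided_power_matrices.alg_isomorphic_truncated_poly)
qed

end
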